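(* Let $d\ge 1$ be an integer and let $\mathcal{M}$ be a $d$-cluster tilting subcategory of an abelian length category $\mathcal{A}$. Then the set $d\text{-}\mathrm{tors}(\mathcal{M})$ of all $d$-torsion classes in $\mathcal{M}$, ordered by inclusion, is a complete lattice with meet given by intersection.
   Context: Conventions: $\mathcal{A}$ is an essentially small abelian category in which every object has finite length. All subcategories are full and closed under isomorphisms, finite direct sums and direct summands. A subcategory $\mathcal{X}\subseteq\mathcal{A}$ is generating (cogenerating) if every object of $\mathcal{A}$ is a quotient of (a subobject of) an object of $\mathcal{X}$. A left $\mathcal{X}$-approximation of $Y\in\mathcal{A}$ is a morphism $Y\to X$ with $X\in\mathcal{X}$ through which every morphism from $Y$ to an object of $\mathcal{X}$ factors; right $\mathcal{X}$-approximations are dual. $\mathcal{X}$ is functorially finite if every object of $\mathcal{A}$ admits a left and a right $\mathcal{X}$-approximation. A functorially finite generating-cogenerating subcategory $\mathcal{M}\subseteq\mathcal{A}$ is $d$-cluster tilting if $$\mathcal{M}=\{X\in\mathcal{A}\mid \operatorname{Ext}^i_{\mathcal{A}}(X,M)=0 \ \forall M\in\mathcal{M},\ 1\le i\le d-1\}=\{Y\in\mathcal{A}\mid \operatorname{Ext}^i_{\mathcal{A}}(M,Y)=0\ \forall M\in\mathcal{M},\ 1\le i\le d-1\}.$$ A $d$-cokernel of a morphism $f_0\colon X_0\to X_1$ in $\mathcal{M}$ is a sequence $X_1\xrightarrow{f_1}X_2\to\cdots\xrightarrow{f_d}X_{d+1}\to 0$ in $\mathcal{M}$ such that for every $M\in\mathcal{M}$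 the sequence $0\to\operatorname{Hom}(X_{d+1},M)\to\cdots\to\operatorname{Hom}(X_1,M)\to\operatorname{Hom}(X_0,M)$ is exact. $d$-kernels are defined dually. A $d$-exact sequence in $\mathcal{M}$ is a sequence $0\to X_0\xrightarrow{f_0}X_1\to\cdots\to X_d\xrightarrow{f_d}X_{d+1}\to0$ in $\mathcal{M}$ such that $(f_1,\dots,f_d)$ is a $d$-cokernel of $f_0$ and $(f_0,\dots,f_{d-1})$ is a $d$-kernel of $f_d$. A subcategory $\mathcal{U}\subseteq\mathcal{M}$ is a $d$-torsion class in $\mathcal{M}$ if for every $M\in\mathcal{M}$ there is a $d$-exact sequence $0\to U_M\to M\to V_1\to\cdots\to V_d\to0$ in $\mathcal{M}$ with $U_M\in\mathcal{U}$ such that $0\to\operatorname{Hom}(U,V_1)\to\cdots\to\operatorname{Hom}(U,V_d)\to0$ is exact for every $U\in\mathcal{U}$. A poset is a complete lattice if every subset has a join (least upper bound) and a meet (greatest lower bound). *)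

theory Defs
  imports "HOL-Algebra.Exact_Sequence" "HOL-Algebra.Complete_Lattice"
begin

section \<open>Abelian categories\<close>

text \<open>Objects and arrows form sets, so the categories below are small.  This is what an essentially
  small category amounts to up to equivalence.  \<open>g \<cdot>\<^bsub>C\<^esub> f\<close> is \<open>g\<close> after \<open>f\<close>.\<close>

record ('o, 'm) preadd_cat =
  Obj :: "'o set"
  Arr :: "'m set"
  Dom :: "'m \<Rightarrow> 'o"
  Cod :: "'m \<Rightarrow> 'o"
  Comp :: "'m \<Rightarrow> 'm \<Rightarrow> 'm" (infixr \<open>\<cdot>\<index>\<close> 70)
  Ident :: "'o \<Rightarrow> 'm"
  Add :: "'m \<Rightarrow> 'm \<Rightarrow> 'm"
  Zero :: "'o \<Rightarrow> 'o \<Rightarrow> 'm"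

definition Hom :: "('o, 'm, 'z) preadd_cat_scheme \<Rightarrow> 'o \<Rightarrow> 'o \<Rightarrow> 'm set" where
  "Hom C X Y = {f \<in> Arr C. Dom C f = X \<and> Cod C f = Y}"

definition Hom_group :: "('o, 'm, 'z) preadd_cat_scheme \<Rightarrow> 'o \<Rightarrow> 'o \<Rightarrow> 'm monoid" where
  "Hom_group C X Y = \<lparr>carrier = Hom C X Y, monoid.mult = Add C, one = Zero C X Y\<rparr>"

locale category =
  fixes C :: "('o, 'm, 'z) preadd_cat_scheme" (structure)
  assumes dom_cod: "f \<in> Arr C \<Longrightarrow> Dom C f \<in> Obj C \<and> Cod C f \<in> Obj C"
    and ident_in_Hom: "X \<in> Obj C \<Longrightarrow> Ident C X \<in> Hom C X X"
    and comp_in_Hom: "\<lbrakk>f \<in> Hom C X Y; g \<in> Hom C Y Z\<rbrakk> \<Longrightarrow> g \<cdot> f \<in> Hom C X Z"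
    and comp_ident: "f \<in> Hom C X Y \<Longrightarrow> f \<cdot> Ident C X = f"
    and ident_comp: "f \<in> Hom C X Y \<Longrightarrow> Ident C Y \<cdot> f = f"
    and comp_assoc:
      "\<lbrakk>f \<in> Hom C W X; g \<in> Hom C X Y; h \<in> Hom C Y Z\<rbrakk> \<Longrightarrow> (h \<cdot> g) \<cdot> f = h \<cdot> (g \<cdot> f)"

locale preadditive_category = category +
  assumes Hom_comm_group: "\<lbrakk>X \<in> Obj C; Y \<in> Obj C\<rbrakk> \<Longrightarrow> comm_group (Hom_group C X Y)"
    and comp_add_left: "\<lbrakk>f \<in> Hom C X Y; g \<in> Hom C Y Z; h \<in> Hom C Y Z\<rbrakk> \<Longrightarrow>
      Add C g h \<cdot> f = Add C (g \<cdot> f) (h \<cdot> f)"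
    and comp_add_right: "\<lbrakk>f \<in> Hom C X Y; g \<in> Hom C X Y; h \<in> Hom C Y Z\<rbrakk> \<Longrightarrow>
      h \<cdot> Add C f g = Add C (h \<cdot> f) (h \<cdot> g)"

definition is_zero_object :: "('o, 'm, 'z) preadd_cat_scheme \<Rightarrow> 'o \<Rightarrow> bool" where
  "is_zero_object C Z \<longleftrightarrow> Z \<in> Obj C \<and>
     (\<forall>X\<in>Obj C. (\<exists>!f. f \<in> Hom C Z X) \<and> (\<exists>!f. f \<in> Hom C X Z))"

definition is_mono :: "('o, 'm, 'z) preadd_cat_scheme \<Rightarrow> 'm \<Rightarrow> bool" where
  "is_mono C m \<longleftrightarrow> m \<in> Arr C \<and>
     (\<forall>W. \<forall>g\<in>Hom C W (Dom C m). \<forall>h\<in>Hom C W (Dom C m). m \<cdot>\<^bsub>C\<^esub> g = m \<cdot>\<^bsub>C\<^esub> h \<longrightarrow> g = h)"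

definition is_epi :: "('o, 'm, 'z) preadd_cat_scheme \<Rightarrow> 'm \<Rightarrow> bool" where
  "is_epi C e \<longleftrightarrow> e \<in> Arr C \<and>
     (\<forall>W. \<forall>g\<in>Hom C (Cod C e) W. \<forall>h\<in>Hom C (Cod C e) W. g \<cdot>\<^bsub>C\<^esub> e = h \<cdot>\<^bsub>C\<^esub> e \<longrightarrow> g = h)"

definition is_iso :: "('o, 'm, 'z) preadd_cat_scheme \<Rightarrow> 'm \<Rightarrow> bool" where
  "is_iso C f \<longleftrightarrow> f \<in> Arr C \<and>
     (\<exists>g\<in>Hom C (Cod C f) (Dom C f).
        g \<cdot>\<^bsub>C\<^esub> f = Ident C (Dom C f) \<and> f \<cdot>\<^bsub>C\<^esub> g = Ident C (Cod C f))"

definition isomorphic :: "('o, 'm, 'z) preadd_cat_scheme \<Rightarrow> 'o \<Rightarrow> 'o \<Rightarrow> bool" where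
  "isomorphic C X Y \<longleftrightarrow> (\<exists>f\<in>Hom C X Y. is_iso C f)"

definition is_kernel :: "('o, 'm, 'z) preadd_cat_scheme \<Rightarrow> 'm \<Rightarrow> 'm \<Rightarrow> bool" where
  "is_kernel C k f \<longleftrightarrow> f \<in> Arr C \<and> k \<in> Arr C \<and> Cod C k = Dom C f \<and>
     f \<cdot>\<^bsub>C\<^esub> k = Zero C (Dom C k) (Cod C f) \<and>
     (\<forall>W. \<forall>h\<in>Hom C W (Dom C f). f \<cdot>\<^bsub>C\<^esub> h = Zero C W (Cod C f) \<longrightarrow>
        (\<exists>!u. u \<in> Hom C W (Dom C k) \<and> k \<cdot>\<^bsub>C\<^esub> u = h))"

definition is_cokernel :: "('o, 'm, 'z) preadd_cat_scheme \<Rightarrow> 'm \<Rightarrow> 'm \<Rightarrow> bool" where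
  "is_cokernel C c f \<longleftrightarrow> f \<in> Arr C \<and> c \<in> Arr C \<and> Dom C c = Cod C f \<and>
     c \<cdot>\<^bsub>C\<^esub> f = Zero C (Dom C f) (Cod C c) \<and>
     (\<forall>W. \<forall>h\<in>Hom C (Cod C f) W. h \<cdot>\<^bsub>C\<^esub> f = Zero C (Dom C f) W \<longrightarrow>
        (\<exists>!u. u \<in> Hom C (Cod C c) W \<and> u \<cdot>\<^bsub>C\<^esub> c = h))"

definition is_direct_sum :: "('o, 'm, 'z) preadd_cat_scheme \<Rightarrow> 'o \<Rightarrow> 'o \<Rightarrow> 'o \<Rightarrow> bool" where
  "is_direct_sum C S X Y \<longleftrightarrow> S \<in> Obj C \<and> X \<in> Obj C \<and> Y \<in> Obj C \<and>
     (\<exists>i\<in>Hom C X S. \<exists>j\<in>Hom C Y S. \<exists>p\<in>Hom C S X. \<exists>q\<in>Hom C S Y.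
        p \<cdot>\<^bsub>C\<^esub> i = Ident C X \<and> q \<cdot>\<^bsub>C\<^esub> j = Ident C Y \<and>
        p \<cdot>\<^bsub>C\<^esub> j = Zero C Y X \<and> q \<cdot>\<^bsub>C\<^esub> i = Zero C X Y \<and>
        Add C (i \<cdot>\<^bsub>C\<^esub> p) (j \<cdot>\<^bsub>C\<^esub> q) = Ident C S)"

locale abelian_category = preadditive_category +
  assumes zero_object: "\<exists>Z. is_zero_object C Z"
    and direct_sum: "\<lbrakk>X \<in> Obj C; Y \<in> Obj C\<rbrakk> \<Longrightarrow> \<exists>S. is_direct_sum C S X Y"
    and has_kernel: "f \<in> Arr C \<Longrightarrow> \<exists>k. is_kernel C k f"
    and has_cokernel: "f \<in> Arr C \<Longrightarrow> \<exists>c. is_cokernel C c f"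
    and mono_normal: "is_mono C m \<Longrightarrow> \<exists>f. is_kernel C m f"
    and epi_conormal: "is_epi C e \<Longrightarrow> \<exists>f. is_cokernel C e f"

definition is_simple :: "('o, 'm, 'z) preadd_cat_scheme \<Rightarrow> 'o \<Rightarrow> bool" where
  "is_simple C S \<longleftrightarrow> S \<in> Obj C \<and> \<not> is_zero_object C S \<and>
     (\<forall>m. is_mono C m \<and> Cod C m = S \<longrightarrow> is_zero_object C (Dom C m) \<or> is_iso C m)"

text \<open>Finite length is the existence of a composition series
  \<open>0 = F 0 \<subseteq> F 1 \<subseteq> \<dots> \<subseteq> F n = X\<close>, with inclusions \<open>j k\<close>.\<close>

definition has_finite_length :: "('o, 'm, 'z) preadd_cat_scheme \<Rightarrow> 'o \<Rightarrow> bool" where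
  "has_finite_length C X \<longleftrightarrow> (\<exists>(n :: nat) F j.
     is_zero_object C (F 0) \<and> F n = X \<and>
     (\<forall>k<n. j k \<in> Hom C (F k) (F (Suc k)) \<and> is_mono C (j k) \<and>
        (\<exists>c. is_cokernel C c (j k) \<and> is_simple C (Cod C c))))"

locale abelian_length_category = abelian_category +
  assumes finite_length: "X \<in> Obj C \<Longrightarrow> has_finite_length C X"


section \<open>Exact sequences and Yoneda Ext\<close>

definition is_image :: "('o, 'm, 'z) preadd_cat_scheme \<Rightarrow> 'm \<Rightarrow> 'm \<Rightarrow> bool" where
  "is_image C k f \<longleftrightarrow> (\<exists>c. is_cokernel C c f \<and> is_kernel C k c)"

definition exact_pair :: "('o, 'm, 'z) preadd_cat_scheme \<Rightarrow> 'm \<Rightarrow> 'm \<Rightarrow> bool" where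
  "exact_pair C f g \<longleftrightarrow> (\<exists>k. is_image C k f \<and> is_kernel C k g)"

text \<open>A sequence \<open>X\<^sub>0 \<rightarrow> X\<^sub>1 \<rightarrow> \<dots> \<rightarrow> X\<^sub>n\<close> is given by the nonempty list of its arrows.\<close>

definition is_sequence :: "('o, 'm, 'z) preadd_cat_scheme \<Rightarrow> 'm list \<Rightarrow> bool" where
  "is_sequence C fs \<longleftrightarrow> fs \<noteq> [] \<and> set fs \<subseteq> Arr C \<and>
     (\<forall>k. Suc k < length fs \<longrightarrow> Cod C (fs ! k) = Dom C (fs ! Suc k))"

definition objects :: "('o, 'm, 'z) preadd_cat_scheme \<Rightarrow> 'm list \<Rightarrow> 'o list" where
  "objects C fs = Dom C (hd fs) # map (Cod C) fs"

text \<open>The \<open>i\<close>-extensions \<open>0 \<rightarrow> Y \<rightarrow> E\<^sub>1 \<rightarrow> \<dots> \<rightarrow> E\<^sub>i \<rightarrow> X \<rightarrow> 0\<close>, their morphisms that are the identity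
  on \<open>X\<close> and \<open>Y\<close>, and the set of classes under the equivalence relation generated by these.
  These notions are meant for \<open>i \<ge> 1\<close> only.\<close>

definition extensions :: "('o, 'm, 'z) preadd_cat_scheme \<Rightarrow> nat \<Rightarrow> 'o \<Rightarrow> 'o \<Rightarrow> 'm list set" where
  "extensions C i X Y = {fs. length fs = i + 1 \<and> is_sequence C fs \<and>
     Dom C (hd fs) = Y \<and> Cod C (last fs) = X \<and>
     is_mono C (hd fs) \<and> is_epi C (last fs) \<and>
     (\<forall>k<i. exact_pair C (fs ! k) (fs ! Suc k))}"

definition extension_morphism ::
  "('o, 'm, 'z) preadd_cat_scheme \<Rightarrow> nat \<Rightarrow> 'o \<Rightarrow> 'o \<Rightarrow> ('m list \<times> 'm list) set" where
  "extension_morphism C i X Y =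
     {(fs, gs). fs \<in> extensions C i X Y \<and> gs \<in> extensions C i X Y \<and>
       (\<exists>a. a 0 = Ident C Y \<and> a (Suc i) = Ident C X \<and>
         (\<forall>k\<le>Suc i. a k \<in> Hom C (objects C fs ! k) (objects C gs ! k)) \<and>
         (\<forall>k\<le>i. gs ! k \<cdot>\<^bsub>C\<^esub> a k = a (Suc k) \<cdot>\<^bsub>C\<^esub> fs ! k))}"

definition extension_equiv ::
  "('o, 'm, 'z) preadd_cat_scheme \<Rightarrow> nat \<Rightarrow> 'o \<Rightarrow> 'o \<Rightarrow> ('m list \<times> 'm list) set" where
  "extension_equiv C i X Y =
     (extension_morphism C i X Y \<union> (extension_morphism C i X Y)\<inverse>)\<^sup>*
       \<inter> extensions C i X Y \<times> extensions C i X Y"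

definition Ext :: "('o, 'm, 'z) preadd_cat_scheme \<Rightarrow> nat \<Rightarrow> 'o \<Rightarrow> 'o \<Rightarrow> 'm list set set" where
  "Ext C i X Y = extensions C i X Y // extension_equiv C i X Y"

text \<open>The group structure of \<open>Ext\<close> (the Baer sum) is not needed to say that \<open>Ext\<close> is zero:
  a group is zero iff its underlying set has exactly one element.\<close>

definition Ext_zero :: "('o, 'm, 'z) preadd_cat_scheme \<Rightarrow> nat \<Rightarrow> 'o \<Rightarrow> 'o \<Rightarrow> bool" where
  "Ext_zero C i X Y \<longleftrightarrow> is_singleton (Ext C i X Y)"


section \<open>Cluster tilting subcategories\<close>

text \<open>Full subcategories are given by their sets of objects.  They are closed under isomorphisms,
  finite direct sums (including the empty one) and direct summands.\<close>

definition subcategory :: "('o, 'm, 'z) preadd_cat_scheme \<Rightarrow> 'o set \<Rightarrow> bool" where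
  "subcategory C \<X> \<longleftrightarrow> \<X> \<subseteq> Obj C \<and>
     (\<forall>X\<in>\<X>. \<forall>Y. isomorphic C X Y \<longrightarrow> Y \<in> \<X>) \<and>
     (\<forall>Z. is_zero_object C Z \<longrightarrow> Z \<in> \<X>) \<and>
     (\<forall>S X Y. is_direct_sum C S X Y \<longrightarrow> (S \<in> \<X> \<longleftrightarrow> X \<in> \<X> \<and> Y \<in> \<X>))"

definition generating :: "('o, 'm, 'z) preadd_cat_scheme \<Rightarrow> 'o set \<Rightarrow> bool" where
  "generating C \<X> \<longleftrightarrow> (\<forall>A\<in>Obj C. \<exists>X\<in>\<X>. \<exists>e\<in>Hom C X A. is_epi C e)"

definition cogenerating :: "('o, 'm, 'z) preadd_cat_scheme \<Rightarrow> 'o set \<Rightarrow> bool" where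
  "cogenerating C \<X> \<longleftrightarrow> (\<forall>A\<in>Obj C. \<exists>X\<in>\<X>. \<exists>m\<in>Hom C A X. is_mono C m)"

definition left_approximation ::
  "('o, 'm, 'z) preadd_cat_scheme \<Rightarrow> 'o set \<Rightarrow> 'o \<Rightarrow> 'm \<Rightarrow> bool" where
  "left_approximation C \<X> Y f \<longleftrightarrow> (\<exists>X\<in>\<X>. f \<in> Hom C Y X \<and>
     (\<forall>X'\<in>\<X>. \<forall>g\<in>Hom C Y X'. \<exists>h\<in>Hom C X X'. g = h \<cdot>\<^bsub>C\<^esub> f))"

definition right_approximation ::
  "('o, 'm, 'z) preadd_cat_scheme \<Rightarrow> 'o set \<Rightarrow> 'o \<Rightarrow> 'm \<Rightarrow> bool" where
  "right_approximation C \<X> Y f \<longleftrightarrow> (\<exists>X\<in>\<X>. f \<in> Hom C X Y \<and>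
     (\<forall>X'\<in>\<X>. \<forall>g\<in>Hom C X' Y. \<exists>h\<in>Hom C X' X. g = f \<cdot>\<^bsub>C\<^esub> h))"

definition functorially_finite :: "('o, 'm, 'z) preadd_cat_scheme \<Rightarrow> 'o set \<Rightarrow> bool" where
  "functorially_finite C \<X> \<longleftrightarrow>
     (\<forall>Y\<in>Obj C. (\<exists>f. left_approximation C \<X> Y f) \<and> (\<exists>f. right_approximation C \<X> Y f))"

definition cluster_tilting :: "('o, 'm, 'z) preadd_cat_scheme \<Rightarrow> nat \<Rightarrow> 'o set \<Rightarrow> bool" where
  "cluster_tilting C d \<M> \<longleftrightarrow> subcategory C \<M> \<and>
     functorially_finite C \<M> \<and> generating C \<M> \<and> cogenerating C \<M> \<and>
     \<M> = {X \<in> Obj C. \<forall>M\<in>\<M>. \<forall>i. 1 \<le> i \<and> i < d \<longrightarrow> Ext_zero C i X M} \<and>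
     \<M> = {Y \<in> Obj C. \<forall>M\<in>\<M>. \<forall>i. 1 \<le> i \<and> i < d \<longrightarrow> Ext_zero C i M Y}"


section \<open>Higher torsion classes\<close>

text \<open>Hom sequences are rendered with \<^const>\<open>exact_seq\<close>, whose lists start at the target end of the
  sequence.  For \<open>fs = [f\<^sub>0, \<dots>, f\<^sub>d]\<close> the first predicate below is therefore exactness of
  \<open>0 \<rightarrow> Hom(X\<^bsub>d+1\<^esub>, N) \<rightarrow> \<dots> \<rightarrow> Hom(X\<^sub>0, N)\<close>, and the lists for covariant Hom are reversed.
  There is no condition of surjectivity at the target end unless a zero group is put there.\<close>

definition d_cokernel :: "('o, 'm, 'z) preadd_cat_scheme \<Rightarrow> 'o set \<Rightarrow> nat \<Rightarrow> 'm \<Rightarrow> 'm list \<Rightarrow> bool" where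
  "d_cokernel C \<M> d f gs \<longleftrightarrow> length gs = d \<and> is_sequence C (f # gs) \<and>
     set (objects C (f # gs)) \<subseteq> \<M> \<and>
     (\<forall>N\<in>\<M>. let z = Zero C (Cod C (last (f # gs))) N in
        exact_seq (map (\<lambda>X. Hom_group C X N) (objects C (f # gs)) @ [singleton_group z],
                   map (\<lambda>h g. g \<cdot>\<^bsub>C\<^esub> h) (f # gs) @ [\<lambda>_. z]))"

definition d_kernel :: "('o, 'm, 'z) preadd_cat_scheme \<Rightarrow> 'o set \<Rightarrow> nat \<Rightarrow> 'm list \<Rightarrow> 'm \<Rightarrow> bool" where
  "d_kernel C \<M> d gs f \<longleftrightarrow> length gs = d \<and> is_sequence C (gs @ [f]) \<and>
     set (objects C (gs @ [f])) \<subseteq> \<M> \<and>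
     (\<forall>N\<in>\<M>. let z = Zero C N (Dom C (hd (gs @ [f]))) in
        exact_seq (rev (singleton_group z # map (\<lambda>X. Hom_group C N X) (objects C (gs @ [f]))),
                   rev ((\<lambda>_. z) # map (\<lambda>h g. h \<cdot>\<^bsub>C\<^esub> g) (gs @ [f]))))"

definition d_exact :: "('o, 'm, 'z) preadd_cat_scheme \<Rightarrow> 'o set \<Rightarrow> nat \<Rightarrow> 'm list \<Rightarrow> bool" where
  "d_exact C \<M> d fs \<longleftrightarrow> length fs = d + 1 \<and>
     d_cokernel C \<M> d (hd fs) (tl fs) \<and> d_kernel C \<M> d (butlast fs) (last fs)"

text \<open>In a \<open>d\<close>-exact sequence \<open>0 \<rightarrow> U\<^sub>M \<rightarrow> M \<rightarrow> V\<^sub>1 \<rightarrow> \<dots> \<rightarrow> V\<^sub>d \<rightarrow> 0\<close> the objects \<open>V\<^sub>1, \<dots>, V\<^sub>d\<close> and the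
  arrows between them are what remains after dropping the first two objects and arrows.\<close>

definition d_torsion_class :: "('o, 'm, 'z) preadd_cat_scheme \<Rightarrow> 'o set \<Rightarrow> nat \<Rightarrow> 'o set \<Rightarrow> bool" where
  "d_torsion_class C \<M> d \<U> \<longleftrightarrow> subcategory C \<U> \<and> \<U> \<subseteq> \<M> \<and>
     (\<forall>M\<in>\<M>. \<exists>fs. d_exact C \<M> d fs \<and> objects C fs ! 0 \<in> \<U> \<and> objects C fs ! 1 = M \<and>
       (\<forall>U\<in>\<U>. let Vs = drop 2 (objects C fs); z = Zero C U (hd Vs); z' = Zero C U (last Vs) in
          exact_seq
            (rev (singleton_group z # map (\<lambda>V. Hom_group C U V) Vs @ [singleton_group z']),
             rev ((\<lambda>_. z) # map (\<lambda>h g. h \<cdot>\<^bsub>C\<^esub> g) (drop 2 fs) @ [\<lambda>_. z']))))"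

definition d_tors :: "('o, 'm, 'z) preadd_cat_scheme \<Rightarrow> 'o set \<Rightarrow> nat \<Rightarrow> 'o set gorder" where
  "d_tors C \<M> d = \<lparr>carrier = {\<U>. d_torsion_class C \<M> d \<U>}, eq = (=), le = (\<subseteq>)\<rparr>"

end

theory Submission
  imports Defs
begin

text \<open>
  Let \<open>M\<close> be the cluster tilting subcategory, \<open>U\<close> a \<open>d\<close>-torsion class and \<open>Q \<in> M\<close>, with its
  \<open>d\<close>-exact sequence \<open>0 \<rightarrow> U\<^sub>Q \<rightarrow> Q \<rightarrow> V\<^sub>1 \<rightarrow> \<dots> \<rightarrow> V\<^sub>d \<rightarrow> 0\<close>.  Since the objects of \<open>M\<close> have no extensions
  among each other in the degrees \<open>1, \<dots>, d - 1\<close>, exactness of \<open>Hom(V, V\<^sub>1) \<rightarrow> \<dots> \<rightarrow> Hom(V, V\<^sub>d)\<close> for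
  \<open>V \<in> U\<close> amounts to two properties of the monomorphism \<open>U\<^sub>Q \<rightarrow> Q\<close>: every map \<open>V \<rightarrow> Q\<close> factors
  through it, and \<open>Ext\<^sup>d(V, U\<^sub>Q) \<rightarrow> Ext\<^sup>d(V, Q)\<close> is injective (\<open>d_torsion_classE\<close>,
  \<open>ext_injective_of_hom_exact\<close>).  Conversely, let \<open>j : L \<rightarrow> Q\<close> be a monomorphism with \<open>L \<in> U\<close> that
  has both properties for all \<open>V \<in> U\<close>.  Iterated left \<open>M\<close>-approximations of its cokernel complete
  \<open>j\<close> to a \<open>d\<close>-exact sequence, because the \<open>d\<close>-th cokernel has no extensions by \<open>M\<close> and therefore lies
  in \<open>M\<close> (\<open>mono_sequence\<close>), and this sequence is as required (\<open>d_torsion_classI\<close>).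

  Both properties are stable under composition.  Hence, given a family of torsion classes and
  \<open>Q \<in> M\<close>, take a monomorphism \<open>j : L \<rightarrow> Q\<close> with both properties for all \<open>V\<close> in the intersection, and
  with \<open>L\<close> of least length; the identity of \<open>Q\<close> shows that there is one.  If \<open>U\<close> belongs to the
  family, the composite \<open>U\<^sub>L \<rightarrow> L \<rightarrow> Q\<close> is another such monomorphism, so \<open>U\<^sub>L = L\<close> by minimality and
  \<open>L \<in> U\<close>.  Thus \<open>L\<close> lies in the intersection, which is therefore a torsion class
  (\<open>d_torsion_class_Inter\<close>).  The empty family gives the greatest element \<open>M\<close>, and a poset with all
  meets is a complete lattice.

  Membership in \<open>M\<close> is a condition on Yoneda extensions, while the argument above needs dimension
  shifting, in a category that need not have enough projectives or injectives.  The bridge is the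
  predicate \<open>acyclic k A\<close>, defined by recursion on syzygies with respect to \<open>M\<close>, which says that
  \<open>Ext\<^sup>i(A, N) = 0\<close> for \<open>1 \<le> i \<le> k\<close> and \<open>N \<in> M\<close>; its closure properties (\<open>acyclic_closure\<close>) are
  elementary.  It implies the vanishing of Ext because every extension of an acyclic object receives a
  morphism from one that splits at its left end (\<open>split_extension_above\<close>).  For the converse one needs
  an invariant that detects the zero class along the zigzags of morphisms that define the equivalence
  of extensions: the extension is effaced, that is, it dies when it is pulled back to the kernels of
  successive epimorphisms from \<open>M\<close> (\<open>effaced_preserve\<close>, \<open>effaced_reflect\<close>).
\<close>

section \<open>Diagram chasing in an abelian category\<close>

context category
begin

lemma Hom_iff [simp]: "f \<in> Hom C X Y \<longleftrightarrow> f \<in> Arr C \<and> Dom C f = X \<and> Cod C f = Y"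
  by (auto simp: Hom_def)

lemma dom_obj [simp]: "f \<in> Arr C \<Longrightarrow> Dom C f \<in> Obj C"
  and cod_obj [simp]: "f \<in> Arr C \<Longrightarrow> Cod C f \<in> Obj C"
  using dom_cod by auto

lemma comp_arr [simp]:
  assumes "f \<in> Arr C" "g \<in> Arr C" "Cod C f = Dom C g"
  shows "g \<cdot> f \<in> Arr C" "Dom C (g \<cdot> f) = Dom C f" "Cod C (g \<cdot> f) = Cod C g"
  using comp_in_Hom[of f "Dom C f" "Dom C g" g "Cod C g"] assms by auto

lemma assoc [simp]:
  assumes "f \<in> Arr C" "g \<in> Arr C" "h \<in> Arr C" "Cod C f = Dom C g" "Cod C g = Dom C h"
  shows "(h \<cdot> g) \<cdot> f = h \<cdot> (g \<cdot> f)"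
  using comp_assoc[of f "Dom C f" "Dom C g" g "Dom C h" h "Cod C h"] assms by auto

lemma ident_arr [simp]:
  assumes "X \<in> Obj C"
  shows "Ident C X \<in> Arr C" "Dom C (Ident C X) = X" "Cod C (Ident C X) = X"
  using ident_in_Hom[OF assms] by auto

lemma ident_left [simp]: "\<lbrakk>f \<in> Arr C; Cod C f = X\<rbrakk> \<Longrightarrow> Ident C X \<cdot> f = f"
  and ident_right [simp]: "\<lbrakk>f \<in> Arr C; Dom C f = X\<rbrakk> \<Longrightarrow> f \<cdot> Ident C X = f"
  using ident_comp[of f "Dom C f" "Cod C f"] comp_ident[of f "Dom C f" "Cod C f"] by auto

text \<open>Composites are normalised to the right, so an equation of two composites has to be available
  with a further arrow on the right.\<close>

lemma comp_eqD:
  assumes "a \<cdot> b = c \<cdot> d" "a \<in> Arr C" "b \<in> Arr C" "c \<in> Arr C" "d \<in> Arr C" "x \<in> Arr C"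
    "Dom C a = Cod C b" "Dom C c = Cod C d" "Cod C x = Dom C b" "Cod C x = Dom C d"
  shows "a \<cdot> b \<cdot> x = c \<cdot> d \<cdot> x"
  using assms assoc[of x b a] assoc[of x d c] by simp

lemma comp_eqD':
  assumes "a \<cdot> b = c" "a \<in> Arr C" "b \<in> Arr C" "x \<in> Arr C"
    "Dom C a = Cod C b" "Cod C x = Dom C b"
  shows "a \<cdot> b \<cdot> x = c \<cdot> x"
  using assms assoc[of x b a] by simp

end

context preadditive_category
begin

definition neg :: "'b \<Rightarrow> 'b" where
  "neg f = inv\<^bsub>Hom_group C (Dom C f) (Cod C f)\<^esub> f"

abbreviation diff :: "'b \<Rightarrow> 'b \<Rightarrow> 'b" where
  "diff f g \<equiv> Add C f (neg g)"

lemma Hom_group_simps [simp]: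
  "carrier (Hom_group C X Y) = Hom C X Y"
  "x \<otimes>\<^bsub>Hom_group C X Y\<^esub> y = Add C x y"
  "\<one>\<^bsub>Hom_group C X Y\<^esub> = Zero C X Y"
  by (simp_all add: Hom_group_def)

lemma Hom_group_group: "\<lbrakk>X \<in> Obj C; Y \<in> Obj C\<rbrakk> \<Longrightarrow> group (Hom_group C X Y)"
  using Hom_comm_group comm_group.axioms(2) by blast

lemma zero_arr [simp]:
  assumes "X \<in> Obj C" "Y \<in> Obj C"
  shows "Zero C X Y \<in> Arr C" "Dom C (Zero C X Y) = X" "Cod C (Zero C X Y) = Y"
  using group.is_monoid[OF Hom_group_group[OF assms], THEN monoid.one_closed] by auto

lemma add_arr [simp]:
  assumes "f \<in> Arr C" "g \<in> Arr C" "Dom C g = Dom C f" "Cod C g = Cod C f"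
  shows "Add C f g \<in> Arr C" "Dom C (Add C f g) = Dom C f" "Cod C (Add C f g) = Cod C f"
  using group.is_monoid[OF Hom_group_group[of "Dom C f" "Cod C f"], THEN monoid.m_closed, of f g] assms
  by auto

lemma neg_arr [simp]:
  assumes "f \<in> Arr C"
  shows "neg f \<in> Arr C" "Dom C (neg f) = Dom C f" "Cod C (neg f) = Cod C f"
  using group.inv_closed[OF Hom_group_group[of "Dom C f" "Cod C f"], of f] assms
  by (auto simp: neg_def)

lemma add_assoc:
  assumes "f \<in> Arr C" "g \<in> Arr C" "h \<in> Arr C" "Dom C g = Dom C f" "Cod C g = Cod C f"
    "Dom C h = Dom C f" "Cod C h = Cod C f"
  shows "Add C (Add C f g) h = Add C f (Add C g h)"
proof -
  interpret comm_group "Hom_group C (Dom C f) (Cod C f)"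
    using Hom_comm_group assms by simp
  show ?thesis
    using m_assoc[of f g h] assms by auto
qed

lemma add_comm:
  assumes "f \<in> Arr C" "g \<in> Arr C" "Dom C g = Dom C f" "Cod C g = Cod C f"
  shows "Add C f g = Add C g f"
proof -
  interpret comm_group "Hom_group C (Dom C f) (Cod C f)"
    using Hom_comm_group assms by simp
  show ?thesis
    using m_comm[of f g] assms by auto
qed

lemma add_zero [simp]:
  assumes "f \<in> Arr C"
  shows "X = Dom C f \<Longrightarrow> Y = Cod C f \<Longrightarrow> Add C f (Zero C X Y) = f"
    "X = Dom C f \<Longrightarrow> Y = Cod C f \<Longrightarrow> Add C (Zero C X Y) f = f"
    "X = Dom C f \<Longrightarrow> Y = Cod C f \<Longrightarrow> Add C f (neg f) = Zero C X Y"
    "X = Dom C f \<Longrightarrow> Y = Cod C f \<Longrightarrow> Add C (neg f) f = Zero C X Y"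
proof -
  interpret comm_group "Hom_group C (Dom C f) (Cod C f)"
    using Hom_comm_group assms by simp
  show "X = Dom C f \<Longrightarrow> Y = Cod C f \<Longrightarrow> Add C f (Zero C X Y) = f"
    "X = Dom C f \<Longrightarrow> Y = Cod C f \<Longrightarrow> Add C (Zero C X Y) f = f"
    "X = Dom C f \<Longrightarrow> Y = Cod C f \<Longrightarrow> Add C f (neg f) = Zero C X Y"
    "X = Dom C f \<Longrightarrow> Y = Cod C f \<Longrightarrow> Add C (neg f) f = Zero C X Y"
    using r_one[of f] l_one[of f] r_inv[of f] l_inv[of f] assms by (auto simp: neg_def)
qed

lemma add_cancel:
  assumes "Add C f g = Add C f h" "f \<in> Arr C" "g \<in> Arr C" "h \<in> Arr C"
    "Dom C g = Dom C f" "Cod C g = Cod C f" "Dom C h = Dom C f" "Cod C h = Cod C f"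
  shows "g = h"
proof -
  interpret comm_group "Hom_group C (Dom C f) (Cod C f)"
    using Hom_comm_group assms by simp
  show ?thesis
    using Units_l_cancel[of f g h] assms by (simp add: Units_eq)
qed

lemma diff_eq_zero:
  assumes "diff f g = Zero C X Y" "f \<in> Hom C X Y" "g \<in> Hom C X Y"
  shows "f = g"
proof -
  have "Add C (neg g) f = Add C (neg g) g"
    using assms add_comm[of f "neg g"] by simp
  then show ?thesis
    using assms add_cancel[of "neg g" f g] by simp
qed

lemma diff_add [simp]:
  assumes "f \<in> Arr C" "g \<in> Arr C" "Dom C g = Dom C f" "Cod C g = Cod C f"
  shows "Add C (diff f g) g = f" "diff (Add C f g) g = f"
  using assms by (simp_all add: add_assoc)

lemma comp_add [simp]:
  assumes "f \<in> Arr C" "g \<in> Arr C" "Dom C g = Dom C f" "Cod C g = Cod C f"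
  shows "\<lbrakk>h \<in> Arr C; Dom C h = Cod C f\<rbrakk> \<Longrightarrow> h \<cdot> Add C f g = Add C (h \<cdot> f) (h \<cdot> g)"
    "\<lbrakk>h \<in> Arr C; Cod C h = Dom C f\<rbrakk> \<Longrightarrow> Add C f g \<cdot> h = Add C (f \<cdot> h) (g \<cdot> h)"
  using comp_add_right[of f "Dom C f" "Cod C f" g h "Cod C h"]
    comp_add_left[of h "Dom C h" "Dom C f" f "Cod C f" g] assms by simp_all

lemma comp_zero [simp]:
  assumes "f \<in> Arr C" "W \<in> Obj C"
  shows "X = Dom C f \<Longrightarrow> f \<cdot> Zero C W X = Zero C W (Cod C f)"
    "Y = Cod C f \<Longrightarrow> Zero C Y W \<cdot> f = Zero C (Dom C f) W"
proof -
  have "Add C (f \<cdot> Zero C W (Dom C f)) (f \<cdot> Zero C W (Dom C f)) =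
      Add C (f \<cdot> Zero C W (Dom C f)) (Zero C W (Cod C f))"
    using comp_add(1)[of "Zero C W (Dom C f)" "Zero C W (Dom C f)" f] assms by simp
  from add_cancel[OF this] show "X = Dom C f \<Longrightarrow> f \<cdot> Zero C W X = Zero C W (Cod C f)"
    using assms by simp
  have "Add C (Zero C (Cod C f) W \<cdot> f) (Zero C (Cod C f) W \<cdot> f) =
      Add C (Zero C (Cod C f) W \<cdot> f) (Zero C (Dom C f) W)"
    using comp_add(2)[of "Zero C (Cod C f) W" "Zero C (Cod C f) W" f] assms by simp
  from add_cancel[OF this] show "Y = Cod C f \<Longrightarrow> Zero C Y W \<cdot> f = Zero C (Dom C f) W"
    using assms by simp
qed

lemma neg_unique:
  assumes "Add C f g = Zero C X Y" "f \<in> Hom C X Y" "g \<in> Hom C X Y"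
  shows "g = neg f"
  using assms add_cancel[of f g "neg f"] by simp

lemma neg_zero [simp]: "\<lbrakk>X \<in> Obj C; Y \<in> Obj C\<rbrakk> \<Longrightarrow> neg (Zero C X Y) = Zero C X Y"
  using neg_unique[of "Zero C X Y" "Zero C X Y" X Y] by simp

lemma neg_neg [simp]: "f \<in> Arr C \<Longrightarrow> neg (neg f) = f"
  using neg_unique[of "neg f" f "Dom C f" "Cod C f"] by simp

lemma comp_neg [simp]:
  assumes "f \<in> Arr C" "g \<in> Arr C" "Dom C g = Cod C f"
  shows "g \<cdot> neg f = neg (g \<cdot> f)" "neg g \<cdot> f = neg (g \<cdot> f)"
proof -
  have "Add C (g \<cdot> f) (g \<cdot> neg f) = g \<cdot> Add C f (neg f)"
    using assms by (subst comp_add(1)) auto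
  also have "\<dots> = Zero C (Dom C f) (Cod C g)"
    using assms by simp
  finally show "g \<cdot> neg f = neg (g \<cdot> f)"
    using assms by (intro neg_unique[of _ _ "Dom C f" "Cod C g"]) auto
  have "Add C (g \<cdot> f) (neg g \<cdot> f) = Add C g (neg g) \<cdot> f"
    using assms by (subst comp_add(2)) auto
  also have "\<dots> = Zero C (Dom C f) (Cod C g)"
    using assms by simp
  finally show "neg g \<cdot> f = neg (g \<cdot> f)"
    using assms by (intro neg_unique[of _ _ "Dom C f" "Cod C g"]) auto
qed

lemma mono_arr: "is_mono C m \<Longrightarrow> m \<in> Arr C"
  and epi_arr: "is_epi C m \<Longrightarrow> m \<in> Arr C"
  by (simp_all add: is_mono_def is_epi_def)

lemma mono_cancel:
  "\<lbrakk>is_mono C m; m \<cdot> g = m \<cdot> h; g \<in> Arr C; h \<in> Arr C; Cod C g = Dom C m; Cod C h = Dom C m;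
    Dom C g = Dom C h\<rbrakk> \<Longrightarrow> g = h"
  by (auto simp: is_mono_def)

lemma epi_cancel:
  "\<lbrakk>is_epi C e; g \<cdot> e = h \<cdot> e; g \<in> Arr C; h \<in> Arr C; Dom C g = Cod C e; Dom C h = Cod C e;
    Cod C g = Cod C h\<rbrakk> \<Longrightarrow> g = h"
  by (auto simp: is_epi_def)

lemma mono_zero:
  "\<lbrakk>is_mono C m; m \<cdot> g = Zero C (Dom C g) (Cod C m); g \<in> Arr C; Cod C g = Dom C m\<rbrakk> \<Longrightarrow>
    g = Zero C (Dom C g) (Dom C m)"
  using mono_cancel[of m g "Zero C (Dom C g) (Dom C m)"] by (simp add: mono_arr)

lemma epi_zero:
  "\<lbrakk>is_epi C e; g \<cdot> e = Zero C (Dom C e) (Cod C g); g \<in> Arr C; Dom C g = Cod C e\<rbrakk> \<Longrightarrow>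
    g = Zero C (Cod C e) (Cod C g)"
  using epi_cancel[of e g "Zero C (Cod C e) (Cod C g)"] by (simp add: epi_arr)

lemma monoI:
  assumes "m \<in> Arr C"
    "\<And>g. \<lbrakk>g \<in> Arr C; Cod C g = Dom C m; m \<cdot> g = Zero C (Dom C g) (Cod C m)\<rbrakk> \<Longrightarrow>
      g = Zero C (Dom C g) (Dom C m)"
  shows "is_mono C m"
proof -
  have "g = h" if "g \<in> Hom C W (Dom C m)" "h \<in> Hom C W (Dom C m)" "m \<cdot> g = m \<cdot> h" for W g h
    using that assms(1) assms(2)[of "diff g h"] diff_eq_zero[of g h] by simp
  then show ?thesis
    using assms(1) by (auto simp: is_mono_def)
qed

lemma epiI:
  assumes "e \<in> Arr C"
    "\<And>g. \<lbrakk>g \<in> Arr C; Dom C g = Cod C e; g \<cdot> e = Zero C (Dom C e) (Cod C g)\<rbrakk> \<Longrightarrow>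
      g = Zero C (Cod C e) (Cod C g)"
  shows "is_epi C e"
proof -
  have "g = h" if "g \<in> Hom C (Cod C e) W" "h \<in> Hom C (Cod C e) W" "g \<cdot> e = h \<cdot> e" for W g h
    using that assms(1) assms(2)[of "diff g h"] diff_eq_zero[of g h] by simp
  then show ?thesis
    using assms(1) by (auto simp: is_epi_def)
qed

lemma mono_comp:
  assumes "is_mono C f" "is_mono C g" "Cod C f = Dom C g"
  shows "is_mono C (g \<cdot> f)"
proof (rule monoI)
  fix h assume h: "h \<in> Arr C" "Cod C h = Dom C (g \<cdot> f)" "(g \<cdot> f) \<cdot> h = Zero C (Dom C h) (Cod C (g \<cdot> f))"
  note fg = mono_arr[OF assms(1)] mono_arr[OF assms(2)]
  have "f \<cdot> h = Zero C (Dom C h) (Cod C f)"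
    using mono_zero[OF assms(2), of "f \<cdot> h"] fg h assms(3) by simp
  then show "h = Zero C (Dom C h) (Dom C (g \<cdot> f))"
    using mono_zero[OF assms(1), of h] fg h assms(3) by simp
qed (use assms mono_arr[of f] mono_arr[of g] in auto)

lemma epi_comp:
  assumes "is_epi C f" "is_epi C g" "Cod C f = Dom C g"
  shows "is_epi C (g \<cdot> f)"
proof (rule epiI)
  fix h assume h: "h \<in> Arr C" "Dom C h = Cod C (g \<cdot> f)" "h \<cdot> g \<cdot> f = Zero C (Dom C (g \<cdot> f)) (Cod C h)"
  show "h = Zero C (Cod C (g \<cdot> f)) (Cod C h)"
    using assms epi_arr[of f] epi_arr[of g] epi_zero[of f "h \<cdot> g"] epi_zero[of g h] h by auto
qed (use assms epi_arr[of f] epi_arr[of g] in auto)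

lemma epi_of_comp:
  assumes "is_epi C (g \<cdot> f)" "f \<in> Arr C" "g \<in> Arr C" "Cod C f = Dom C g"
  shows "is_epi C g"
proof (rule epiI)
  fix h assume h: "h \<in> Arr C" "Dom C h = Cod C g" "h \<cdot> g = Zero C (Dom C g) (Cod C h)"
  have "h \<cdot> g \<cdot> f = Zero C (Dom C f) (Cod C h)"
    using comp_eqD'[OF h(3), of f] h assms by simp
  then show "h = Zero C (Cod C g) (Cod C h)"
    using assms h epi_zero[of "g \<cdot> f" h] by auto
qed (use assms in auto)

lemma mono_of_comp:
  assumes "is_mono C (g \<cdot> f)" "f \<in> Arr C" "g \<in> Arr C" "Cod C f = Dom C g"
  shows "is_mono C f"
proof (rule monoI)
  fix h assume h: "h \<in> Arr C" "Cod C h = Dom C f" "f \<cdot> h = Zero C (Dom C h) (Cod C f)"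
  then show "h = Zero C (Dom C h) (Dom C f)"
    using assms mono_zero[of "g \<cdot> f" h] by auto
qed (use assms in auto)

lemma ident_mono: "X \<in> Obj C \<Longrightarrow> is_mono C (Ident C X)"
  by (rule monoI) auto

lemma ident_epi: "X \<in> Obj C \<Longrightarrow> is_epi C (Ident C X)"
  by (rule epiI) auto

lemma kernel_arr:
  assumes "is_kernel C k f"
  shows "k \<in> Arr C" "f \<in> Arr C" "Cod C k = Dom C f" "f \<cdot> k = Zero C (Dom C k) (Cod C f)"
  using assms by (auto simp: is_kernel_def)

lemma cokernel_arr:
  assumes "is_cokernel C c f"
  shows "c \<in> Arr C" "f \<in> Arr C" "Dom C c = Cod C f" "c \<cdot> f = Zero C (Dom C f) (Cod C c)"
  using assms by (auto simp: is_cokernel_def)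

lemma kernel_lift:
  assumes "is_kernel C k f" "h \<in> Arr C" "Cod C h = Dom C f" "f \<cdot> h = Zero C (Dom C h) (Cod C f)"
  obtains u where "u \<in> Arr C" "Dom C u = Dom C h" "Cod C u = Dom C k" "k \<cdot> u = h"
proof -
  have "h \<in> Hom C (Dom C h) (Dom C f)"
    using assms by simp
  with assms(1,4) have "\<exists>!u. u \<in> Hom C (Dom C h) (Dom C k) \<and> k \<cdot> u = h"
    unfolding is_kernel_def by blast
  then show ?thesis
    using that by auto
qed

lemma cokernel_desc:
  assumes "is_cokernel C c f" "h \<in> Arr C" "Dom C h = Cod C f" "h \<cdot> f = Zero C (Dom C f) (Cod C h)"
  obtains u where "u \<in> Arr C" "Cod C u = Cod C h" "Dom C u = Cod C c" "u \<cdot> c = h"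
proof -
  have "h \<in> Hom C (Cod C f) (Cod C h)"
    using assms by simp
  with assms(1,4) have "\<exists>!u. u \<in> Hom C (Cod C c) (Cod C h) \<and> u \<cdot> c = h"
    unfolding is_cokernel_def by blast
  then show ?thesis
    using that by auto
qed

lemma kernel_mono: "is_kernel C k f \<Longrightarrow> is_mono C k"
proof (rule monoI)
  assume k: "is_kernel C k f"
  then show "k \<in> Arr C" by (rule kernel_arr)
  fix g assume g: "g \<in> Arr C" "Cod C g = Dom C k" "k \<cdot> g = Zero C (Dom C g) (Cod C k)"
  have "\<exists>!u. u \<in> Hom C (Dom C g) (Dom C k) \<and> k \<cdot> u = Zero C (Dom C g) (Cod C k)"
    using k kernel_arr[OF k] g(1) unfolding is_kernel_def by simp
  moreover have "g \<in> Hom C (Dom C g) (Dom C k)"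
    "Zero C (Dom C g) (Dom C k) \<in> Hom C (Dom C g) (Dom C k)"
    "k \<cdot> Zero C (Dom C g) (Dom C k) = Zero C (Dom C g) (Cod C k)"
    using g(1,2) kernel_arr[OF k] by simp_all
  ultimately show "g = Zero C (Dom C g) (Dom C k)"
    using g(3) by blast
qed

lemma cokernel_epi: "is_cokernel C c f \<Longrightarrow> is_epi C c"
proof (rule epiI)
  assume c: "is_cokernel C c f"
  then show "c \<in> Arr C" by (rule cokernel_arr)
  fix g assume g: "g \<in> Arr C" "Dom C g = Cod C c" "g \<cdot> c = Zero C (Dom C c) (Cod C g)"
  have "\<exists>!u. u \<in> Hom C (Cod C c) (Cod C g) \<and> u \<cdot> c = Zero C (Dom C c) (Cod C g)"
    using c cokernel_arr[OF c] g(1) unfolding is_cokernel_def by simp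
  moreover have "g \<in> Hom C (Cod C c) (Cod C g)"
    "Zero C (Cod C c) (Cod C g) \<in> Hom C (Cod C c) (Cod C g)"
    "Zero C (Cod C c) (Cod C g) \<cdot> c = Zero C (Dom C c) (Cod C g)"
    using g(1,2) cokernel_arr[OF c] by simp_all
  ultimately show "g = Zero C (Cod C c) (Cod C g)"
    using g(3) by blast
qed

lemma kernelI:
  assumes "is_mono C k" "f \<in> Arr C" "Cod C k = Dom C f" "f \<cdot> k = Zero C (Dom C k) (Cod C f)"
    "\<And>h. \<lbrakk>h \<in> Arr C; Cod C h = Dom C f; f \<cdot> h = Zero C (Dom C h) (Cod C f)\<rbrakk> \<Longrightarrow>
      \<exists>u. u \<in> Arr C \<and> Dom C u = Dom C h \<and> Cod C u = Dom C k \<and> k \<cdot> u = h"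
  shows "is_kernel C k f"
  unfolding is_kernel_def
proof (intro conjI allI ballI impI)
  fix W h assume h: "h \<in> Hom C W (Dom C f)" "f \<cdot> h = Zero C W (Cod C f)"
  then obtain u where u: "u \<in> Arr C" "Dom C u = W" "Cod C u = Dom C k" "k \<cdot> u = h"
    using assms(5)[of h] by auto
  show "\<exists>!u. u \<in> Hom C W (Dom C k) \<and> k \<cdot> u = h"
  proof (rule ex1I)
    show "u \<in> Hom C W (Dom C k) \<and> k \<cdot> u = h"
      using u by simp
    fix v assume "v \<in> Hom C W (Dom C k) \<and> k \<cdot> v = h"
    then show "v = u"
      using u by (intro mono_cancel[OF assms(1), of v u]) simp_all
  qed
qed (use assms mono_arr in auto)

lemma cokernelI:
  assumes "is_epi C c" "f \<in> Arr C" "Dom C c = Cod C f" "c \<cdot> f = Zero C (Dom C f) (Cod C c)"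
    "\<And>h. \<lbrakk>h \<in> Arr C; Dom C h = Cod C f; h \<cdot> f = Zero C (Dom C f) (Cod C h)\<rbrakk> \<Longrightarrow>
      \<exists>u. u \<in> Arr C \<and> Cod C u = Cod C h \<and> Dom C u = Cod C c \<and> u \<cdot> c = h"
  shows "is_cokernel C c f"
  unfolding is_cokernel_def
proof (intro conjI allI ballI impI)
  fix W h assume h: "h \<in> Hom C (Cod C f) W" "h \<cdot> f = Zero C (Dom C f) W"
  then obtain u where u: "u \<in> Arr C" "Cod C u = W" "Dom C u = Cod C c" "u \<cdot> c = h"
    using assms(5)[of h] by auto
  show "\<exists>!u. u \<in> Hom C (Cod C c) W \<and> u \<cdot> c = h"
  proof (rule ex1I)
    show "u \<in> Hom C (Cod C c) W \<and> u \<cdot> c = h"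
      using u by simp
    fix v assume "v \<in> Hom C (Cod C c) W \<and> v \<cdot> c = h"
    then show "v = u"
      using u by (intro epi_cancel[OF assms(1), of v u]) simp_all
  qed
qed (use assms epi_arr in auto)

lemma kernel_mono_comp:
  assumes "is_kernel C k e" "is_mono C m" "Dom C m = Cod C e"
  shows "is_kernel C k (m \<cdot> e)"
proof (rule kernelI)
  note k = kernel_arr[OF assms(1)]
  fix h assume h: "h \<in> Arr C" "Cod C h = Dom C (m \<cdot> e)" "(m \<cdot> e) \<cdot> h = Zero C (Dom C h) (Cod C (m \<cdot> e))"
  have "e \<cdot> h = Zero C (Dom C h) (Cod C e)"
    using h k assms mono_arr[OF assms(2)] mono_zero[OF assms(2), of "e \<cdot> h"] by simp
  then obtain u where "u \<in> Arr C" "Dom C u = Dom C h" "Cod C u = Dom C k" "k \<cdot> u = h"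
    using h k assms mono_arr[OF assms(2)] by - (rule kernel_lift[OF assms(1), of h], simp_all)
  then show "\<exists>u. u \<in> Arr C \<and> Dom C u = Dom C h \<and> Cod C u = Dom C k \<and> k \<cdot> u = h"
    by blast
qed (use kernel_arr[OF assms(1)] assms mono_arr[OF assms(2)] kernel_mono in auto)

lemma kernel_of_mono_comp:
  assumes "is_kernel C k (m \<cdot> e)" "m \<in> Arr C" "is_mono C m" "e \<in> Arr C" "Dom C m = Cod C e"
  shows "is_kernel C k e"
proof (rule kernelI)
  note k = kernel_arr[OF assms(1)]
  show "e \<cdot> k = Zero C (Dom C k) (Cod C e)"
    using k assms mono_zero[OF assms(3), of "e \<cdot> k"] by simp
  fix h assume h: "h \<in> Arr C" "Cod C h = Dom C e" "e \<cdot> h = Zero C (Dom C h) (Cod C e)"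
  then obtain u where "u \<in> Arr C" "Dom C u = Dom C h" "Cod C u = Dom C k" "k \<cdot> u = h"
    using k assms by - (rule kernel_lift[OF assms(1), of h], simp_all)
  then show "\<exists>u. u \<in> Arr C \<and> Dom C u = Dom C h \<and> Cod C u = Dom C k \<and> k \<cdot> u = h"
    by blast
qed (use kernel_arr[OF assms(1)] assms kernel_mono in auto)

lemma cokernel_epi_comp:
  assumes "is_cokernel C c k" "is_epi C e" "Cod C e = Dom C k"
  shows "is_cokernel C c (k \<cdot> e)"
proof (rule cokernelI)
  note k = cokernel_arr[OF assms(1)]
  note e = epi_arr[OF assms(2)]
  show "c \<cdot> k \<cdot> e = Zero C (Dom C (k \<cdot> e)) (Cod C c)"
    using comp_eqD'[OF k(4), of e] e k assms by simp
  fix h assume h: "h \<in> Arr C" "Dom C h = Cod C (k \<cdot> e)" "h \<cdot> k \<cdot> e = Zero C (Dom C (k \<cdot> e)) (Cod C h)"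
  have "h \<cdot> k = Zero C (Dom C k) (Cod C h)"
    using h k assms e epi_zero[OF assms(2), of "h \<cdot> k"] by simp
  then obtain u where "u \<in> Arr C" "Cod C u = Cod C h" "Dom C u = Cod C c" "u \<cdot> c = h"
    using h k assms e by - (rule cokernel_desc[OF assms(1), of h], simp_all)
  then show "\<exists>u. u \<in> Arr C \<and> Cod C u = Cod C h \<and> Dom C u = Cod C c \<and> u \<cdot> c = h"
    by blast
qed (use cokernel_arr[OF assms(1)] assms epi_arr[OF assms(2)] cokernel_epi in auto)

definition ses :: "'b \<Rightarrow> 'b \<Rightarrow> bool" where
  "ses i p \<longleftrightarrow> is_kernel C i p \<and> is_cokernel C p i"

lemma ses_arr:
  assumes "ses i p"
  shows "i \<in> Arr C" "p \<in> Arr C" "Cod C i = Dom C p" "p \<cdot> i = Zero C (Dom C i) (Cod C p)"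
    "is_mono C i" "is_epi C p"
  using assms kernel_arr[of i p] kernel_mono[of i p] cokernel_epi[of p i] unfolding ses_def by auto

lemma ses_lift:
  assumes "ses i p" "h \<in> Hom C W (Dom C p)" "p \<cdot> h = Zero C W (Cod C p)"
  obtains u where "u \<in> Hom C W (Dom C i)" "i \<cdot> u = h"
  using assms kernel_lift[of i p h] unfolding ses_def by auto

lemma ses_desc:
  assumes "ses i p" "h \<in> Hom C (Dom C p) W" "h \<cdot> i = Zero C (Dom C i) W"
  obtains u where "u \<in> Hom C (Cod C p) W" "u \<cdot> p = h"
  using assms cokernel_desc[of p i h] ses_arr[of i p] unfolding ses_def by auto

text \<open>The map \<open>y - f' h\<close> lifts \<open>g p\<close> as well as \<open>y\<close> does, and it vanishes on \<open>i\<close>, so it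
  descends along \<open>p\<close>.  All dimension shifting below ends with this step.\<close>

lemma corrected_lift:
  assumes p: "ses i p" and f: "f \<in> Hom C X Y" "f \<cdot> f' = Zero C W Y" and f': "f' \<in> Hom C W X"
    and g: "g \<in> Hom C (Cod C p) Y" and y: "y \<in> Hom C (Dom C p) X" "f \<cdot> y = g \<cdot> p"
    and h: "h \<in> Hom C (Dom C p) W" "f' \<cdot> h \<cdot> i = y \<cdot> i"
  obtains t where "t \<in> Hom C (Cod C p) X" "f \<cdot> t = g"
proof -
  note A = ses_arr[OF p]
  have Y: "Y \<in> Obj C"
    using f(1) by auto
  have "diff y (f' \<cdot> h) \<cdot> i = Zero C (Dom C i) X"
    using h y(1) A f' by simp
  then obtain t where t: "t \<in> Hom C (Cod C p) X" "t \<cdot> p = diff y (f' \<cdot> h)"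
    using h(1) y(1) f' A by - (rule ses_desc[OF p, of "diff y (f' \<cdot> h)" X], simp_all)
  have "f \<cdot> (f' \<cdot> h) = Zero C (Dom C p) Y"
    using comp_eqD'[OF f(2), of h] h(1) f(1) f' Y by simp
  then have "f \<cdot> diff y (f' \<cdot> h) = g \<cdot> p"
    using y h(1) f(1) f' g A Y by simp
  then have "(f \<cdot> t) \<cdot> p = g \<cdot> p"
    using t f(1) A by simp
  then have "f \<cdot> t = g"
    by (rule epi_cancel[OF A(6)]) (use t(1) f(1) g in simp_all)
  with t(1) that show ?thesis
    by blast
qed

end

context abelian_category
begin

text \<open>An epimorphism is the cokernel of some arrow; that arrow factors through the kernel, so
  the epimorphism is the cokernel of its kernel too.\<close>

lemma epi_ses:
  assumes "is_epi C e"
  obtains k where "ses k e"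
proof -
  obtain f where f: "is_cokernel C e f"
    using epi_conormal assms by blast
  obtain k where k: "is_kernel C k e"
    using has_kernel epi_arr assms by blast
  note arr = cokernel_arr[OF f] kernel_arr[OF k]
  obtain u where u: "u \<in> Arr C" "Dom C u = Dom C f" "Cod C u = Dom C k" "k \<cdot> u = f"
    using arr by - (rule kernel_lift[OF k, of f], simp_all)
  have "is_cokernel C e k"
  proof (rule cokernelI)
    fix h assume h: "h \<in> Arr C" "Dom C h = Cod C k" "h \<cdot> k = Zero C (Dom C k) (Cod C h)"
    have "h \<cdot> f = Zero C (Dom C f) (Cod C h)"
      using comp_eqD'[OF h(3), of u] u h arr by simp
    then obtain v where "v \<in> Arr C" "Cod C v = Cod C h" "Dom C v = Cod C e" "v \<cdot> e = h"
      using h arr by - (rule cokernel_desc[OF f, of h], simp_all)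
    then show "\<exists>u. u \<in> Arr C \<and> Cod C u = Cod C h \<and> Dom C u = Cod C e \<and> u \<cdot> e = h"
      by blast
  qed (use assms arr in auto)
  with k that show ?thesis
    unfolding ses_def by blast
qed

lemma mono_ses:
  assumes "is_mono C m"
  obtains c where "ses m c"
proof -
  obtain f where f: "is_kernel C m f"
    using mono_normal assms by blast
  obtain c where c: "is_cokernel C c m"
    using has_cokernel mono_arr assms by blast
  note arr = kernel_arr[OF f] cokernel_arr[OF c]
  obtain u where u: "u \<in> Arr C" "Cod C u = Cod C f" "Dom C u = Cod C c" "u \<cdot> c = f"
    using arr by - (rule cokernel_desc[OF c, of f], simp_all)
  have "is_kernel C m c"
  proof (rule kernelI)
    fix h assume h: "h \<in> Arr C" "Cod C h = Dom C c" "c \<cdot> h = Zero C (Dom C h) (Cod C c)"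
    have "f \<cdot> h = u \<cdot> c \<cdot> h"
      using comp_eqD'[OF u(4), of h] u h arr by simp
    also have "\<dots> = Zero C (Dom C h) (Cod C f)"
      using u h arr by simp
    finally obtain v where "v \<in> Arr C" "Dom C v = Dom C h" "Cod C v = Dom C m" "m \<cdot> v = h"
      using h arr by - (rule kernel_lift[OF f, of h], simp_all)
    then show "\<exists>u. u \<in> Arr C \<and> Dom C u = Dom C h \<and> Cod C u = Dom C m \<and> m \<cdot> u = h"
      by blast
  qed (use assms arr in auto)
  with c that show ?thesis
    unfolding ses_def by blast
qed

lemma kernel_epi_ses: "\<lbrakk>is_kernel C k e; is_epi C e\<rbrakk> \<Longrightarrow> ses k e"
proof -
  assume k: "is_kernel C k e" and e: "is_epi C e"
  note arr = kernel_arr[OF k]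
  obtain k' where k': "ses k' e"
    using epi_ses e by blast
  note arr' = ses_arr[OF k']
  obtain u where u: "u \<in> Hom C (Dom C k') (Dom C k)" "k \<cdot> u = k'"
    using arr' arr by - (rule kernel_lift[OF k, of k'], simp_all)
  have "is_cokernel C e k"
  proof (rule cokernelI)
    fix h assume h: "h \<in> Arr C" "Dom C h = Cod C k" "h \<cdot> k = Zero C (Dom C k) (Cod C h)"
    have "h \<cdot> k' = Zero C (Dom C k') (Cod C h)"
      using comp_eqD'[OF h(3), of u] u h arr by simp
    then obtain v where "v \<in> Hom C (Cod C e) (Cod C h)" "v \<cdot> e = h"
      using h arr by - (rule ses_desc[OF k', of h "Cod C h"], simp_all)
    then show "\<exists>u. u \<in> Arr C \<and> Cod C u = Cod C h \<and> Dom C u = Cod C e \<and> u \<cdot> e = h"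
      by auto
  qed (use e arr in auto)
  with k show ?thesis
    unfolding ses_def by blast
qed

lemma cokernel_mono_ses: "\<lbrakk>is_cokernel C c m; is_mono C m\<rbrakk> \<Longrightarrow> ses m c"
proof -
  assume c: "is_cokernel C c m" and m: "is_mono C m"
  note arr = cokernel_arr[OF c]
  obtain c' where c': "ses m c'"
    using mono_ses m by blast
  note arr' = ses_arr[OF c']
  obtain u where u: "u \<in> Hom C (Cod C c) (Cod C c')" "u \<cdot> c = c'"
    using arr' arr by - (rule cokernel_desc[OF c, of c'], simp_all)
  have "is_kernel C m c"
  proof (rule kernelI)
    fix h assume h: "h \<in> Arr C" "Cod C h = Dom C c" "c \<cdot> h = Zero C (Dom C h) (Cod C c)"
    have "c' \<cdot> h = u \<cdot> c \<cdot> h"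
      using comp_eqD'[OF u(2), of h] u h arr by simp
    also have "\<dots> = Zero C (Dom C h) (Cod C c')"
      using u h arr by simp
    finally obtain v where "v \<in> Hom C (Dom C h) (Dom C m)" "m \<cdot> v = h"
      using h arr arr' by - (rule ses_lift[OF c', of h "Dom C h"], simp_all)
    then show "\<exists>u. u \<in> Arr C \<and> Dom C u = Dom C h \<and> Cod C u = Dom C m \<and> m \<cdot> u = h"
      by auto
  qed (use m arr in auto)
  with c show ?thesis
    unfolding ses_def by blast
qed

lemma zero_object_Zero:
  assumes "is_zero_object C Z"
  shows "f \<in> Hom C W Z \<Longrightarrow> f = Zero C W Z" "f \<in> Hom C Z W \<Longrightarrow> f = Zero C Z W" "Z \<in> Obj C"
    "Ident C Z = Zero C Z Z"
proof -
  show Z: "Z \<in> Obj C"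
    using assms unfolding is_zero_object_def by blast
  show 1: "f = Zero C W Z" if "f \<in> Hom C W Z" for f W
  proof -
    have W: "W \<in> Obj C"
      using that by auto
    have "Zero C W Z \<in> Hom C W Z"
      using Z W by simp
    then show ?thesis
      using assms that W unfolding is_zero_object_def by blast
  qed
  show "f = Zero C Z W" if "f \<in> Hom C Z W" for f W
  proof -
    have W: "W \<in> Obj C"
      using that by auto
    have "Zero C Z W \<in> Hom C Z W"
      using Z W by simp
    then show ?thesis
      using assms that W unfolding is_zero_object_def by blast
  qed
  show "Ident C Z = Zero C Z Z"
    using 1[of "Ident C Z" Z] Z by simp
qed

lemma biproduct:
  assumes "X \<in> Obj C" "Y \<in> Obj C"
  obtains S i j p q where "is_direct_sum C S X Y" "i \<in> Hom C X S" "j \<in> Hom C Y S"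
    "p \<in> Hom C S X" "q \<in> Hom C S Y" "p \<cdot> i = Ident C X" "q \<cdot> j = Ident C Y"
    "p \<cdot> j = Zero C Y X" "q \<cdot> i = Zero C X Y" "Add C (i \<cdot> p) (j \<cdot> q) = Ident C S"
  using direct_sum[OF assms] unfolding is_direct_sum_def by metis

text \<open>The kernel of \<open>(f, - p) : A \<oplus> B \<rightarrow> X\<close> is the pullback.  Since \<open>p\<close> is an epimorphism, so is
  \<open>(f, - p)\<close>, which is therefore the cokernel of its kernel; a map out of \<open>A\<close> that vanishes on the
  pullback thus factors through \<open>(f, - p)\<close> and restricts to zero on \<open>B\<close>, whence it is zero.\<close>

lemma pullback_epi:
  assumes f: "f \<in> Hom C A X" and p: "p \<in> Hom C B X" "is_epi C p"
  obtains Y a b where "a \<in> Hom C Y A" "b \<in> Hom C Y B" "is_epi C a" "f \<cdot> a = p \<cdot> b"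
    "\<And>W x y. \<lbrakk>x \<in> Hom C W A; y \<in> Hom C W B; f \<cdot> x = p \<cdot> y\<rbrakk> \<Longrightarrow>
      \<exists>u\<in>Hom C W Y. a \<cdot> u = x \<and> b \<cdot> u = y"
    "\<And>W u v. \<lbrakk>u \<in> Hom C W Y; v \<in> Hom C W Y; a \<cdot> u = a \<cdot> v; b \<cdot> u = b \<cdot> v\<rbrakk> \<Longrightarrow> u = v"
proof -
  have obj: "A \<in> Obj C" "B \<in> Obj C" "X \<in> Obj C"
    using f p by auto
  obtain S i j s t where S: "i \<in> Hom C A S" "j \<in> Hom C B S"
    "s \<in> Hom C S A" "t \<in> Hom C S B" "s \<cdot> i = Ident C A" "t \<cdot> j = Ident C B"
    "s \<cdot> j = Zero C B A" "t \<cdot> i = Zero C A B" "Add C (i \<cdot> s) (j \<cdot> t) = Ident C S"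
    using biproduct[OF obj(1,2)] by metis
  define g where "g = diff (f \<cdot> s) (p \<cdot> t)"
  have g: "g \<in> Hom C S X"
    using S f p by (simp add: g_def)
  have gj: "g \<cdot> j = neg p"
    using S f p obj by (simp add: g_def)
  have "is_epi C g"
  proof (rule epiI)
    fix h assume h: "h \<in> Arr C" "Dom C h = Cod C g" "h \<cdot> g = Zero C (Dom C g) (Cod C h)"
    have "h \<cdot> (g \<cdot> j) = Zero C B (Cod C h)"
      using comp_eqD'[OF h(3), of j] h g S by simp
    then have "neg (h \<cdot> p) = Zero C B (Cod C h)"
      using gj h p g by simp
    then have "neg (neg (h \<cdot> p)) = Zero C B (Cod C h)"
      using h g p obj by simp
    then have "h \<cdot> p = Zero C B (Cod C h)"
      using h g p by simp
    then show "h = Zero C (Cod C g) (Cod C h)"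
      using epi_zero[OF p(2), of h] h g p by simp
  qed (use g in auto)
  then obtain k where k: "ses k g"
    using epi_ses by blast
  note ka = ses_arr[OF k]
  define Y where "Y = Dom C k"
  define a where "a = s \<cdot> k"
  define b where "b = t \<cdot> k"
  have kY: "k \<in> Hom C Y S"
    using ka g by (simp add: Y_def)
  have ab: "a \<in> Hom C Y A" "b \<in> Hom C Y B"
    using kY S by (auto simp: a_def b_def)
  have "diff (f \<cdot> a) (p \<cdot> b) = Zero C Y X"
    using ka(4) kY f p S g by (simp add: g_def a_def b_def)
  then have eq: "f \<cdot> a = p \<cdot> b"
    by (rule diff_eq_zero) (use ab f p in simp_all)
  have "is_epi C a"
  proof (rule epiI)
    fix h assume h: "h \<in> Arr C" "Dom C h = Cod C a" "h \<cdot> a = Zero C (Dom C a) (Cod C h)"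
    have "(h \<cdot> s) \<cdot> k = Zero C (Dom C k) (Cod C h)"
      using h S ab kY by (simp add: a_def)
    then obtain w where w: "w \<in> Hom C X (Cod C h)" "w \<cdot> g = h \<cdot> s"
      using h S ab g by - (rule ses_desc[OF k, of "h \<cdot> s" "Cod C h"], simp_all)
    have "w \<cdot> (g \<cdot> j) = Zero C B (Cod C h)"
      using comp_eqD[OF w(2), of j] w h S ab g obj by simp
    then have "neg (w \<cdot> p) = Zero C B (Cod C h)"
      using gj w p by simp
    then have "neg (neg (w \<cdot> p)) = Zero C B (Cod C h)"
      using w h obj by simp
    then have "w \<cdot> p = Zero C B (Cod C h)"
      using w p by simp
    then have "w = Zero C X (Cod C h)"
      using epi_zero[OF p(2), of w] w p by simp
    then have "h \<cdot> s = Zero C S (Cod C h)"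
      using w(2) g h by simp
    then have "h \<cdot> s \<cdot> i = Zero C A (Cod C h)"
      using comp_eqD'[of h s "Zero C S (Cod C h)" i] S h ab by simp
    then show "h = Zero C (Cod C a) (Cod C h)"
      using S h ab by simp
  qed (use ab in auto)
  moreover have "\<exists>u\<in>Hom C W Y. a \<cdot> u = x \<and> b \<cdot> u = y"
    if xy: "x \<in> Hom C W A" "y \<in> Hom C W B" "f \<cdot> x = p \<cdot> y" for W x y
  proof -
    define z where "z = Add C (i \<cdot> x) (j \<cdot> y)"
    have W: "W \<in> Obj C"
      using xy(1) by auto
    have z: "z \<in> Hom C W S"
      using xy S by (simp add: z_def)
    have sz: "s \<cdot> z = x"
      using xy S obj comp_eqD'[OF S(5), of x] comp_eqD'[OF S(7), of y] by (simp add: z_def)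
    have tz: "t \<cdot> z = y"
      using xy S obj comp_eqD'[OF S(8), of x] comp_eqD'[OF S(6), of y] by (simp add: z_def)
    have "g \<cdot> z = Zero C W X"
      using z S f p xy sz tz by (simp add: g_def)
    then obtain u where "u \<in> Hom C W Y" "k \<cdot> u = z"
      using z g unfolding Y_def by - (rule ses_lift[OF k, of z W], simp_all)
    then show ?thesis
      using kY S sz tz unfolding a_def b_def by (intro bexI[of _ u]) simp_all
  qed
  moreover have "u = v"
    if uv: "u \<in> Hom C W Y" "v \<in> Hom C W Y" "a \<cdot> u = a \<cdot> v" "b \<cdot> u = b \<cdot> v" for W u v
  proof -
    have *: "k \<cdot> x = Add C (i \<cdot> a \<cdot> x) (j \<cdot> b \<cdot> x)" if "x \<in> Hom C W Y" for x
    proof -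
      have "k \<cdot> x = Add C (i \<cdot> s) (j \<cdot> t) \<cdot> k \<cdot> x"
        using S that kY by simp
      also have "\<dots> = Add C (i \<cdot> a \<cdot> x) (j \<cdot> b \<cdot> x)"
        unfolding a_def b_def using S(1-4) that kY by (subst comp_add(2)) simp_all
      finally show ?thesis .
    qed
    have "k \<cdot> u = k \<cdot> v"
      using *[OF uv(1)] *[OF uv(2)] uv by simp
    then show ?thesis
      using mono_cancel[OF ka(5)] uv kY by auto
  qed
  ultimately show ?thesis
    using that[OF ab _ eq] by blast
qed

text \<open>If \<open>x\<close> kills \<open>e\<close>, then \<open>f\<close> factors through the subobject \<open>ker x\<close> of \<open>k\<close>.  This subobject
  is the kernel of an arrow that kills \<open>f\<close>, hence kills \<open>k\<close>; so it is all of \<open>k\<close> and \<open>x = 0\<close>.\<close>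

lemma image_factorisation:
  assumes f: "f \<in> Arr C" and k: "is_image C k f"
  obtains e where "is_epi C e" "e \<in> Hom C (Dom C f) (Dom C k)" "k \<cdot> e = f"
proof -
  obtain c where c: "is_cokernel C c f" "is_kernel C k c"
    using k unfolding is_image_def by blast
  note arr = cokernel_arr[OF c(1)] kernel_arr[OF c(2)]
  note km = kernel_mono[OF c(2)]
  obtain e where e: "e \<in> Arr C" "Dom C e = Dom C f" "Cod C e = Dom C k" "k \<cdot> e = f"
    using arr by - (rule kernel_lift[OF c(2), of f], simp_all)
  have "is_epi C e"
  proof (rule epiI)
    fix x assume x: "x \<in> Arr C" "Dom C x = Cod C e" "x \<cdot> e = Zero C (Dom C e) (Cod C x)"
    obtain k' where k': "is_kernel C k' x"
      using has_kernel x by blast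
    note arr' = kernel_arr[OF k'] kernel_mono[OF k']
    have kk: "is_mono C (k \<cdot> k')"
      using arr' arr x e km by (intro mono_comp) auto
    then obtain y where y: "ses (k \<cdot> k') y"
      using mono_ses by blast
    note ya = ses_arr[OF y]
    obtain e' where e': "e' \<in> Arr C" "Dom C e' = Dom C e" "Cod C e' = Dom C k'" "k' \<cdot> e' = e"
      using x e by - (rule kernel_lift[OF k', of e], simp_all)
    have kk': "k \<cdot> k' \<in> Arr C" "Dom C (k \<cdot> k') = Dom C k'" "Cod C (k \<cdot> k') = Cod C k"
      using arr arr' x e by simp_all
    have "f = (k \<cdot> k') \<cdot> e'"
      using e e' arr arr' x by simp
    then have "y \<cdot> f = (y \<cdot> (k \<cdot> k')) \<cdot> e'"
      using ya kk' e' by (simp del: assoc add: assoc[symmetric])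
    also have "\<dots> = Zero C (Dom C f) (Cod C y)"
      unfolding ya(4) using ya e' kk' e by simp
    finally obtain w where w: "w \<in> Arr C" "Dom C w = Cod C c" "Cod C w = Cod C y" "w \<cdot> c = y"
      using ya kk' arr by - (rule cokernel_desc[OF c(1), of y], simp_all)
    have "y \<cdot> k = w \<cdot> c \<cdot> k"
      using comp_eqD'[OF w(4), of k] w arr by simp
    also have "\<dots> = Zero C (Dom C k) (Cod C y)"
      using w arr by simp
    finally obtain v where v: "v \<in> Hom C (Dom C k) (Dom C k')" "(k \<cdot> k') \<cdot> v = k"
      using arr ya kk' by - (rule ses_lift[OF y, of k "Dom C k"], simp_all)
    have "k \<cdot> (k' \<cdot> v) = k \<cdot> Ident C (Dom C k)"
      using v arr arr' x e by simp
    then have "k' \<cdot> v = Ident C (Dom C k)"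
      using mono_cancel[OF km, of "k' \<cdot> v" "Ident C (Dom C k)"] v arr arr' x e by simp
    then have "x = x \<cdot> k' \<cdot> v"
      using x e by simp
    also have "\<dots> = Zero C (Cod C e) (Cod C x)"
      using comp_eqD'[OF arr'(4), of v] arr' v x e by simp
    finally show "x = Zero C (Cod C e) (Cod C x)" .
  qed (use e in auto)
  with e that show ?thesis by auto
qed

lemma exact_pair_iff:
  "exact_pair C f g \<longleftrightarrow> (\<exists>k e. is_epi C e \<and> k \<in> Arr C \<and> Cod C e = Dom C k \<and> f = k \<cdot> e \<and> is_kernel C k g)"
proof
  assume "exact_pair C f g"
  then obtain k where k: "is_image C k f" "is_kernel C k g"
    unfolding exact_pair_def by blast
  then have "f \<in> Arr C"
    unfolding is_image_def using cokernel_arr by blast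
  from image_factorisation[OF this k(1)] k(2) kernel_arr[OF k(2)]
  show "\<exists>k e. is_epi C e \<and> k \<in> Arr C \<and> Cod C e = Dom C k \<and> f = k \<cdot> e \<and> is_kernel C k g"
    by (metis Hom_iff)
next
  assume "\<exists>k e. is_epi C e \<and> k \<in> Arr C \<and> Cod C e = Dom C k \<and> f = k \<cdot> e \<and> is_kernel C k g"
  then obtain k e where k: "is_epi C e" "k \<in> Arr C" "Cod C e = Dom C k" "f = k \<cdot> e" "is_kernel C k g"
    by blast
  obtain c where c: "ses k c"
    using mono_ses kernel_mono[OF k(5)] by blast
  then have "is_cokernel C c f"
    using cokernel_epi_comp[of c k e] k unfolding ses_def by simp
  then show "exact_pair C f g"
    using c k(5) unfolding exact_pair_def is_image_def ses_def by blast
qed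

text \<open>In terms of subobjects: the preimage \<open>K''\<close> of \<open>A\<close> under an epimorphism \<open>q : P \<rightarrow> B\<close> is an
  extension of \<open>A\<close> by \<open>ker q\<close>.\<close>

lemma pullback_of_ses:
  assumes ses: "ses a b" and q: "q \<in> Hom C P (Dom C b)" "is_epi C q" and k: "ses k q"
    and k'': "ses k'' (b \<cdot> q)"
  obtains u v where "ses u v" "u \<in> Hom C (Dom C k) (Dom C k'')" "v \<in> Hom C (Dom C k'') (Dom C a)"
    "k'' \<cdot> u = k" "a \<cdot> v = q \<cdot> k''"
proof -
  note A = ses_arr[OF ses] ses_arr[OF k] ses_arr[OF k'']
  have bq: "b \<cdot> q \<in> Arr C" "Dom C (b \<cdot> q) = P" "Cod C (b \<cdot> q) = Cod C b"
    using A q by auto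
  have "(b \<cdot> q) \<cdot> k = Zero C (Dom C k) (Cod C b)"
    using A(1-10) q by simp
  then obtain u where u: "u \<in> Hom C (Dom C k) (Dom C k'')" "k'' \<cdot> u = k"
    using A bq q by - (rule ses_lift[OF k'', of k "Dom C k"], simp_all)
  have "b \<cdot> (q \<cdot> k'') = Zero C (Dom C k'') (Cod C b)"
    using A q bq by simp
  then obtain v where v: "v \<in> Hom C (Dom C k'') (Dom C a)" "a \<cdot> v = q \<cdot> k''"
    using A bq q by - (rule ses_lift[OF ses, of "q \<cdot> k''" "Dom C k''"], simp_all)
  have aq: "a \<in> Hom C (Dom C a) (Dom C b)"
    using A by simp
  obtain Y y1 y2 where Y: "y1 \<in> Hom C Y (Dom C a)" "y2 \<in> Hom C Y P" "is_epi C y1" "a \<cdot> y1 = q \<cdot> y2"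
    using pullback_epi[OF aq q] by metis
  have "(b \<cdot> q) \<cdot> y2 = b \<cdot> a \<cdot> y1"
    using Y A q by simp
  also have "\<dots> = Zero C Y (Cod C b)"
    using comp_eqD'[OF A(4), of y1] Y A(1-3) by simp
  finally obtain z where z: "z \<in> Hom C Y (Dom C k'')" "k'' \<cdot> z = y2"
    using Y bq by - (rule ses_lift[OF k'', of y2 Y], simp_all)
  have "a \<cdot> (v \<cdot> z) = q \<cdot> k'' \<cdot> z"
    using comp_eqD[OF v(2), of z] v z A q bq by simp
  then have "a \<cdot> (v \<cdot> z) = a \<cdot> y1"
    using z Y by simp
  then have "v \<cdot> z = y1"
    using mono_cancel[OF A(5), of "v \<cdot> z" y1] v z Y by simp
  then have epi: "is_epi C v"
    using epi_of_comp[of v z] Y v z by auto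
  have "is_kernel C u v"
  proof (rule kernelI)
    show "is_mono C u"
      using mono_of_comp[of k'' u] A u by auto
    have "a \<cdot> (v \<cdot> u) = q \<cdot> k'' \<cdot> u"
      using comp_eqD[OF v(2), of u] v u A q bq by simp
    then have "a \<cdot> (v \<cdot> u) = Zero C (Dom C k) (Dom C b)"
      using u A q by simp
    then show "v \<cdot> u = Zero C (Dom C u) (Cod C v)"
      using mono_zero[OF A(5), of "v \<cdot> u"] A u v by simp
    fix h assume h: "h \<in> Arr C" "Cod C h = Dom C v" "v \<cdot> h = Zero C (Dom C h) (Cod C v)"
    have "q \<cdot> k'' \<cdot> h = a \<cdot> v \<cdot> h"
      using comp_eqD[OF v(2), of h] v h A q bq by simp
    then have "q \<cdot> (k'' \<cdot> h) = Zero C (Dom C h) (Dom C b)"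
      using h v A by simp
    then obtain w where w: "w \<in> Hom C (Dom C h) (Dom C k)" "k \<cdot> w = k'' \<cdot> h"
      using q h v A bq by - (rule ses_lift[OF k, of "k'' \<cdot> h" "Dom C h"], simp_all)
    have "k'' \<cdot> (u \<cdot> w) = k \<cdot> w"
      using comp_eqD'[OF u(2), of w] u w A by simp
    then have "u \<cdot> w = h"
      using mono_cancel[OF A(17), of "u \<cdot> w" h] u v w h by simp
    then show "\<exists>w. w \<in> Arr C \<and> Dom C w = Dom C h \<and> Cod C w = Dom C u \<and> u \<cdot> w = h"
      using w u by (intro exI[of _ w]) simp
  qed (use u v in auto)
  with epi u v that show ?thesis
    using kernel_epi_ses by blast
qed

lemma ses_composite:
  assumes ab: "ses a b" and kq: "ses k q" "Cod C q = Dom C b"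
  obtains k'' u v where "ses k'' (b \<cdot> q)" "ses u v" "u \<in> Hom C (Dom C k) (Dom C k'')"
    "v \<in> Hom C (Dom C k'') (Dom C a)" "k'' \<cdot> u = k" "a \<cdot> v = q \<cdot> k''"
proof -
  note A = ses_arr[OF ab] ses_arr[OF kq(1)]
  have "is_epi C (b \<cdot> q)"
    using A kq by (intro epi_comp) auto
  then obtain k'' where k'': "ses k'' (b \<cdot> q)"
    using epi_ses by blast
  have q: "q \<in> Hom C (Dom C q) (Dom C b)"
    using A kq by simp
  obtain u v where "ses u v" "u \<in> Hom C (Dom C k) (Dom C k'')"
    "v \<in> Hom C (Dom C k'') (Dom C a)" "k'' \<cdot> u = k" "a \<cdot> v = q \<cdot> k''"
    using pullback_of_ses[OF ab q A(12) kq(1) k''] by metis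
  with k'' that show ?thesis
    by blast
qed

text \<open>An epimorphism and its pullback have the same kernel.\<close>

lemma pullback_ses:
  assumes p: "ses i p" and v: "v \<in> Hom C T (Cod C p)"
  obtains j a b where "ses j a" "a \<in> Hom C (Dom C a) T" "b \<in> Hom C (Dom C a) (Dom C p)"
    "j \<in> Hom C (Dom C i) (Dom C a)" "b \<cdot> j = i" "v \<cdot> a = p \<cdot> b"
    "\<And>W x y. \<lbrakk>x \<in> Hom C W T; y \<in> Hom C W (Dom C p); v \<cdot> x = p \<cdot> y\<rbrakk> \<Longrightarrow>
      \<exists>u\<in>Hom C W (Dom C a). a \<cdot> u = x \<and> b \<cdot> u = y"
    "\<And>W u w. \<lbrakk>u \<in> Hom C W (Dom C a); w \<in> Hom C W (Dom C a); a \<cdot> u = a \<cdot> w; b \<cdot> u = b \<cdot> w\<rbrakk> \<Longrightarrow> u = w"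
proof -
  note A = ses_arr[OF p]
  have p': "p \<in> Hom C (Dom C p) (Cod C p)"
    using A by simp
  obtain Y a b where Y: "a \<in> Hom C Y T" "b \<in> Hom C Y (Dom C p)" "is_epi C a" "v \<cdot> a = p \<cdot> b"
    and ex: "\<And>W x y. \<lbrakk>x \<in> Hom C W T; y \<in> Hom C W (Dom C p); v \<cdot> x = p \<cdot> y\<rbrakk> \<Longrightarrow>
      \<exists>u\<in>Hom C W Y. a \<cdot> u = x \<and> b \<cdot> u = y"
    and un: "\<And>W u w. \<lbrakk>u \<in> Hom C W Y; w \<in> Hom C W Y; a \<cdot> u = a \<cdot> w; b \<cdot> u = b \<cdot> w\<rbrakk> \<Longrightarrow> u = w"
    by (rule pullback_epi[OF v p' A(6)]) (rule that, assumption+)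
  have T: "T \<in> Obj C"
    using v by auto
  obtain j where j: "j \<in> Hom C (Dom C i) Y" "a \<cdot> j = Zero C (Dom C i) T" "b \<cdot> j = i"
  proof -
    have "\<exists>u\<in>Hom C (Dom C i) Y. a \<cdot> u = Zero C (Dom C i) T \<and> b \<cdot> u = i"
      using A T v by (intro ex) simp_all
    with that show ?thesis by blast
  qed
  have "is_kernel C j a"
  proof (rule kernelI)
    show "is_mono C j"
      using mono_of_comp[of b j] A j Y by auto
    fix h assume h: "h \<in> Arr C" "Cod C h = Dom C a" "a \<cdot> h = Zero C (Dom C h) (Cod C a)"
    have "p \<cdot> (b \<cdot> h) = v \<cdot> a \<cdot> h"
      using comp_eqD[OF Y(4), of h] h Y v A by simp
    also have "\<dots> = Zero C (Dom C h) (Cod C p)"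
      using h Y v by simp
    finally obtain w where w: "w \<in> Hom C (Dom C h) (Dom C i)" "i \<cdot> w = b \<cdot> h"
      using h Y by - (rule ses_lift[OF p, of "b \<cdot> h" "Dom C h"], simp_all)
    have "j \<cdot> w = h"
    proof (rule un)
      show "j \<cdot> w \<in> Hom C (Dom C h) Y" "h \<in> Hom C (Dom C h) Y"
        using j w h Y by simp_all
      show "a \<cdot> j \<cdot> w = a \<cdot> h"
        using comp_eqD'[OF j(2), of w] j w h Y T A by simp
      show "b \<cdot> j \<cdot> w = b \<cdot> h"
        using comp_eqD'[OF j(3), of w] j w h Y T A by simp
    qed
    then show "\<exists>u. u \<in> Arr C \<and> Dom C u = Dom C h \<and> Cod C u = Dom C j \<and> j \<cdot> u = h"
      using w j by (intro exI[of _ w]) simp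
  qed (use j Y in auto)
  with Y(3) have "ses j a"
    using kernel_epi_ses by blast
  with Y j show ?thesis
    using that[of j a b] ex un by auto
qed

text \<open>The pullback of two epimorphisms \<open>P \<rightarrow> X \<leftarrow> T\<close>, an extension both of \<open>T\<close> by \<open>ker(P \<rightarrow> X)\<close>
  and of \<open>P\<close> by \<open>ker(T \<rightarrow> X)\<close>.  Comparing the two descriptions replaces Schanuel's lemma.\<close>

lemma pullback_two_ses:
  assumes p: "ses i p" and v: "ses l v" and cod: "Cod C v = Cod C p"
  obtains j a m b where "ses j a" "ses m b" "a \<in> Hom C (Dom C a) (Dom C v)"
    "b \<in> Hom C (Dom C a) (Dom C p)" "j \<in> Hom C (Dom C i) (Dom C a)"
    "m \<in> Hom C (Dom C l) (Dom C a)" "b \<cdot> j = i" "a \<cdot> m = l" "v \<cdot> a = p \<cdot> b"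
proof -
  note A = ses_arr[OF p] ses_arr[OF v]
  have v': "v \<in> Hom C (Dom C v) (Cod C p)" and p': "p \<in> Hom C (Dom C p) (Cod C v)"
    using A cod by simp_all
  obtain j a b where Y: "ses j a" "a \<in> Hom C (Dom C a) (Dom C v)"
    "b \<in> Hom C (Dom C a) (Dom C p)" "j \<in> Hom C (Dom C i) (Dom C a)" "b \<cdot> j = i" "v \<cdot> a = p \<cdot> b"
    and ex: "\<And>W x y. \<lbrakk>x \<in> Hom C W (Dom C v); y \<in> Hom C W (Dom C p); v \<cdot> x = p \<cdot> y\<rbrakk> \<Longrightarrow>
      \<exists>u\<in>Hom C W (Dom C a). a \<cdot> u = x \<and> b \<cdot> u = y"
    and un: "\<And>W u w. \<lbrakk>u \<in> Hom C W (Dom C a); w \<in> Hom C W (Dom C a); a \<cdot> u = a \<cdot> w; b \<cdot> u = b \<cdot> w\<rbrakk>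
      \<Longrightarrow> u = w"
    by (rule pullback_ses[OF p v']) (rule that, assumption+)
  obtain Y' a' b' where Y': "a' \<in> Hom C Y' (Dom C p)" "b' \<in> Hom C Y' (Dom C v)" "is_epi C a'"
    "p \<cdot> a' = v \<cdot> b'"
    using pullback_epi[OF p' _ A(12)] A by (metis Hom_iff)
  obtain z where z: "z \<in> Hom C Y' (Dom C a)" "b \<cdot> z = a'"
    using ex[OF Y'(2,1) Y'(4)[symmetric]] by blast
  have epi: "is_epi C b"
    using epi_of_comp[of b z] Y' Y z by auto
  have "\<exists>u\<in>Hom C (Dom C l) (Dom C a). a \<cdot> u = l \<and> b \<cdot> u = Zero C (Dom C l) (Dom C p)"
    using A cod by (intro ex) simp_all
  then obtain m where m: "m \<in> Hom C (Dom C l) (Dom C a)" "a \<cdot> m = l"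
    "b \<cdot> m = Zero C (Dom C l) (Dom C p)"
    by blast
  have "is_kernel C m b"
  proof (rule kernelI)
    show "is_mono C m"
      using mono_of_comp[of a m] A m Y by auto
    fix h assume h: "h \<in> Arr C" "Cod C h = Dom C b" "b \<cdot> h = Zero C (Dom C h) (Cod C b)"
    have "v \<cdot> (a \<cdot> h) = p \<cdot> b \<cdot> h"
      using comp_eqD[OF Y(6), of h] h Y A by simp
    also have "\<dots> = Zero C (Dom C h) (Cod C v)"
      using h Y A cod by simp
    finally obtain w where w: "w \<in> Hom C (Dom C h) (Dom C l)" "l \<cdot> w = a \<cdot> h"
      using h Y by - (rule ses_lift[OF v, of "a \<cdot> h" "Dom C h"], simp_all)
    have "m \<cdot> w = h"
    proof (rule un)
      show "m \<cdot> w \<in> Hom C (Dom C h) (Dom C a)" "h \<in> Hom C (Dom C h) (Dom C a)"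
        using m w h Y by simp_all
      show "a \<cdot> m \<cdot> w = a \<cdot> h"
        using comp_eqD'[OF m(2), of w] m w h Y A by simp
      show "b \<cdot> m \<cdot> w = b \<cdot> h"
        using comp_eqD'[OF m(3), of w] m w h Y A by simp
    qed
    then show "\<exists>u. u \<in> Arr C \<and> Dom C u = Dom C h \<and> Cod C u = Dom C m \<and> m \<cdot> u = h"
      using w m by (intro exI[of _ w]) simp
  qed (use m Y in auto)
  then show ?thesis
    using that[OF Y(1) kernel_epi_ses[OF _ epi] Y(2,3,4) m(1) Y(5) m(2) Y(6)] by blast
qed

end

section \<open>Objects without extensions by the subcategory\<close>

locale generating_subcategory = abelian_category +
  fixes M :: "'a set"
  assumes sub: "subcategory C M" and gen: "generating C M"
begin

lemma M_obj [simp]: "X \<in> M \<Longrightarrow> X \<in> Obj C"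
  using sub unfolding subcategory_def by blast

lemma M_sum: "is_direct_sum C S X Y \<Longrightarrow> S \<in> M \<longleftrightarrow> X \<in> M \<and> Y \<in> M"
  using sub unfolding subcategory_def by blast

lemma cover:
  assumes "A \<in> Obj C"
  obtains i p where "ses i p" "Cod C p = A" "Dom C p \<in> M"
proof -
  obtain p X where "X \<in> M" "p \<in> Hom C X A" "is_epi C p"
    using gen assms unfolding generating_def by blast
  with epi_ses[of p] that show ?thesis
    by auto
qed

definition extends :: "'b \<Rightarrow> bool" where
  "extends i \<longleftrightarrow> (\<forall>N\<in>M. \<forall>s\<in>Hom C (Dom C i) N. \<exists>t\<in>Hom C (Cod C i) N. t \<cdot> i = s)"

text \<open>This is \<open>Ext\<^sup>1(A, N) = 0\<close> for \<open>N \<in> M\<close>, in the form in which it is used: by pushing out, all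
  extensions of \<open>A\<close> by \<open>N\<close> split iff maps to \<open>N\<close> extend along every monomorphism with cokernel \<open>A\<close>.\<close>

definition ext1_zero :: "'a \<Rightarrow> bool" where
  "ext1_zero A \<longleftrightarrow> (\<forall>i p. ses i p \<and> Cod C p = A \<longrightarrow> extends i)"

text \<open>\<open>acyclic k A\<close> expresses \<open>Ext\<^sup>i(A, N) = 0\<close> for \<open>1 \<le> i \<le> k\<close> and \<open>N \<in> M\<close>, once the objects of \<open>M\<close>
  are known to have this property in degrees less than \<open>k\<close>.  All covers of \<open>A\<close> are quantified over, so
  that no comparison of different covers is needed when the hypothesis is used.\<close>

primrec acyclic :: "nat \<Rightarrow> 'a \<Rightarrow> bool" where
  "acyclic 0 A \<longleftrightarrow> True"
| "acyclic (Suc k) A \<longleftrightarrow> ext1_zero A \<and>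
     (\<forall>i p. ses i p \<and> Cod C p = A \<and> Dom C p \<in> M \<longrightarrow> acyclic k (Dom C i))"

lemma extendsE:
  assumes "extends i" "N \<in> M" "s \<in> Hom C (Dom C i) N"
  obtains t where "t \<in> Hom C (Cod C i) N" "t \<cdot> i = s"
  using assms unfolding extends_def by blast

lemma ext1_zero_extension:
  assumes ab: "ses a b" and e: "ext1_zero (Dom C a)" "ext1_zero (Cod C b)"
  shows "ext1_zero (Dom C b)"
  unfolding ext1_zero_def extends_def
proof (intro allI impI ballI)
  fix k q N s assume kq: "ses k q \<and> Cod C q = Dom C b" and N: "N \<in> M" and s: "s \<in> Hom C (Dom C k) N"
  note A = ses_arr[OF ab] ses_arr[OF conjunct1[OF kq]]
  obtain k'' u v where k'': "ses k'' (b \<cdot> q)" and uv: "ses u v"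
    "u \<in> Hom C (Dom C k) (Dom C k'')" "v \<in> Hom C (Dom C k'') (Dom C a)" "k'' \<cdot> u = k" "a \<cdot> v = q \<cdot> k''"
    by (rule ses_composite[OF ab conjunct1[OF kq] conjunct2[OF kq]])
  note A'' = ses_arr[OF k'']
  have "Cod C v = Dom C a" "Cod C (b \<cdot> q) = Cod C b"
    using uv A kq by simp_all
  then have "extends u" "extends k''"
    using e uv(1) k'' unfolding ext1_zero_def by blast+
  obtain t where t: "t \<in> Hom C (Dom C k'') N" "t \<cdot> u = s"
    using extendsE[OF \<open>extends u\<close> N, of s] s uv by auto
  obtain r where r: "r \<in> Hom C (Dom C q) N" "r \<cdot> k'' = t"
    using extendsE[OF \<open>extends k''\<close> N, of t] t A'' A kq by auto
  have "r \<cdot> k = s"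
    using comp_eqD'[OF r(2), of u] t r uv A'' A kq by simp
  then show "\<exists>t\<in>Hom C (Cod C k) N. t \<cdot> k = s"
    using r A by (intro bexI[of _ r]) simp_all
qed

text \<open>This is the piece \<open>Hom(B, N) \<rightarrow> Hom(A, N) \<rightarrow> Ext\<^sup>1(B/A, N) \<rightarrow> Ext\<^sup>1(B, N)\<close> of the long exact
  sequence.\<close>

lemma ext1_zero_quotient:
  assumes ab: "ses a b" and e: "ext1_zero (Dom C b)" and a: "extends a"
  shows "ext1_zero (Cod C b)"
  unfolding ext1_zero_def extends_def
proof (intro allI impI ballI)
  fix i p N s assume ip: "ses i p \<and> Cod C p = Cod C b" and N: "N \<in> M" and s: "s \<in> Hom C (Dom C i) N"
  note A = ses_arr[OF ab] ses_arr[OF conjunct1[OF ip]]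
  obtain j c m d where Y: "ses j c" "ses m d" "c \<in> Hom C (Dom C c) (Dom C b)"
    "d \<in> Hom C (Dom C c) (Dom C p)" "j \<in> Hom C (Dom C i) (Dom C c)" "m \<in> Hom C (Dom C a) (Dom C c)"
    "d \<cdot> j = i" "c \<cdot> m = a"
    using pullback_two_ses[OF conjunct1[OF ip] ab] ip by metis
  note A' = ses_arr[OF Y(1)] ses_arr[OF Y(2)]
  have "extends j"
    using e Y A' unfolding ext1_zero_def by auto
  then obtain y where y: "y \<in> Hom C (Dom C c) N" "y \<cdot> j = s"
    using extendsE[OF \<open>extends j\<close> N, of s] s Y by auto
  obtain z where z: "z \<in> Hom C (Dom C b) N" "z \<cdot> a = y \<cdot> m"
    using extendsE[OF a N, of "y \<cdot> m"] y Y A by auto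
  have "z \<cdot> c \<cdot> m = y \<cdot> m"
    using z Y A by simp
  then have "diff y (z \<cdot> c) \<cdot> m = Zero C (Dom C m) N"
    using y z Y by simp
  then obtain x where x: "x \<in> Hom C (Dom C p) N" "x \<cdot> d = diff y (z \<cdot> c)"
    using y z Y A by - (rule ses_desc[OF Y(2), of "diff y (z \<cdot> c)" N], simp_all)
  have "x \<cdot> i = x \<cdot> d \<cdot> j"
    using Y by simp
  also have "\<dots> = diff y (z \<cdot> c) \<cdot> j"
    using comp_eqD'[OF x(2), of j] x Y by simp
  also have "\<dots> = s"
    using y z s Y A' N A by simp
  finally show "\<exists>t\<in>Hom C (Cod C i) N. t \<cdot> i = s"
    using x A by (intro bexI[of _ x]) simp_all
qed

lemma acyclic_Suc: "acyclic (Suc k) A \<Longrightarrow> acyclic k A"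
proof (induction k arbitrary: A)
  case (Suc k)
  then show ?case
    by (simp only: acyclic.simps(2)) blast
qed simp

lemma acyclic_le: "\<lbrakk>acyclic k A; j \<le> k\<rbrakk> \<Longrightarrow> acyclic j A"
proof (induction k)
  case (Suc k)
  then show ?case
    using acyclic_Suc[of k A] by (metis le_Suc_eq)
qed simp

lemma acyclic_ext1: "acyclic (Suc k) A \<Longrightarrow> ext1_zero A"
  and acyclic_syzygy: "\<lbrakk>acyclic (Suc k) A; ses i p; Cod C p = A; Dom C p \<in> M\<rbrakk> \<Longrightarrow> acyclic k (Dom C i)"
  unfolding acyclic.simps(2) by blast+

text \<open>The three consequences of the long exact sequence of \<open>Ext(-, N)\<close> for \<open>0 \<rightarrow> A \<rightarrow> B \<rightarrow> D \<rightarrow> 0\<close>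
  support each other in a common induction.  Cover \<open>B\<close> by \<open>P\<close>: the kernels \<open>K\<close> of \<open>P \<rightarrow> B\<close> and \<open>K''\<close> of
  \<open>P \<rightarrow> D\<close> form \<open>0 \<rightarrow> K \<rightarrow> K'' \<rightarrow> A \<rightarrow> 0\<close>, which deduces the first statement from the third one degree lower,
  and the third from the second.  The second follows from the other two one degree lower, applied to
  the pullback of \<open>B\<close> and a cover of \<open>D\<close>.\<close>

lemma acyclic_closure:
  assumes "\<And>P j. \<lbrakk>P \<in> M; j < k\<rbrakk> \<Longrightarrow> acyclic j P"
  shows "(\<forall>a b. ses a b \<and> acyclic k (Dom C a) \<and> acyclic k (Cod C b) \<longrightarrow> acyclic k (Dom C b)) \<and>
    (\<forall>a b. ses a b \<and> acyclic (k - 1) (Dom C a) \<and> acyclic k (Dom C b) \<and> extends a \<longrightarrow> acyclic k (Cod C b)) \<and>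
    (\<forall>a b. ses a b \<and> acyclic k (Dom C b) \<and> acyclic (Suc k) (Cod C b) \<longrightarrow> acyclic k (Dom C a))"
  using assms
proof (induction k)
  case (Suc n)
  have E_n: "acyclic n (Dom C b)" if "ses a b" "acyclic n (Dom C a)" "acyclic n (Cod C b)" for a b
    using Suc that by (metis less_SucI)
  have K_n: "acyclic n (Dom C a)" if "ses a b" "acyclic n (Dom C b)" "acyclic (Suc n) (Cod C b)" for a b
    using Suc that by (metis less_SucI)
  have M_n: "acyclic n P" if "P \<in> M" for P
    using Suc.prems that by simp
  have E: "acyclic (Suc n) (Dom C b)"
    if ab: "ses a b" "acyclic (Suc n) (Dom C a)" "acyclic (Suc n) (Cod C b)" for a b
  proof -
    have "acyclic n (Dom C k)" if kq: "ses k q" "Cod C q = Dom C b" "Dom C q \<in> M" for k q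
    proof -
      obtain k'' u v where u: "ses k'' (b \<cdot> q)" "ses u v" "u \<in> Hom C (Dom C k) (Dom C k'')"
        "v \<in> Hom C (Dom C k'') (Dom C a)"
        using ses_composite[OF ab(1) kq(1,2)] by metis
      have "acyclic n (Dom C k'')"
        using acyclic_syzygy[OF ab(3) u(1)] ses_arr[OF ab(1)] ses_arr[OF kq(1)] kq by simp
      then have "acyclic n (Dom C u)"
        using K_n[OF u(2)] u ab(2) by simp
      then show ?thesis
        using u by simp
    qed
    then show ?thesis
      using ext1_zero_extension[OF ab(1)] acyclic_ext1 ab by auto
  qed
  have C: "acyclic (Suc n) (Cod C b)"
    if ab: "ses a b" "acyclic n (Dom C a)" "acyclic (Suc n) (Dom C b)" "extends a" for a b
  proof -
    have "acyclic n (Dom C i)" if ip: "ses i p" "Cod C p = Cod C b" "Dom C p \<in> M" for i p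
    proof -
      obtain j c m d where Y: "ses j c" "ses m d" "c \<in> Hom C (Dom C c) (Dom C b)"
        "d \<in> Hom C (Dom C c) (Dom C p)" "j \<in> Hom C (Dom C i) (Dom C c)"
        "m \<in> Hom C (Dom C a) (Dom C c)"
        using pullback_two_ses[OF ip(1) ab(1)] ip by metis
      have "acyclic n (Dom C d)"
        using E_n[OF Y(2)] Y M_n ip ab by simp
      then have "acyclic n (Dom C j)"
        using K_n[OF Y(1)] Y ab by simp
      then show ?thesis
        using Y by simp
    qed
    then show ?thesis
      using ext1_zero_quotient[OF ab(1)] acyclic_ext1 ab by auto
  qed
  have K: "acyclic (Suc n) (Dom C a)"
    if ab: "ses a b" "acyclic (Suc n) (Dom C b)" "acyclic (Suc (Suc n)) (Cod C b)" for a b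
  proof -
    obtain k q where kq: "ses k q" "Cod C q = Dom C b" "Dom C q \<in> M"
      using cover[of "Dom C b"] ses_arr[OF ab(1)] by auto
    note A = ses_arr[OF ab(1)] ses_arr[OF kq(1)]
    obtain k'' u v where u: "ses k'' (b \<cdot> q)" "ses u v" "u \<in> Hom C (Dom C k) (Dom C k'')"
      "v \<in> Hom C (Dom C k'') (Dom C a)" "k'' \<cdot> u = k"
      using ses_composite[OF ab(1) kq(1,2)] by metis
    note A'' = ses_arr[OF u(1)]
    have 1: "acyclic (Suc n) (Dom C k'')"
      using acyclic_syzygy[OF ab(3) u(1)] A kq by simp
    have 2: "acyclic n (Dom C k)"
      using acyclic_syzygy[OF ab(2) kq(1,2,3)] .
    have "extends k"
      using acyclic_ext1[OF ab(2)] kq unfolding ext1_zero_def by blast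
    have "extends u"
      unfolding extends_def
    proof (intro ballI)
      fix N s assume N: "N \<in> M" "s \<in> Hom C (Dom C u) N"
      obtain t where t: "t \<in> Hom C (Cod C k) N" "t \<cdot> k = s"
        using extendsE[OF \<open>extends k\<close> N(1), of s] N u by auto
      have "(t \<cdot> k'') \<cdot> u = s"
        using t u A A'' kq by simp
      then show "\<exists>t\<in>Hom C (Cod C u) N. t \<cdot> u = s"
        using t u A A'' kq by (intro bexI[of _ "t \<cdot> k''"]) simp_all
    qed
    then have "acyclic (Suc n) (Cod C v)"
      using C[OF u(2)] 1 2 u by simp
    then show ?thesis
      using u by simp
  qed
  from E C K show ?case
    by (simp only: diff_Suc_1) blast
qed simp

section \<open>Effaceable classes of extensions\<close>

text \<open>A sequence \<open>0 \<rightarrow> X\<^sub>0 \<rightarrow> X\<^sub>1 \<rightarrow> \<dots> \<rightarrow> X\<^sub>n \<rightarrow> X\<^bsub>n+1\<^esub>\<close> that is exact except possibly at the last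
  object.  Indexing by natural numbers instead of lists keeps the recursions below simple.\<close>

definition exact_sequence :: "(nat \<Rightarrow> 'a) \<Rightarrow> (nat \<Rightarrow> 'b) \<Rightarrow> nat \<Rightarrow> bool" where
  "exact_sequence X e n \<longleftrightarrow> (\<forall>j\<le>n. e j \<in> Hom C (X j) (X (Suc j))) \<and> is_mono C (e 0) \<and>
     (\<forall>j<n. exact_pair C (e j) (e (Suc j)))"

lemma exact_sequence_arr:
  assumes "exact_sequence X e n" "j \<le> n"
  shows "e j \<in> Arr C" "Dom C (e j) = X j" "Cod C (e j) = X (Suc j)"
  using assms unfolding exact_sequence_def by auto

lemma exact_sequence_zero:
  assumes "exact_sequence X e n" "Suc j \<le> n"
  shows "e (Suc j) \<cdot> e j = Zero C (X j) (X (Suc (Suc j)))"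
proof -
  note A = exact_sequence_arr[OF assms(1), of j] exact_sequence_arr[OF assms(1), of "Suc j"]
  obtain k c where k: "is_epi C c" "k \<in> Arr C" "Cod C c = Dom C k" "e j = k \<cdot> c"
    "is_kernel C k (e (Suc j))"
    using assms unfolding exact_sequence_def exact_pair_iff by (meson Suc_le_eq)
  then show ?thesis
    using comp_eqD'[OF kernel_arr(4)[OF k(5)], of c] kernel_arr[OF k(5)] epi_arr[OF k(1)] A assms(2)
      cod_obj[of "e (Suc j)"] by simp
qed

text \<open>Factorisation through \<open>e\<close> after an epimorphism from \<open>M\<close>.  For objects that are not
  projective this is all that exactness provides (\<open>exact_sequence_liftable\<close>).\<close>

definition liftable :: "'b \<Rightarrow> 'b \<Rightarrow> bool" where
  "liftable e g \<longleftrightarrow> (\<exists>i p f. ses i p \<and> Cod C p = Dom C g \<and> Dom C p \<in> M \<and>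
     f \<in> Hom C (Dom C p) (Dom C e) \<and> e \<cdot> f = g \<cdot> p)"

lemma liftable_epi_local:
  assumes q: "is_epi C q" "Cod C q = Dom C g" and y: "y \<in> Hom C (Dom C q) (Dom C e)" "e \<cdot> y = g \<cdot> q"
    and arr: "e \<in> Arr C" "g \<in> Arr C"
  shows "liftable e g"
proof -
  note qa = epi_arr[OF q(1)]
  obtain i p where p: "ses i p" "Cod C p = Dom C q" "Dom C p \<in> M"
    using cover[of "Dom C q"] qa by auto
  note A = ses_arr[OF p(1)]
  have "is_epi C (q \<cdot> p)"
    using epi_comp[of p q] p A q by simp
  then obtain i' where "ses i' (q \<cdot> p)"
    using epi_ses by blast
  moreover have "e \<cdot> (y \<cdot> p) = g \<cdot> (q \<cdot> p)"
    using comp_eqD[OF y(2), of p] y arr q qa p A by simp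
  ultimately show ?thesis
    unfolding liftable_def using y arr q qa p A
    by (intro exI[of _ i'] exI[of _ "q \<cdot> p"] exI[of _ "y \<cdot> p"]) simp
qed

lemma liftable_restrict:
  assumes l: "liftable e g" and u: "u \<in> Hom C W (Dom C g)" and arr: "e \<in> Arr C" "g \<in> Arr C"
  shows "liftable e (g \<cdot> u)"
proof -
  obtain i p f where p: "ses i p" "Cod C p = Dom C g" "Dom C p \<in> M"
     "f \<in> Hom C (Dom C p) (Dom C e)" "e \<cdot> f = g \<cdot> p"
    using l unfolding liftable_def by blast
  note A = ses_arr[OF p(1)]
  obtain Y a b where Y: "a \<in> Hom C Y W" "b \<in> Hom C Y (Dom C p)" "is_epi C a" "u \<cdot> a = p \<cdot> b"
    using pullback_epi[OF u, of p "Dom C p"] A p by (metis Hom_iff)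
  have "e \<cdot> (f \<cdot> b) = g \<cdot> p \<cdot> b"
    using comp_eqD[OF p(5), of b] p Y A arr by simp
  also have "\<dots> = (g \<cdot> u) \<cdot> a"
    using Y u arr by simp
  finally show ?thesis
    using p Y arr u A by (intro liftable_epi_local[OF Y(3), of _ "f \<cdot> b"]) simp_all
qed

lemma liftable_epi:
  assumes e: "is_epi C e" and g: "g \<in> Hom C W (Cod C e)"
  shows "liftable e g"
proof -
  obtain Y a b where Y: "a \<in> Hom C Y W" "b \<in> Hom C Y (Dom C e)" "is_epi C a" "g \<cdot> a = e \<cdot> b"
    using pullback_epi[OF g, of e "Dom C e"] e epi_arr[OF e] by (metis Hom_iff)
  then show ?thesis
    using g epi_arr[OF e] by (intro liftable_epi_local[OF Y(3), of _ b]) simp_all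
qed

lemma exact_sequence_liftable:
  assumes ex: "exact_sequence X e n" and j: "j < n"
    and h: "h \<in> Hom C W (X (Suc j))" "e (Suc j) \<cdot> h = Zero C W (X (Suc (Suc j)))"
  shows "liftable (e j) h"
proof -
  have E: "e j \<in> Arr C" "Dom C (e j) = X j" "Cod C (e j) = X (Suc j)"
    "e (Suc j) \<in> Arr C" "Dom C (e (Suc j)) = X (Suc j)" "Cod C (e (Suc j)) = X (Suc (Suc j))"
    using exact_sequence_arr[OF ex, of j] exact_sequence_arr[OF ex, of "Suc j"] j by auto
  obtain k c where k: "is_epi C c" "k \<in> Arr C" "Cod C c = Dom C k" "e j = k \<cdot> c"
    "is_kernel C k (e (Suc j))"
    using ex j unfolding exact_sequence_def exact_pair_iff by meson
  note ca = epi_arr[OF k(1)] kernel_arr[OF k(5)]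
  obtain u where u: "u \<in> Hom C W (Dom C k)" "k \<cdot> u = h"
    using kernel_lift[OF k(5), of h] h E by (metis Hom_iff)
  have u': "u \<in> Hom C W (Cod C c)"
    using u k by simp
  obtain Y a b where Y: "a \<in> Hom C Y W" "b \<in> Hom C Y (Dom C c)" "is_epi C a" "u \<cdot> a = c \<cdot> b"
    using pullback_epi[OF u', of c "Dom C c"] k ca by (metis Hom_iff)
  have "e j \<cdot> b = k \<cdot> u \<cdot> a"
    using Y k ca by simp
  also have "\<dots> = h \<cdot> a"
    using comp_eqD'[OF u(2), of a] u Y k by simp
  finally show ?thesis
    using Y h E k ca by (intro liftable_epi_local[OF Y(3), of _ b]) simp_all
qed

lemma exact_sequence_lift:
  assumes ex: "exact_sequence X e n" and n: "0 < n"
    and h: "h \<in> Hom C W (X (Suc 0))" "e (Suc 0) \<cdot> h = Zero C W (X (Suc (Suc 0)))"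
  obtains u where "u \<in> Hom C W (X 0)" "e 0 \<cdot> u = h"
proof -
  have E: "e 0 \<in> Arr C" "Dom C (e 0) = X 0" "Cod C (e 0) = X (Suc 0)"
    using exact_sequence_arr[OF ex, of 0] by auto
  have m: "is_mono C (e 0)"
    using ex unfolding exact_sequence_def by blast
  obtain i p f where p: "ses i p" "Cod C p = W" "Dom C p \<in> M" "f \<in> Hom C (Dom C p) (X 0)" "e 0 \<cdot> f = h \<cdot> p"
    using exact_sequence_liftable[OF ex n h] h E unfolding liftable_def by auto
  note A = ses_arr[OF p(1)]
  have "e 0 \<cdot> (f \<cdot> i) = h \<cdot> p \<cdot> i"
    using comp_eqD[OF p(5), of i] p E h A by simp
  then have "f \<cdot> i = Zero C (Dom C i) (X 0)"
    using mono_zero[OF m, of "f \<cdot> i"] p E h A by simp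
  then obtain u where u: "u \<in> Hom C W (X 0)" "u \<cdot> p = f"
    using p A E by - (rule ses_desc[OF p(1), of f "X 0"], simp_all)
  have "(e 0 \<cdot> u) \<cdot> p = h \<cdot> p"
    using u p A E by simp
  then have "e 0 \<cdot> u = h"
    using epi_cancel[OF A(6), of "e 0 \<cdot> u" h] u p A E h by simp
  with u that show ?thesis by blast
qed

text \<open>Let \<open>g : K \<rightarrow> X\<^bsub>m+2\<^esub>\<close> have its image in that of \<open>e\<^bsub>m+1\<^esub>\<close>.  Pulling back the sequence
  \<open>0 \<rightarrow> X\<^sub>0 \<rightarrow> \<dots> \<rightarrow> X\<^bsub>m+1\<^esub>\<close> along \<open>g\<close> gives a class in \<open>Ext\<^bsup>m+1\<^esup>(K, X\<^sub>0)\<close>, and \<open>effaced e m g\<close> says that it is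
  zero.  In degree one this means that \<open>g\<close> lifts to \<open>X\<^sub>1\<close>.  In higher degree the class is the connecting
  image of a class on the kernel of any \<open>p : P \<rightarrow> K\<close> for which \<open>g p\<close> lifts, and if
  \<open>Ext\<^sup>m(P, X\<^sub>0) = 0\<close>, then one class is zero iff the other is.\<close>

primrec effaced :: "(nat \<Rightarrow> 'b) \<Rightarrow> nat \<Rightarrow> 'b \<Rightarrow> bool" where
  "effaced e 0 = (\<lambda>g. \<exists>t\<in>Hom C (Dom C g) (Dom C (e 1)). e 1 \<cdot> t = g)"
| "effaced e (Suc m) = (\<lambda>g. \<forall>i p f. ses i p \<and> Cod C p = Dom C g \<and> Dom C p \<in> M \<and>
     f \<in> Hom C (Dom C p) (Dom C (e (Suc (Suc m)))) \<and> e (Suc (Suc m)) \<cdot> f = g \<cdot> p \<longrightarrow>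
     effaced e m (f \<cdot> i))"

lemma lift_on_kernel:
  assumes ex: "exact_sequence X e n" and m: "Suc (Suc m) \<le> n"
    and p: "ses i p" "Cod C p = Dom C g" "f \<in> Hom C (Dom C p) (X (Suc (Suc m)))"
      "e (Suc (Suc m)) \<cdot> f = g \<cdot> p" "g \<in> Arr C" "Cod C g = X (Suc (Suc (Suc m)))"
  shows "liftable (e (Suc m)) (f \<cdot> i)"
proof -
  note A = ses_arr[OF p(1)]
  have E: "e (Suc (Suc m)) \<in> Arr C" "Dom C (e (Suc (Suc m))) = X (Suc (Suc m))"
    "Cod C (e (Suc (Suc m))) = X (Suc (Suc (Suc m)))"
    using exact_sequence_arr[OF ex m] by auto
  have "e (Suc (Suc m)) \<cdot> (f \<cdot> i) = g \<cdot> p \<cdot> i"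
    using comp_eqD[OF p(4), of i] p E A by simp
  then have "e (Suc (Suc m)) \<cdot> (f \<cdot> i) = Zero C (Dom C i) (X (Suc (Suc (Suc m))))"
    using A p by simp
  then show ?thesis
    using m p A by (intro exact_sequence_liftable[OF ex, of "Suc m" _ "Dom C i"]) simp_all
qed

text \<open>Given a candidate \<open>(P', p', f')\<close> for \<open>g u\<close>, add any candidate \<open>(P\<^sub>0, p\<^sub>0, f\<^sub>0)\<close> for \<open>g\<close>: the map
  \<open>(u p', p\<^sub>0) : P' \<oplus> P\<^sub>0 \<rightarrow> K\<close> is a candidate for \<open>g\<close>, and its kernel contains that of \<open>p'\<close>.\<close>

lemma effaced_restrict:
  assumes ex: "exact_sequence X e n"
  shows "\<lbrakk>Suc m \<le> n; g \<in> Hom C K (X (Suc (Suc m))); liftable (e (Suc m)) g; u \<in> Hom C K' K;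
    effaced e m g\<rbrakk> \<Longrightarrow> effaced e m (g \<cdot> u)"
proof (induction m arbitrary: g K u K')
  case 0
  then obtain t where t: "t \<in> Hom C K (Dom C (e 1))" "e 1 \<cdot> t = g"
    by auto
  have "e 1 \<cdot> (t \<cdot> u) = g \<cdot> u"
    using comp_eqD'[OF t(2), of u] t 0 exact_sequence_arr[OF ex, of 1] by simp
  then show ?case
    unfolding effaced.simps using t 0 by (intro bexI[of _ "t \<cdot> u"]) simp_all
next
  case (Suc m)
  let ?e = "e (Suc (Suc m))" and ?X = "X (Suc (Suc m))"
  have E: "?e \<in> Arr C" "Dom C ?e = ?X" "Cod C ?e = X (Suc (Suc (Suc m)))"
    using exact_sequence_arr[OF ex, of "Suc (Suc m)"] Suc by auto
  obtain i0 p0 f0 where c0: "ses i0 p0" "Cod C p0 = K" "Dom C p0 \<in> M"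
     "f0 \<in> Hom C (Dom C p0) ?X" "?e \<cdot> f0 = g \<cdot> p0"
    using Suc.prems(2,3) E unfolding liftable_def by auto
  note A0 = ses_arr[OF c0(1)]
  note gu = Suc.prems(2,4)
  have "effaced e m (f' \<cdot> i')"
    if c: "ses i' p'" "Cod C p' = Dom C (g \<cdot> u)" "Dom C p' \<in> M"
     "f' \<in> Hom C (Dom C p') (Dom C ?e)" "?e \<cdot> f' = (g \<cdot> u) \<cdot> p'" for i' p' f'
  proof -
    note A = ses_arr[OF c(1)]
    have K': "Cod C p' = K'"
      using c gu by simp
    obtain S s1 s2 t1 t2 where S: "is_direct_sum C S (Dom C p') (Dom C p0)"
      "s1 \<in> Hom C (Dom C p') S" "s2 \<in> Hom C (Dom C p0) S" "t1 \<in> Hom C S (Dom C p')"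
      "t2 \<in> Hom C S (Dom C p0)" "t1 \<cdot> s1 = Ident C (Dom C p')" "t2 \<cdot> s2 = Ident C (Dom C p0)"
      "t1 \<cdot> s2 = Zero C (Dom C p0) (Dom C p')" "t2 \<cdot> s1 = Zero C (Dom C p') (Dom C p0)"
      using biproduct[of "Dom C p'" "Dom C p0"] A A0 by (metis dom_obj)
    have SM: "S \<in> M"
      using M_sum[OF S(1)] c c0 by simp
    define q where "q = Add C (u \<cdot> p' \<cdot> t1) (p0 \<cdot> t2)"
    define F where "F = Add C (f' \<cdot> t1) (f0 \<cdot> t2)"
    have T: "t1 \<in> Hom C S (Dom C p')" "t2 \<in> Hom C S (Dom C p0)" "p' \<in> Hom C (Dom C p') K'"
      "p0 \<in> Hom C (Dom C p0) K" "u \<in> Hom C K' K" "f' \<in> Hom C (Dom C p') ?X"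
      "f0 \<in> Hom C (Dom C p0) ?X" "s1 \<in> Hom C (Dom C p') S" "s2 \<in> Hom C (Dom C p0) S" "?e \<in> Arr C"
      "Dom C ?e = ?X" "g \<in> Arr C" "Dom C g = K"
      using S(2-5) A(2) A0(2) K' c0(2,4) c(4) gu E by simp_all
    have q: "q \<in> Hom C S K"
      using T by (simp add: q_def)
    have F: "F \<in> Hom C S ?X"
      using T by (simp add: F_def)
    have obj: "K \<in> Obj C" "?X \<in> Obj C" "Dom C p' \<in> Obj C" "Dom C p0 \<in> Obj C"
      using T cod_obj[of p0] cod_obj[of f0] dom_obj[of p'] dom_obj[of p0] by auto
    have qs2: "q \<cdot> s2 = p0"
      using T S(6-9) obj by (simp add: q_def)
    have qs1: "q \<cdot> s1 = u \<cdot> p'"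
      using T S(6-9) obj by (simp add: q_def)
    have Fs1: "F \<cdot> s1 = f'"
      using T S(6-9) obj by (simp add: F_def)
    have "is_epi C q"
      using epi_of_comp[of q s2] qs2 A0 q S by simp
    then obtain k where k: "ses k q"
      using epi_ses by blast
    note Ak = ses_arr[OF k]
    have ef: "?e \<cdot> f' = g \<cdot> u \<cdot> p'"
      using c(5) T by simp
    have "g \<cdot> q = Add C (g \<cdot> u \<cdot> p' \<cdot> t1) (g \<cdot> p0 \<cdot> t2)"
      using T unfolding q_def by simp
    also have "g \<cdot> u \<cdot> p' \<cdot> t1 = ?e \<cdot> f' \<cdot> t1"
      using comp_eqD[OF ef, of t1] T by simp
    also have "g \<cdot> p0 \<cdot> t2 = ?e \<cdot> f0 \<cdot> t2"
      using comp_eqD[OF c0(5), of t2] T by simp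
    also have "Add C (?e \<cdot> f' \<cdot> t1) (?e \<cdot> f0 \<cdot> t2) = ?e \<cdot> F"
      using T unfolding F_def by simp
    finally have eF: "?e \<cdot> F = g \<cdot> q" ..
    have eff: "effaced e m (F \<cdot> k)"
      using Suc.prems(5) k q SM F E eF Suc.prems(2) unfolding effaced.simps by auto
    have "q \<cdot> s1 \<cdot> i' = u \<cdot> p' \<cdot> i'"
      using comp_eqD[OF qs1, of i'] q S A gu K' by simp
    then have "q \<cdot> (s1 \<cdot> i') = Zero C (Dom C i') K"
      using gu K' A by simp
    then obtain w where w: "w \<in> Hom C (Dom C i') (Dom C k)" "k \<cdot> w = s1 \<cdot> i'"
      using S A q by - (rule ses_lift[OF k, of "s1 \<cdot> i'" "Dom C i'"], simp_all)
    have "effaced e m ((F \<cdot> k) \<cdot> w)"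
    proof (rule Suc.IH)
      show "liftable (e (Suc m)) (F \<cdot> k)"
        using lift_on_kernel[OF ex Suc.prems(1) k, of g F] q Suc.prems(2) F eF by simp
    qed (use Suc.prems(1) F q Ak w eff in simp_all)
    moreover have "(F \<cdot> k) \<cdot> w = F \<cdot> s1 \<cdot> i'"
      using F q Ak w by simp
    moreover have "\<dots> = f' \<cdot> i'"
      using comp_eqD'[OF Fs1, of i'] F S A by simp
    ultimately show ?thesis
      by simp
  qed
  then show ?case
    by auto
qed

text \<open>This is injectivity of \<open>Ext\<^bsup>m+1\<^esup>(L, X\<^sub>0) \<rightarrow> Ext\<^bsup>m+1\<^esup>(S, X\<^sub>0)\<close> for a subobject \<open>S\<close> of \<open>L\<close> with acyclic
  quotient \<open>L/S\<close>.  In the inductive step one passes from the kernel of a cover of \<open>S\<close> and the kernel of a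
  cover \<open>P\<^sub>L\<close> of \<open>L\<close> to the pullback of the two over \<open>S\<close>, which contains both; the quotient by the first one
  is the kernel of \<open>P\<^sub>L \<rightarrow> L/S\<close> and hence acyclic in one degree less.\<close>

lemma effaced_extension:
  assumes ex: "exact_sequence X e n" and N: "X 0 \<in> M"
  shows "\<lbrakk>Suc m \<le> n; ses s b; acyclic (Suc m) (Cod C b); h \<in> Hom C (Dom C b) (X (Suc (Suc m)));
    liftable (e (Suc m)) h; effaced e m (h \<cdot> s)\<rbrakk> \<Longrightarrow> effaced e m h"
proof (induction m arbitrary: s b h)
  case 0
  have E: "e 0 \<in> Arr C" "Dom C (e 0) = X 0" "Cod C (e 0) = X (Suc 0)"
    "e (Suc 0) \<in> Arr C" "Dom C (e (Suc 0)) = X (Suc 0)" "Cod C (e (Suc 0)) = X (Suc (Suc 0))"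
    using exact_sequence_arr[OF ex, of 0] exact_sequence_arr[OF ex, of "Suc 0"] 0 by auto
  have z: "e (Suc 0) \<cdot> e 0 = Zero C (X 0) (X (Suc (Suc 0)))"
    using exact_sequence_zero[OF ex, of 0] 0 by simp
  have obj: "X 0 \<in> Obj C" "X (Suc 0) \<in> Obj C" "X (Suc (Suc 0)) \<in> Obj C"
    using E dom_obj[of "e 0"] cod_obj[of "e 0"] cod_obj[of "e (Suc 0)"] by auto
  note A = ses_arr[OF 0(2)]
  have h: "h \<in> Arr C" "Dom C h = Dom C b" "Cod C h = X (Suc (Suc 0))"
    using 0(4) by auto
  obtain i c y where c: "ses i c" "Cod C c = Dom C b" "y \<in> Hom C (Dom C c) (X (Suc 0))"
    "e (Suc 0) \<cdot> y = h \<cdot> c"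
    using 0(5) h E unfolding liftable_def by auto
  note Ac = ses_arr[OF c(1)]
  obtain k'' u v where k'': "ses k'' (b \<cdot> c)" "ses u v" "u \<in> Hom C (Dom C i) (Dom C k'')"
    "v \<in> Hom C (Dom C k'') (Dom C s)" "k'' \<cdot> u = i" "s \<cdot> v = c \<cdot> k''"
    by (rule ses_composite[OF 0(2) c(1,2)])
  note Ak = ses_arr[OF k''(1)] ses_arr[OF k''(2)]
  have k3: "Cod C k'' = Dom C c"
    using Ak A Ac c by simp
  obtain t where t: "t \<in> Hom C (Dom C s) (X (Suc 0))" "e (Suc 0) \<cdot> t = h \<cdot> s"
    using 0(6) E h A by auto
  have "e (Suc 0) \<cdot> (y \<cdot> k'') = h \<cdot> c \<cdot> k''"
    using comp_eqD[OF c(4), of k''] c E h Ac Ak(1) k3 by simp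
  also have "\<dots> = h \<cdot> s \<cdot> v"
    using k''(6) by simp
  also have "\<dots> = e (Suc 0) \<cdot> (t \<cdot> v)"
    using comp_eqD[OF t(2), of v] t E h A(1,3) k''(4) by simp
  finally have ey: "e (Suc 0) \<cdot> (y \<cdot> k'') = e (Suc 0) \<cdot> (t \<cdot> v)" .
  have yt: "y \<cdot> k'' \<in> Hom C (Dom C k'') (X (Suc 0))" "t \<cdot> v \<in> Hom C (Dom C k'') (X (Suc 0))"
    using c(3) t(1) k3 Ak(1) k''(4) by simp_all
  have "e (Suc 0) \<cdot> diff (y \<cdot> k'') (t \<cdot> v) = Zero C (Dom C k'') (X (Suc (Suc 0)))"
    using ey yt E by simp
  moreover have "diff (y \<cdot> k'') (t \<cdot> v) \<in> Hom C (Dom C k'') (X (Suc 0))"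
    using yt by simp
  ultimately obtain n where n: "n \<in> Hom C (Dom C k'') (X 0)" "e 0 \<cdot> n = diff (y \<cdot> k'') (t \<cdot> v)"
    using 0(1) by (auto intro: exact_sequence_lift[OF ex])
  have "extends k''"
    using acyclic_ext1[OF 0(3)] k''(1) A Ac c unfolding ext1_zero_def by (metis comp_arr(3))
  then obtain n' where n': "n' \<in> Hom C (Dom C c) (X 0)" "n' \<cdot> k'' = n"
    using extendsE[OF _ N, of k'' n] n k3 by auto
  have "e 0 \<cdot> n' \<cdot> i = e 0 \<cdot> n \<cdot> u"
    using comp_eqD'[OF n'(2), of u] n' k3 Ak(1) k''(3,5) by simp
  also have "\<dots> = diff (y \<cdot> k'') (t \<cdot> v) \<cdot> u"
    using comp_eqD'[OF n(2), of u] n E k''(3) Ak(1) by simp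
  also have "\<dots> = y \<cdot> i"
    using yt Ak(1,7-10) c(3) t(1) k3 k''(3-5) A(1) dom_obj[OF Ac(1)] Ac(1,3) obj by simp
  finally obtain t' where t': "t' \<in> Hom C (Cod C c) (X (Suc 0))" "e (Suc 0) \<cdot> t' = h"
    using corrected_lift[OF c(1) _ z _ _ c(3,4) n'(1)] E h c(2) by (metis Hom_iff)
  then show ?case
    unfolding effaced.simps using E h c(2) by (intro bexI[of _ t']) simp_all
next
  case (Suc m)
  let ?e = "e (Suc (Suc m))" and ?X = "X (Suc (Suc m))" and ?X' = "X (Suc (Suc (Suc m)))"
  have E: "?e \<in> Arr C" "Dom C ?e = ?X" "Cod C ?e = ?X'"
    using exact_sequence_arr[OF ex, of "Suc (Suc m)"] Suc by auto
  note A = ses_arr[OF Suc.prems(2)]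
  have h: "h \<in> Arr C" "Dom C h = Dom C b" "Cod C h = ?X'"
    using Suc.prems(4) by auto
  have hs: "h \<cdot> s \<in> Hom C (Dom C s) ?X'"
    using h A by simp
  have "liftable ?e (h \<cdot> s)"
    using liftable_restrict[OF Suc.prems(5), of s "Dom C s"] h A E by simp
  then obtain i p f where p: "ses i p" "Cod C p = Dom C s" "Dom C p \<in> M"
     "f \<in> Hom C (Dom C p) ?X" "?e \<cdot> f = (h \<cdot> s) \<cdot> p"
    unfolding liftable_def using hs E by auto
  note Ap = ses_arr[OF p(1)]
  have eff: "effaced e m (f \<cdot> i)"
    using Suc.prems(6) p hs E unfolding effaced.simps by auto
  have "effaced e m (fL \<cdot> iL)"
    if c: "ses iL pL" "Cod C pL = Dom C h" "Dom C pL \<in> M"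
      "fL \<in> Hom C (Dom C pL) (Dom C ?e)" "?e \<cdot> fL = h \<cdot> pL" for iL pL fL
  proof -
    note AL = ses_arr[OF c(1)]
    have pLb: "Cod C pL = Dom C b"
      using c h by simp
    obtain k'' u v where k'': "ses k'' (b \<cdot> pL)" "ses u v" "u \<in> Hom C (Dom C iL) (Dom C k'')"
      "v \<in> Hom C (Dom C k'') (Dom C s)" "k'' \<cdot> u = iL" "s \<cdot> v = pL \<cdot> k''"
      by (rule ses_composite[OF Suc.prems(2) c(1) pLb])
    note Ak = ses_arr[OF k''(1)] ses_arr[OF k''(2)]
    have bp: "b \<cdot> pL \<in> Arr C" "Dom C (b \<cdot> pL) = Dom C pL" "Cod C (b \<cdot> pL) = Cod C b"
      using A AL pLb by simp_all
    have k3: "Cod C k'' = Dom C pL"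
      using Ak(3) bp by simp
    obtain j a w d where Y: "ses j a" "ses w d" "a \<in> Hom C (Dom C a) (Dom C v)"
      "d \<in> Hom C (Dom C a) (Dom C p)" "j \<in> Hom C (Dom C i) (Dom C a)"
      "w \<in> Hom C (Dom C u) (Dom C a)" "d \<cdot> j = i" "a \<cdot> w = u" "v \<cdot> a = p \<cdot> d"
      using pullback_two_ses[OF p(1) k''(2)] p(2) k''(4) by (metis Hom_iff)
    note AY = ses_arr[OF Y(1)] ses_arr[OF Y(2)]
    have T: "f \<in> Hom C (Dom C p) ?X" "fL \<in> Hom C (Dom C pL) ?X" "d \<in> Hom C (Dom C a) (Dom C p)"
      "a \<in> Hom C (Dom C a) (Dom C k'')" "k'' \<in> Hom C (Dom C k'') (Dom C pL)"
      "j \<in> Hom C (Dom C i) (Dom C a)" "w \<in> Hom C (Dom C iL) (Dom C a)"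
      "u \<in> Hom C (Dom C iL) (Dom C k'')" "v \<in> Hom C (Dom C k'') (Dom C s)"
      "s \<in> Hom C (Dom C s) (Dom C b)" "p \<in> Hom C (Dom C p) (Dom C s)"
      "pL \<in> Hom C (Dom C pL) (Dom C b)" "i \<in> Hom C (Dom C i) (Dom C p)"
      using p(2,4) c(4) Y(3-6) E Ak(1) k''(3,4) k3 A(1,3) Ap(1-3) AL(2) pLb by simp_all
    \<comment> \<open>The difference of the two lifts, on the pullback: it restricts to \<open>f i\<close> and to \<open>- fL iL\<close> on the kernels.\<close>
    define g where "g = diff (f \<cdot> d) (fL \<cdot> k'' \<cdot> a)"
    have g: "g \<in> Hom C (Dom C a) ?X"
      using T by (simp add: g_def)
    have "?e \<cdot> f \<cdot> d = h \<cdot> s \<cdot> p \<cdot> d"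
      using comp_eqD[of ?e f "h \<cdot> s" p d] p(5) T h E by simp
    also have "\<dots> = h \<cdot> s \<cdot> v \<cdot> a"
      using Y(9) by simp
    also have "\<dots> = h \<cdot> pL \<cdot> k'' \<cdot> a"
      using comp_eqD[OF k''(6), of a] T by simp
    also have "\<dots> = ?e \<cdot> fL \<cdot> k'' \<cdot> a"
      using comp_eqD[OF c(5), of "k'' \<cdot> a"] T h E by simp
    finally have "?e \<cdot> g = Zero C (Dom C a) ?X'"
      using T E unfolding g_def by simp
    then have lg: "liftable (e (Suc m)) g"
      using exact_sequence_liftable[OF ex _ g] Suc.prems(1) by simp
    have "a \<cdot> j = Zero C (Dom C i) (Dom C k'')"
      using AY(4) T by simp
    then have "g \<cdot> j = f \<cdot> i"
      using T Y(7) cod_obj[of f] dom_obj[of i] unfolding g_def by simp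
    then have "effaced e m (g \<cdot> j)"
      using eff by simp
    moreover have "acyclic (Suc m) (Cod C a)"
      using acyclic_syzygy[OF Suc.prems(3) k''(1)] bp c(3) T(4) by simp
    ultimately have "effaced e m g"
      using Suc.IH[OF _ Y(1), of g] Suc.prems(1) g lg by simp
    then have "effaced e m (g \<cdot> neg w)"
      using effaced_restrict[OF ex _ g lg, of "neg w" "Dom C iL"] Suc.prems(1) T by simp
    moreover have "d \<cdot> w = Zero C (Dom C iL) (Dom C p)"
      using AY(10) T Y(4) by simp
    then have "g \<cdot> neg w = fL \<cdot> iL"
      using T Y(8) k''(5) cod_obj[of f] dom_obj[of iL] AL(1,3) unfolding g_def by simp
    ultimately show ?thesis
      by simp
  qed
  then show ?case
    by auto
qed

text \<open>The identity is prescribed at the left end only; the component at the right end varies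
  when extensions are pulled back.\<close>

definition chain_map :: "(nat \<Rightarrow> 'a) \<Rightarrow> (nat \<Rightarrow> 'b) \<Rightarrow> (nat \<Rightarrow> 'a) \<Rightarrow> (nat \<Rightarrow> 'b) \<Rightarrow> (nat \<Rightarrow> 'b) \<Rightarrow> nat \<Rightarrow> bool"
  where "chain_map X e X' e' \<alpha> n \<longleftrightarrow> \<alpha> 0 = Ident C (X 0) \<and>
    (\<forall>j\<le>Suc n. \<alpha> j \<in> Hom C (X j) (X' j)) \<and> (\<forall>j\<le>n. e' j \<cdot> \<alpha> j = \<alpha> (Suc j) \<cdot> e j)"

lemma chain_mapD:
  assumes "chain_map X e X' e' \<alpha> n"
  shows "j \<le> Suc n \<Longrightarrow> \<alpha> j \<in> Arr C" "j \<le> Suc n \<Longrightarrow> Dom C (\<alpha> j) = X j"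
    "j \<le> Suc n \<Longrightarrow> Cod C (\<alpha> j) = X' j" "j \<le> n \<Longrightarrow> e' j \<cdot> \<alpha> j = \<alpha> (Suc j) \<cdot> e j"
    "\<alpha> 0 = Ident C (X 0)"
  using assms unfolding chain_map_def by auto

text \<open>Candidates for \<open>g\<close> are mapped to candidates for its image, so only degree one matters:
  there the map from \<open>X\<^sub>1\<close> onto its image is the pullback of the one from \<open>X'\<^sub>1\<close>, because both sequences
  have the same left end.\<close>

lemma effaced_reflect:
  assumes ex: "exact_sequence X e n" "exact_sequence X' e' n" and \<alpha>: "chain_map X e X' e' \<alpha> n"
    and X': "X' 0 = X 0"
  shows "\<lbrakk>Suc m \<le> n; g \<in> Hom C K (X (Suc (Suc m))); liftable (e (Suc m)) g;
    effaced e' m (\<alpha> (Suc (Suc m)) \<cdot> g)\<rbrakk> \<Longrightarrow> effaced e m g"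
proof (induction m arbitrary: K g)
  case 0
  have E: "e 0 \<in> Arr C" "Dom C (e 0) = X 0" "Cod C (e 0) = X (Suc 0)"
    "e (Suc 0) \<in> Arr C" "Dom C (e (Suc 0)) = X (Suc 0)" "Cod C (e (Suc 0)) = X (Suc (Suc 0))"
    using exact_sequence_arr[OF ex(1), of 0] exact_sequence_arr[OF ex(1), of "Suc 0"] 0 by auto
  have E': "e' 0 \<in> Arr C" "Dom C (e' 0) = X 0" "Cod C (e' 0) = X' (Suc 0)"
    "e' (Suc 0) \<in> Arr C" "Dom C (e' (Suc 0)) = X' (Suc 0)" "Cod C (e' (Suc 0)) = X' (Suc (Suc 0))"
    using exact_sequence_arr[OF ex(2), of 0] exact_sequence_arr[OF ex(2), of "Suc 0"] 0 X' by auto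
  have a: "\<alpha> (Suc 0) \<in> Arr C" "Dom C (\<alpha> (Suc 0)) = X (Suc 0)" "Cod C (\<alpha> (Suc 0)) = X' (Suc 0)"
    "\<alpha> (Suc (Suc 0)) \<in> Arr C" "Dom C (\<alpha> (Suc (Suc 0))) = X (Suc (Suc 0))"
    "Cod C (\<alpha> (Suc (Suc 0))) = X' (Suc (Suc 0))"
    "e' (Suc 0) \<cdot> \<alpha> (Suc 0) = \<alpha> (Suc (Suc 0)) \<cdot> e (Suc 0)"
    using chain_mapD(1-4)[OF \<alpha>, of "Suc 0"] chain_mapD(1-4)[OF \<alpha>, of "Suc (Suc 0)"] 0 by auto
  have a0: "\<alpha> (Suc 0) \<cdot> e 0 = e' 0"
    using chain_mapD(4)[OF \<alpha>, of 0] chain_mapD(5)[OF \<alpha>] E' by simp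
  have m0: "is_mono C (e' 0)"
    using ex unfolding exact_sequence_def by blast
  have z: "e (Suc 0) \<cdot> e 0 = Zero C (X 0) (X (Suc (Suc 0)))"
    using exact_sequence_zero[OF ex(1), of 0] 0 by simp
  have obj: "X 0 \<in> Obj C" "X (Suc 0) \<in> Obj C" "X (Suc (Suc 0)) \<in> Obj C"
    "X' (Suc 0) \<in> Obj C" "X' (Suc (Suc 0)) \<in> Obj C"
    using E E' dom_obj[of "e 0"] cod_obj[of "e 0"] cod_obj[of "e (Suc 0)"]
      cod_obj[of "e' 0"] cod_obj[of "e' (Suc 0)"] by auto
  have g: "g \<in> Arr C" "Dom C g = K" "Cod C g = X (Suc (Suc 0))"
    using 0(2) by auto
  obtain i c y where c: "ses i c" "Cod C c = K" "y \<in> Hom C (Dom C c) (X (Suc 0))"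
    "e (Suc 0) \<cdot> y = g \<cdot> c"
    using 0(3) g E unfolding liftable_def by auto
  note Ac = ses_arr[OF c(1)]
  obtain t where t: "t \<in> Hom C K (X' (Suc 0))" "e' (Suc 0) \<cdot> t = \<alpha> (Suc (Suc 0)) \<cdot> g"
    using 0(4) E' g a by auto
  have "e' (Suc 0) \<cdot> \<alpha> (Suc 0) \<cdot> y = \<alpha> (Suc (Suc 0)) \<cdot> e (Suc 0) \<cdot> y"
    using comp_eqD[OF a(7), of y] a(1-6) E E' c(3) by simp
  also have "\<dots> = \<alpha> (Suc (Suc 0)) \<cdot> g \<cdot> c"
    using c(4) by simp
  also have "\<dots> = e' (Suc 0) \<cdot> t \<cdot> c"
    using comp_eqD[OF t(2), of c] t(1) a(4-6) g E' Ac(2) c(2) by simp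
  finally have ez: "e' (Suc 0) \<cdot> diff (\<alpha> (Suc 0) \<cdot> y) (t \<cdot> c) = Zero C (Dom C c) (X' (Suc (Suc 0)))"
    using a(1-6) E' c(2,3) t(1) Ac(2) by simp
  have yt: "\<alpha> (Suc 0) \<cdot> y \<in> Hom C (Dom C c) (X' (Suc 0))" "t \<cdot> c \<in> Hom C (Dom C c) (X' (Suc 0))"
    using a(1-3) c(2,3) t(1) Ac(2) by simp_all
  then have dh: "diff (\<alpha> (Suc 0) \<cdot> y) (t \<cdot> c) \<in> Hom C (Dom C c) (X' (Suc 0))"
    by simp
  have n: "0 < n"
    using 0(1) by simp
  obtain l where "l \<in> Hom C (Dom C c) (X' 0)" "e' 0 \<cdot> l = diff (\<alpha> (Suc 0) \<cdot> y) (t \<cdot> c)"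
    by (rule exact_sequence_lift[OF ex(2) n dh ez])
  then have l: "l \<in> Hom C (Dom C c) (X 0)" "e' 0 \<cdot> l = diff (\<alpha> (Suc 0) \<cdot> y) (t \<cdot> c)"
    unfolding X' by blast+
  have yi: "y \<cdot> i \<in> Hom C (Dom C i) (X (Suc 0))"
    using c(3) Ac(1,3) by simp
  have "e (Suc 0) \<cdot> (y \<cdot> i) = Zero C (Dom C i) (X (Suc (Suc 0)))"
    using comp_eqD[OF c(4), of i] c(2,3) E g Ac(1-4) by simp
  then obtain r where r: "r \<in> Hom C (Dom C i) (X 0)" "e 0 \<cdot> r = y \<cdot> i"
    using exact_sequence_lift[OF ex(1) n yi] by blast
  have "e' 0 \<cdot> r = \<alpha> (Suc 0) \<cdot> y \<cdot> i"
    using comp_eqD'[OF a0, of r] r a(1-3) E by simp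
  also have "\<dots> = diff (\<alpha> (Suc 0) \<cdot> y) (t \<cdot> c) \<cdot> i"
    using yt a(1-3) c(2,3) t(1) Ac(1-4) obj by simp
  also have "\<dots> = e' 0 \<cdot> l \<cdot> i"
    using comp_eqD'[OF l(2), of i] l(1) E' Ac(1,3) by simp
  finally have "r = l \<cdot> i"
    by (rule mono_cancel[OF m0]) (use r(1) l(1) Ac(1,3) E' in simp_all)
  then have "e 0 \<cdot> l \<cdot> i = y \<cdot> i"
    using r(2) by simp
  then obtain t' where t': "t' \<in> Hom C (Cod C c) (X (Suc 0))" "e (Suc 0) \<cdot> t' = g"
    using corrected_lift[OF c(1) _ z _ _ c(3,4) l(1)] E g c(2) by (metis Hom_iff)
  then show ?case
    unfolding effaced.simps using E g c(2) by (intro bexI[of _ t']) simp_all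
next
  case (Suc m)
  let ?e = "e (Suc (Suc m))" and ?e' = "e' (Suc (Suc m))" and ?a = "\<alpha> (Suc (Suc m))"
    and ?a' = "\<alpha> (Suc (Suc (Suc m)))"
  have E: "?e \<in> Arr C" "Dom C ?e = X (Suc (Suc m))" "Cod C ?e = X (Suc (Suc (Suc m)))"
    using exact_sequence_arr[OF ex(1), of "Suc (Suc m)"] Suc by auto
  have E': "?e' \<in> Arr C" "Dom C ?e' = X' (Suc (Suc m))" "Cod C ?e' = X' (Suc (Suc (Suc m)))"
    using exact_sequence_arr[OF ex(2), of "Suc (Suc m)"] Suc by auto
  have a: "?a \<in> Arr C" "Dom C ?a = X (Suc (Suc m))" "Cod C ?a = X' (Suc (Suc m))"
    "?a' \<in> Arr C" "Dom C ?a' = X (Suc (Suc (Suc m)))" "Cod C ?a' = X' (Suc (Suc (Suc m)))"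
    "?e' \<cdot> ?a = ?a' \<cdot> ?e"
    using chain_mapD(1-4)[OF \<alpha>, of "Suc (Suc m)"] chain_mapD(1-4)[OF \<alpha>, of "Suc (Suc (Suc m))"] Suc.prems(1)
    by auto
  have g: "g \<in> Arr C" "Dom C g = K" "Cod C g = X (Suc (Suc (Suc m)))"
    using Suc.prems(2) by auto
  have "effaced e m (f \<cdot> i)"
    if c: "ses i p" "Cod C p = Dom C g" "Dom C p \<in> M"
      "f \<in> Hom C (Dom C p) (Dom C ?e)" "?e \<cdot> f = g \<cdot> p" for i p f
  proof -
    note A = ses_arr[OF c(1)]
    have f: "f \<in> Hom C (Dom C p) (X (Suc (Suc m)))"
      using c(4) E by simp
    have "?e' \<cdot> (?a \<cdot> f) = ?a' \<cdot> ?e \<cdot> f"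
      using comp_eqD[OF a(7), of f] a(1-6) E E' f by simp
    also have "\<dots> = (?a' \<cdot> g) \<cdot> p"
      using c(2,5) a(4,5) g A(2) by simp
    finally have "effaced e' m ((?a \<cdot> f) \<cdot> i)"
      using Suc.prems(4) c(1-3) a(1-6) g f E' unfolding effaced.simps by auto
    moreover have "(?a \<cdot> f) \<cdot> i = ?a \<cdot> (f \<cdot> i)"
      using a(1,2) f A(1,3) by simp
    ultimately show ?thesis
      using Suc.IH[of "f \<cdot> i" "Dom C i"] Suc.prems(1) f A(1,3)
        lift_on_kernel[OF ex(1) Suc.prems(1) c(1,2) f c(5) g(1,3)] by simp
  qed
  then show ?case
    by auto
qed

text \<open>A candidate \<open>P\<close> for the image of \<open>g\<close> need not come from one for \<open>g\<close>.  It is compared with a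
  candidate \<open>P\<^sub>0\<close> that does, on the pullback of \<open>P\<close> and \<open>P\<^sub>0\<close>: the class is zero on the kernel of \<open>P\<^sub>0\<close>, hence
  on the whole pullback by \<open>effaced_extension\<close>, since the quotient \<open>P\<close> is acyclic, and hence on the kernel of
  \<open>P\<close>.\<close>

lemma effaced_preserve:
  assumes ex: "exact_sequence X e n" "exact_sequence X' e' n" and \<alpha>: "chain_map X e X' e' \<alpha> n"
    and X': "X' 0 \<in> M"
  shows "\<lbrakk>Suc m \<le> n; \<And>P. P \<in> M \<Longrightarrow> acyclic m P; g \<in> Hom C K (X (Suc (Suc m)));
    liftable (e (Suc m)) g; effaced e m g\<rbrakk> \<Longrightarrow> effaced e' m (\<alpha> (Suc (Suc m)) \<cdot> g)"
proof (induction m arbitrary: K g)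
  case 0
  have E: "e (Suc 0) \<in> Arr C" "Dom C (e (Suc 0)) = X (Suc 0)" "Cod C (e (Suc 0)) = X (Suc (Suc 0))"
    using exact_sequence_arr[OF ex(1), of "Suc 0"] 0 by auto
  have E': "e' (Suc 0) \<in> Arr C" "Dom C (e' (Suc 0)) = X' (Suc 0)" "Cod C (e' (Suc 0)) = X' (Suc (Suc 0))"
    using exact_sequence_arr[OF ex(2), of "Suc 0"] 0 by auto
  have a: "\<alpha> (Suc 0) \<in> Arr C" "Dom C (\<alpha> (Suc 0)) = X (Suc 0)" "Cod C (\<alpha> (Suc 0)) = X' (Suc 0)"
    "\<alpha> (Suc (Suc 0)) \<in> Arr C" "Dom C (\<alpha> (Suc (Suc 0))) = X (Suc (Suc 0))"
    "e' (Suc 0) \<cdot> \<alpha> (Suc 0) = \<alpha> (Suc (Suc 0)) \<cdot> e (Suc 0)"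
    using chain_mapD(1-4)[OF \<alpha>, of "Suc 0"] chain_mapD(1-4)[OF \<alpha>, of "Suc (Suc 0)"] 0 by auto
  obtain t where "t \<in> Hom C (Dom C g) (Dom C (e 1))" "e 1 \<cdot> t = g"
    using 0(5) unfolding effaced.simps by blast
  then have t: "t \<in> Hom C K (X (Suc 0))" "e (Suc 0) \<cdot> t = g"
    using 0(3) E by simp_all
  have "e' (Suc 0) \<cdot> (\<alpha> (Suc 0) \<cdot> t) = \<alpha> (Suc (Suc 0)) \<cdot> g"
    using comp_eqD[OF a(6), of t] t a(1-5) E E' by simp
  then show ?case
    unfolding effaced.simps using t(1) a(1-5) E' 0(3)
    by (intro bexI[of _ "\<alpha> (Suc 0) \<cdot> t"]) simp_all
next
  case (Suc m)
  let ?e = "e (Suc (Suc m))" and ?e' = "e' (Suc (Suc m))" and ?a = "\<alpha> (Suc (Suc m))"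
    and ?a' = "\<alpha> (Suc (Suc (Suc m)))"
  have E: "?e \<in> Arr C" "Dom C ?e = X (Suc (Suc m))" "Cod C ?e = X (Suc (Suc (Suc m)))"
    using exact_sequence_arr[OF ex(1), of "Suc (Suc m)"] Suc by auto
  have E': "?e' \<in> Arr C" "Dom C ?e' = X' (Suc (Suc m))" "Cod C ?e' = X' (Suc (Suc (Suc m)))"
    using exact_sequence_arr[OF ex(2), of "Suc (Suc m)"] Suc by auto
  have a: "?a \<in> Arr C" "Dom C ?a = X (Suc (Suc m))" "Cod C ?a = X' (Suc (Suc m))"
    "?a' \<in> Arr C" "Dom C ?a' = X (Suc (Suc (Suc m)))" "Cod C ?a' = X' (Suc (Suc (Suc m)))"
    "?e' \<cdot> ?a = ?a' \<cdot> ?e"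
    using chain_mapD(1-4)[OF \<alpha>, of "Suc (Suc m)"] chain_mapD(1-4)[OF \<alpha>, of "Suc (Suc (Suc m))"] Suc.prems(1)
    by auto
  have g: "g \<in> Arr C" "Dom C g = K" "Cod C g = X (Suc (Suc (Suc m)))"
    using Suc.prems(3) by auto
  obtain i0 p0 f0 where c0: "ses i0 p0" "Cod C p0 = Dom C g" "Dom C p0 \<in> M"
     "f0 \<in> Hom C (Dom C p0) (X (Suc (Suc m)))" "?e \<cdot> f0 = g \<cdot> p0"
    using Suc.prems(4) g E unfolding liftable_def by auto
  note A0 = ses_arr[OF c0(1)]
  have "effaced e m (f0 \<cdot> i0)"
    using Suc.prems(5) c0 E unfolding effaced.simps by auto
  moreover have "acyclic m P" if "P \<in> M" for P
    using Suc.prems(2)[OF that] acyclic_Suc by blast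
  moreover have "f0 \<cdot> i0 \<in> Hom C (Dom C i0) (X (Suc (Suc m)))"
    using c0(4) A0(1,3) by simp
  ultimately have eff: "effaced e' m (?a \<cdot> f0 \<cdot> i0)"
    using Suc.prems(1) lift_on_kernel[OF ex(1) Suc.prems(1) c0(1,2,4,5) g(1,3)]
    by (intro Suc.IH) auto
  have "effaced e' m (f \<cdot> i)"
    if c: "ses i p" "Cod C p = Dom C (?a' \<cdot> g)" "Dom C p \<in> M"
      "f \<in> Hom C (Dom C p) (Dom C ?e')" "?e' \<cdot> f = (?a' \<cdot> g) \<cdot> p" for i p f
  proof -
    note A = ses_arr[OF c(1)]
    have pg: "Cod C p = Dom C g"
      using c(2) g a(4,5) by simp
    obtain j b w d where Y: "ses j b" "ses w d" "b \<in> Hom C (Dom C b) (Dom C p)"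
      "d \<in> Hom C (Dom C b) (Dom C p0)" "j \<in> Hom C (Dom C i0) (Dom C b)"
      "w \<in> Hom C (Dom C i) (Dom C b)" "d \<cdot> j = i0" "b \<cdot> w = i" "p \<cdot> b = p0 \<cdot> d"
      using pullback_two_ses[OF c0(1) c(1)] c0(2) pg by metis
    note AY = ses_arr[OF Y(1)] ses_arr[OF Y(2)]
    have T: "f \<in> Hom C (Dom C p) (X' (Suc (Suc m)))" "f0 \<in> Hom C (Dom C p0) (X (Suc (Suc m)))"
      "p \<in> Hom C (Dom C p) K" "p0 \<in> Hom C (Dom C p0) K" "b \<in> Hom C (Dom C b) (Dom C p)"
      "d \<in> Hom C (Dom C b) (Dom C p0)" "j \<in> Hom C (Dom C i0) (Dom C b)"
      "w \<in> Hom C (Dom C i) (Dom C b)" "i \<in> Hom C (Dom C i) (Dom C p)"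
      "i0 \<in> Hom C (Dom C i0) (Dom C p0)"
      using c(4) c0(2,4) E' A(1,2,3) A0(1,2,3) pg g Y(3-6) by simp_all
    \<comment> \<open>Again the difference of two lifts; the sign is undone by restricting along \<open>- w\<close>.\<close>
    define r where "r = diff (?a \<cdot> f0 \<cdot> d) (f \<cdot> b)"
    have r: "r \<in> Hom C (Dom C b) (X' (Suc (Suc m)))"
      using T a(1-3) by (simp add: r_def)
    have "?e' \<cdot> ?a \<cdot> f0 \<cdot> d = ?a' \<cdot> ?e \<cdot> f0 \<cdot> d"
      using comp_eqD[OF a(7), of "f0 \<cdot> d"] a(1-6) E E' T by simp
    also have "\<dots> = ?a' \<cdot> g \<cdot> p0 \<cdot> d"
      using comp_eqD[OF c0(5), of d] E T g by simp
    also have "\<dots> = ?a' \<cdot> g \<cdot> p \<cdot> b"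
      using Y(9) by simp
    also have "\<dots> = ?e' \<cdot> f \<cdot> b"
      using comp_eqD[of ?e' f "?a' \<cdot> g" p b] c(5) E' T g a(4-6) by simp
    finally have "?e' \<cdot> r = Zero C (Dom C b) (X' (Suc (Suc (Suc m))))"
      using T a(1-3) E' unfolding r_def by simp
    then have lr: "liftable (e' (Suc m)) r"
      using exact_sequence_liftable[OF ex(2) _ r] Suc.prems(1) by simp
    have "b \<cdot> j = Zero C (Dom C i0) (Dom C p)"
      using AY(4) T by simp
    then have "r \<cdot> j = ?a \<cdot> f0 \<cdot> i0"
      using T Y(7) cod_obj[of f] dom_obj[of i0] a(1-3) unfolding r_def by simp
    then have "effaced e' m (r \<cdot> j)"
      using eff by simp
    moreover have "acyclic (Suc m) (Cod C b)"
      using Suc.prems(2)[OF c(3)] T by simp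
    ultimately have "effaced e' m r"
      using effaced_extension[OF ex(2) X' _ Y(1), of m r] Suc.prems(1) r lr by simp
    then have "effaced e' m (r \<cdot> neg w)"
      using effaced_restrict[OF ex(2) _ r lr, of "neg w" "Dom C i"] Suc.prems(1) T by simp
    moreover have "d \<cdot> w = Zero C (Dom C i) (Dom C p0)"
      using AY(10) T by simp
    then have "r \<cdot> neg w = f \<cdot> i"
      using T Y(8) cod_obj[of f] dom_obj[of i] a(1-3) unfolding r_def by simp
    ultimately show ?thesis
      by simp
  qed
  then show ?case
    by auto
qed

section \<open>Vanishing of Yoneda Ext\<close>

definition is_extension :: "(nat \<Rightarrow> 'a) \<Rightarrow> (nat \<Rightarrow> 'b) \<Rightarrow> nat \<Rightarrow> 'a \<Rightarrow> 'a \<Rightarrow> bool" where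
  "is_extension X e n A N \<longleftrightarrow> exact_sequence X e n \<and> X 0 = N \<and> X (Suc n) = A \<and> is_epi C (e n)"

lemma objects_nth:
  "objects C fs ! 0 = Dom C (hd fs)"
  "j < length fs \<Longrightarrow> objects C fs ! Suc j = Cod C (fs ! j)"
  by (simp_all add: objects_def)

lemma sequence_nth:
  assumes fs: "is_sequence C fs" and j: "j < length fs"
  shows "fs ! j \<in> Hom C (objects C fs ! j) (objects C fs ! Suc j)"
proof -
  have "fs ! j \<in> Arr C"
    using fs j nth_mem[of j fs] unfolding is_sequence_def by auto
  moreover have "Dom C (fs ! j) = objects C fs ! j"
  proof (cases j)
    case 0
    then show ?thesis
      using j by (simp add: objects_nth hd_conv_nth flip: length_greater_0_conv)
  next
    case (Suc k)
    then have "Cod C (fs ! k) = Dom C (fs ! Suc k)"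
      using fs j unfolding is_sequence_def by simp
    then show ?thesis
      using Suc j by (simp add: objects_nth)
  qed
  ultimately show ?thesis
    using j by (simp add: objects_nth)
qed

lemma is_extension_of_list:
  assumes "fs \<in> extensions C n A N"
  shows "is_extension (nth (objects C fs)) (nth fs) n A N"
proof -
  have fs: "length fs = Suc n" "is_sequence C fs" "Dom C (hd fs) = N" "Cod C (last fs) = A"
    "is_mono C (hd fs)" "is_epi C (last fs)" "\<forall>k<n. exact_pair C (fs ! k) (fs ! Suc k)"
    using assms unfolding extensions_def by auto
  have hd: "hd fs = fs ! 0" and last: "last fs = fs ! n"
    using fs(1) by (auto simp: hd_conv_nth last_conv_nth simp flip: length_greater_0_conv)
  have "fs ! j \<in> Hom C (objects C fs ! j) (objects C fs ! Suc j)" if "j \<le> n" for j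
    using sequence_nth[OF fs(2)] fs(1) that by simp
  moreover have "objects C fs ! 0 = N" "objects C fs ! Suc n = A"
    using fs(1,3,4) last by (simp_all add: objects_nth)
  ultimately show ?thesis
    using fs(5-7) unfolding is_extension_def exact_sequence_def hd last by blast
qed

lemma objects_map:
  assumes "\<And>j. j \<le> n \<Longrightarrow> e j \<in> Hom C (X j) (X (Suc j))" "j \<le> Suc n"
  shows "objects C (map e [0..<Suc n]) ! j = X j"
  using assms(1)[of 0] assms(1)[of "j - 1"] assms(2)
  by (cases j) (auto simp: objects_def hd_map nth_append simp del: upt_Suc)

lemma extension_of_functions:
  assumes "is_extension X e n A N"
  shows "map e [0..<Suc n] \<in> extensions C n A N"
proof -
  have e: "\<And>j. j \<le> n \<Longrightarrow> e j \<in> Hom C (X j) (X (Suc j))"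
    using assms unfolding is_extension_def exact_sequence_def by blast
  then have "set (map e [0..<Suc n]) \<subseteq> Arr C"
    by (auto simp del: upt_Suc)
  moreover have "Cod C (e j) = Dom C (e (Suc j))" if "Suc j \<le> n" for j
    using e[of j] e[of "Suc j"] that by simp
  ultimately show ?thesis
    using assms e[of 0] e[of n]
    by (auto simp: extensions_def is_extension_def exact_sequence_def is_sequence_def
        hd_map last_map simp del: upt_Suc)
qed

lemma extension_morphismI:
  assumes X: "is_extension X e n A N" and X': "is_extension X' e' n A N"
    and \<alpha>: "chain_map X e X' e' \<alpha> n" "\<alpha> (Suc n) = Ident C A"
  shows "(map e [0..<Suc n], map e' [0..<Suc n]) \<in> extension_morphism C n A N"
proof -
  have e: "\<And>j. j \<le> n \<Longrightarrow> e j \<in> Hom C (X j) (X (Suc j))" "\<And>j. j \<le> n \<Longrightarrow> e' j \<in> Hom C (X' j) (X' (Suc j))"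
    using X X' unfolding is_extension_def exact_sequence_def by blast+
  have "\<alpha> 0 = Ident C N"
    using \<alpha> X unfolding chain_map_def is_extension_def by blast
  moreover have "\<forall>k\<le>Suc n. \<alpha> k \<in> Hom C (objects C (map e [0..<Suc n]) ! k) (objects C (map e' [0..<Suc n]) ! k)"
    using \<alpha>(1) unfolding chain_map_def
    by (auto simp: objects_map[of n e X, OF e(1)] objects_map[of n e' X', OF e(2)] simp del: upt_Suc Hom_iff)
  moreover have "\<forall>k\<le>n. map e' [0..<Suc n] ! k \<cdot> \<alpha> k = \<alpha> (Suc k) \<cdot> map e [0..<Suc n] ! k"
    using \<alpha>(1) unfolding chain_map_def by (auto simp del: upt_Suc)
  ultimately show ?thesis
    unfolding extension_morphism_def
    using extension_of_functions[OF X] extension_of_functions[OF X'] \<alpha>(2) by blast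
qed

lemma extension_morphismE:
  assumes "(fs, gs) \<in> extension_morphism C n A N"
  obtains \<alpha> where "chain_map (nth (objects C fs)) (nth fs) (nth (objects C gs)) (nth gs) \<alpha> n"
    "\<alpha> (Suc n) = Ident C A" "fs \<in> extensions C n A N" "gs \<in> extensions C n A N"
proof -
  obtain \<alpha> where \<alpha>: "fs \<in> extensions C n A N" "gs \<in> extensions C n A N"
    "\<alpha> 0 = Ident C N" "\<alpha> (Suc n) = Ident C A"
    "\<forall>k\<le>Suc n. \<alpha> k \<in> Hom C (objects C fs ! k) (objects C gs ! k)"
    "\<forall>k\<le>n. gs ! k \<cdot> \<alpha> k = \<alpha> (Suc k) \<cdot> fs ! k"
    using assms unfolding extension_morphism_def by blast
  moreover have "objects C fs ! 0 = N"
    using is_extension_of_list[OF \<alpha>(1)] unfolding is_extension_def by blast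
  ultimately show ?thesis
    using that[of \<alpha>] unfolding chain_map_def by blast
qed

lemma Ext_zero_iff:
  "Ext_zero C n A N \<longleftrightarrow> extensions C n A N \<noteq> {} \<and>
     (\<forall>fs\<in>extensions C n A N. \<forall>gs\<in>extensions C n A N. (fs, gs) \<in> extension_equiv C n A N)"
proof -
  let ?E = "extensions C n A N" and ?R = "extension_equiv C n A N"
  have refl: "(fs, fs) \<in> ?R" if "fs \<in> ?E" for fs
    using that unfolding extension_equiv_def by blast
  have R: "?R \<subseteq> ?E \<times> ?E"
    unfolding extension_equiv_def by blast
  show ?thesis
  proof
    assume "Ext_zero C n A N"
    then obtain c where c: "?E // ?R = {c}"
      unfolding Ext_zero_def Ext_def is_singleton_def by blast
    then have "?R `` {fs} = c" if "fs \<in> ?E" for fs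
      using quotientI[OF that, of ?R] by blast
    then have "(fs, gs) \<in> ?R" if "fs \<in> ?E" "gs \<in> ?E" for fs gs
      using refl[OF that(2)] that by blast
    moreover have "?E \<noteq> {}"
      using c unfolding quotient_def by blast
    ultimately show "?E \<noteq> {} \<and> (\<forall>fs\<in>?E. \<forall>gs\<in>?E. (fs, gs) \<in> ?R)"
      by blast
  next
    assume *: "?E \<noteq> {} \<and> (\<forall>fs\<in>?E. \<forall>gs\<in>?E. (fs, gs) \<in> ?R)"
    then have "?R `` {fs} = ?E" if "fs \<in> ?E" for fs
      using R that by blast
    then have "?E // ?R = {?E}"
      using * unfolding quotient_def by blast
    then show "Ext_zero C n A N"
      unfolding Ext_zero_def Ext_def is_singleton_def by blast
  qed
qed

text \<open>Both directions along a morphism are needed, as equivalences of extensions are zigzags.\<close>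

lemma effaced_equiv:
  assumes eq: "(fs, gs) \<in> extension_equiv C (Suc m) A N" and N: "N \<in> M"
    and M: "\<And>P. P \<in> M \<Longrightarrow> acyclic m P" and eff: "effaced (nth fs) m (Ident C A)"
  shows "effaced (nth gs) m (Ident C A)"
proof -
  let ?R = "extension_morphism C (Suc m) A N"
  have step: "effaced (nth x) m (Ident C A) \<longleftrightarrow> effaced (nth y) m (Ident C A)" if xy: "(x, y) \<in> ?R" for x y
  proof -
    obtain \<alpha> where \<alpha>: "chain_map (nth (objects C x)) (nth x) (nth (objects C y)) (nth y) \<alpha> (Suc m)"
      "\<alpha> (Suc (Suc m)) = Ident C A" "x \<in> extensions C (Suc m) A N" "y \<in> extensions C (Suc m) A N"
      using extension_morphismE[OF xy] by blast
    have x: "exact_sequence (nth (objects C x)) (nth x) (Suc m)" "objects C x ! 0 = N"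
      "objects C x ! Suc (Suc m) = A" "is_epi C (x ! Suc m)"
      using is_extension_of_list[OF \<alpha>(3)] unfolding is_extension_def by blast+
    have y: "exact_sequence (nth (objects C y)) (nth y) (Suc m)" "objects C y ! 0 = N"
      using is_extension_of_list[OF \<alpha>(4)] unfolding is_extension_def by blast+
    have c: "Cod C (x ! Suc m) = A"
      using exact_sequence_arr[OF x(1), of "Suc m"] x(3) by simp
    then have A: "A \<in> Obj C"
      using epi_arr[OF x(4)] by auto
    have id: "Ident C A \<in> Hom C A (objects C x ! Suc (Suc m))"
      using A x(3) by simp
    have l: "liftable (x ! Suc m) (Ident C A)"
      using liftable_epi[OF x(4), of "Ident C A" A] A c by simp
    show ?thesis
      using effaced_preserve[OF x(1) y(1) \<alpha>(1) _ _ M id l]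
        effaced_reflect[OF x(1) y(1) \<alpha>(1) _ _ id l] x(2) y(2) N A \<alpha>(2) by auto
  qed
  have "(fs, gs) \<in> (?R \<union> ?R\<inverse>)\<^sup>*"
    using eq unfolding extension_equiv_def by blast
  then show ?thesis
    by (induction rule: rtrancl_induct) (use eff step in auto)
qed

lemma split_ses:
  assumes "i \<in> Hom C X S" "j \<in> Hom C Y S" "p \<in> Hom C S X" "q \<in> Hom C S Y"
    "p \<cdot> i = Ident C X" "q \<cdot> j = Ident C Y" "q \<cdot> i = Zero C X Y" "Add C (i \<cdot> p) (j \<cdot> q) = Ident C S"
  shows "ses i q"
proof (rule kernel_epi_ses)
  have X: "X \<in> Obj C" "Y \<in> Obj C"
    using assms by auto
  show "is_epi C q"
    using epi_of_comp[of q j] ident_epi[OF X(2)] assms by auto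
  show "is_kernel C i q"
  proof (rule kernelI)
    show "is_mono C i"
      using mono_of_comp[of p i] ident_mono[OF X(1)] assms by auto
    fix h assume h: "h \<in> Arr C" "Cod C h = Dom C q" "q \<cdot> h = Zero C (Dom C h) (Cod C q)"
    have "h = Add C (i \<cdot> p) (j \<cdot> q) \<cdot> h"
      using assms h by simp
    also have "\<dots> = Add C (i \<cdot> p \<cdot> h) (j \<cdot> q \<cdot> h)"
      using assms(1-4) h by (subst comp_add(2)) simp_all
    also have "\<dots> = i \<cdot> p \<cdot> h"
      using assms h by simp
    finally have "i \<cdot> (p \<cdot> h) = h" ..
    then show "\<exists>u. u \<in> Arr C \<and> Dom C u = Dom C h \<and> Cod C u = Dom C i \<and> i \<cdot> u = h"
      using assms h by (intro exI[of _ "p \<cdot> h"]) simp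
  qed (use assms in auto)
qed

lemma ses_exact_pair: "ses i p \<Longrightarrow> exact_pair C i p"
  unfolding exact_pair_iff using ses_arr[of i p] ident_epi[of "Dom C i"]
  by (intro exI[of _ i] exI[of _ "Ident C (Dom C i)"]) (simp add: ses_def)

lemma exact_pair_zero:
  assumes "W \<in> Obj C" "f \<in> Arr C" "is_epi C f"
  shows "exact_pair C f (Zero C (Cod C f) W)"
proof -
  have "is_kernel C (Ident C (Cod C f)) (Zero C (Cod C f) W)"
  proof (rule kernelI)
    fix h assume "h \<in> Arr C" "Cod C h = Dom C (Zero C (Cod C f) W)"
    then show "\<exists>u. u \<in> Arr C \<and> Dom C u = Dom C h \<and> Cod C u = Dom C (Ident C (Cod C f)) \<and>
        Ident C (Cod C f) \<cdot> u = h"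
      using assms by (intro exI[of _ h]) simp
  qed (use assms ident_mono in auto)
  then show ?thesis
    unfolding exact_pair_iff using assms
    by (intro exI[of _ "Ident C (Cod C f)"] exI[of _ f]) simp
qed

lemma effaced_zero:
  assumes "\<And>j. j \<le> m \<Longrightarrow> e (Suc j) \<in> Hom C (X (Suc j)) (X (Suc (Suc j)))"
    and "\<And>j. \<lbrakk>2 \<le> j; j \<le> Suc m\<rbrakk> \<Longrightarrow> is_zero_object C (X j)" and "K \<in> Obj C"
  shows "effaced e m (Zero C K (X (Suc (Suc m))))"
  using assms
proof (induction m arbitrary: K)
  case 0
  have "e (Suc 0) \<in> Hom C (X (Suc 0)) (X (Suc (Suc 0)))"
    using 0 by blast
  moreover from this have "X (Suc 0) \<in> Obj C" "X (Suc (Suc 0)) \<in> Obj C"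
    using dom_obj[of "e (Suc 0)"] cod_obj[of "e (Suc 0)"] by auto
  ultimately show ?case
    unfolding effaced.simps using 0(3) by (intro bexI[of _ "Zero C K (X (Suc 0))"]) simp_all
next
  case (Suc m)
  have e: "e (Suc (Suc m)) \<in> Hom C (X (Suc (Suc m))) (X (Suc (Suc (Suc m))))"
    using Suc.prems(1) by blast
  have Z: "is_zero_object C (X (Suc (Suc m)))"
    using Suc.prems(2) by simp
  have "effaced e m (f \<cdot> i)" if "ses i p" "f \<in> Hom C (Dom C p) (Dom C (e (Suc (Suc m))))" for i p f
  proof -
    have "f \<cdot> i = Zero C (Dom C i) (X (Suc (Suc m)))"
      using zero_object_Zero(1)[OF Z, of "f \<cdot> i" "Dom C i"] that e ses_arr[OF that(1)] by simp
    moreover have "effaced e m (Zero C (Dom C i) (X (Suc (Suc m))))"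
      using ses_arr(1)[OF that(1)] Suc.prems(1,2) by (intro Suc.IH) auto
    ultimately show ?thesis
      by simp
  qed
  then show ?case
    by auto
qed

text \<open>The zero class, represented by \<open>N \<rightarrow> N \<oplus> A \<rightarrow> A\<close> in degree one and by
  \<open>N = N \<rightarrow> 0 \<rightarrow> \<dots> \<rightarrow> 0 \<rightarrow> A = A\<close> in higher degrees.
  The third property makes the zero class reachable from every extension that splits at
  its left end: use the retraction on \<open>X'\<^sub>1\<close> and the last arrow on \<open>X'\<^bsub>m+1\<^esub>\<close>, and the
  sum of the two in degree one.\<close>

lemma trivial_extension:
  assumes A: "A \<in> Obj C" and N: "N \<in> Obj C"
  obtains X e where "is_extension X e (Suc m) A N" "effaced e m (Ident C A)"
    "\<And>X' e' \<rho>. \<lbrakk>is_extension X' e' (Suc m) A N; \<rho> \<in> Hom C (X' (Suc 0)) N; \<rho> \<cdot> e' 0 = Ident C N\<rbrakk> \<Longrightarrow>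
      \<exists>\<alpha>. chain_map X' e' X e \<alpha> (Suc m) \<and> \<alpha> (Suc (Suc m)) = Ident C A"
proof (cases m)
  case 0
  obtain S s1 s2 t1 t2 where S: "s1 \<in> Hom C N S" "s2 \<in> Hom C A S" "t1 \<in> Hom C S N" "t2 \<in> Hom C S A"
    "t1 \<cdot> s1 = Ident C N" "t2 \<cdot> s2 = Ident C A" "t1 \<cdot> s2 = Zero C A N" "t2 \<cdot> s1 = Zero C N A"
    "Add C (s1 \<cdot> t1) (s2 \<cdot> t2) = Ident C S"
    using biproduct[OF N A] by metis
  have ses: "ses s1 t2"
    using split_ses[OF S(1-4) S(5,6,8,9)] .
  note B = ses_arr[OF ses]
  define X where "X = (\<lambda>j::nat. if j = 0 then N else if j = 1 then S else A)"
  define e where "e = (\<lambda>j::nat. if j = 0 then s1 else t2)"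
  have "is_extension X e (Suc m) A N"
  proof -
    have "e j \<in> Hom C (X j) (X (Suc j))" if "j \<le> Suc m" for j
      using that S(1,4) 0 by (cases "j = 0") (simp_all add: X_def e_def)
    then show ?thesis
      using B(5,6) ses_exact_pair[OF ses] unfolding is_extension_def exact_sequence_def 0
      by (simp add: X_def e_def)
  qed
  moreover have "effaced e m (Ident C A)"
    unfolding 0 effaced.simps using S A by (intro bexI[of _ s2]) (simp_all add: e_def)
  moreover have "\<exists>\<alpha>. chain_map X' e' X e \<alpha> (Suc m) \<and> \<alpha> (Suc (Suc m)) = Ident C A"
    if X': "is_extension X' e' (Suc m) A N" and \<rho>: "\<rho> \<in> Hom C (X' (Suc 0)) N" "\<rho> \<cdot> e' 0 = Ident C N"
    for X' e' \<rho>
  proof -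
    have ex: "exact_sequence X' e' 1" "X' 0 = N" "X' (Suc (Suc 0)) = A"
      using X' unfolding 0 is_extension_def by auto
    note E = exact_sequence_arr[OF ex(1)]
    have e0: "e' 0 \<in> Hom C N (X' (Suc 0))" "e' (Suc 0) \<in> Hom C (X' (Suc 0)) A"
      "e' (Suc 0) \<cdot> e' 0 = Zero C N A"
      using E[of 0] E[of "Suc 0"] exact_sequence_zero[OF ex(1), of 0] ex by simp_all
    define x where "x = Add C (s1 \<cdot> \<rho>) (s2 \<cdot> e' (Suc 0))"
    have x: "x \<in> Hom C (X' (Suc 0)) S"
      using S \<rho> e0 by (simp add: x_def)
    have x0: "x \<cdot> e' 0 = s1"
      using S \<rho> e0 N cod_obj[of s1] by (simp add: x_def)
    have x1: "t2 \<cdot> x = e' (Suc 0)"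
      using S \<rho> e0 A N cod_obj[of s1] comp_eqD'[OF S(8), of \<rho>] comp_eqD'[OF S(6), of "e' (Suc 0)"] by (simp add: x_def)
    define \<alpha> where "\<alpha> = (\<lambda>j::nat. if j = 0 then Ident C N else if j = 1 then x else Ident C A)"
    have "\<alpha> j \<in> Hom C (X' j) (X j)" if j: "j \<le> Suc (Suc 0)" for j
    proof -
      consider "j = 0" | "j = 1" | "j = Suc (Suc 0)"
        using j by linarith
      then show ?thesis
        using x ex(2,3) A N by cases (simp_all add: X_def \<alpha>_def)
    qed
    moreover have "e j \<cdot> \<alpha> j = \<alpha> (Suc j) \<cdot> e' j" if "j \<le> Suc 0" for j
      using that x0 x1 S(1) e0(2) by (cases "j = 0") (simp_all add: le_Suc_eq e_def \<alpha>_def)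
    moreover have "\<alpha> 0 = Ident C (X' 0)"
      using ex(2) by (simp add: \<alpha>_def)
    ultimately have "chain_map X' e' X e \<alpha> (Suc m)"
      unfolding chain_map_def 0 by blast
    then show ?thesis
      unfolding 0 by (intro exI[of _ \<alpha>]) (simp add: \<alpha>_def)
  qed
  ultimately show ?thesis
    using that by blast
next
  case (Suc m')
  obtain Z where Z: "is_zero_object C Z"
    using zero_object by blast
  note Zz = zero_object_Zero[OF Z]
  define X where "X = (\<lambda>j::nat. if j \<le> 1 then N else if j \<le> m then Z else A)"
  define e where "e = (\<lambda>j. if j = 0 then Ident C N else if j \<le> m then Zero C (X j) (X (Suc j)) else Ident C A)"
  have obj: "X j \<in> Obj C" for j
    using A N Zz(3) by (simp add: X_def)
  have e: "e j \<in> Hom C (X j) (X (Suc j))" if "j \<le> Suc m" for j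
    using that A N obj[of j] obj[of "Suc j"] Suc unfolding e_def by (auto simp: X_def)
  have epiZ: "is_epi C (Zero C W Z)" if "W \<in> Obj C" for W
  proof (rule epiI)
    fix g assume "g \<in> Arr C" "Dom C g = Cod C (Zero C W Z)"
    then show "g = Zero C (Cod C (Zero C W Z)) (Cod C g)"
      using Zz(2)[of g "Cod C g"] Zz(3) that by simp
  qed (use that Zz in simp)
  have kerI: "is_kernel C (Zero C Z A) (Ident C A)"
  proof (rule kernelI)
    show "is_mono C (Zero C Z A)"
    proof (rule monoI)
      fix g assume "g \<in> Arr C" "Cod C g = Dom C (Zero C Z A)"
      then show "g = Zero C (Dom C g) (Dom C (Zero C Z A))"
        using Zz(1)[of g "Dom C g"] Zz(3) A by simp
    qed (use A Zz in simp)
    fix h assume h: "h \<in> Arr C" "Cod C h = Dom C (Ident C A)"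
      "Ident C A \<cdot> h = Zero C (Dom C h) (Cod C (Ident C A))"
    have "Zero C Z A \<cdot> Zero C (Dom C h) Z = h"
      using h A Zz(3) by simp
    then show "\<exists>u. u \<in> Arr C \<and> Dom C u = Dom C h \<and> Cod C u = Dom C (Zero C Z A) \<and> Zero C Z A \<cdot> u = h"
      using h A Zz(3) by (intro exI[of _ "Zero C (Dom C h) Z"]) simp
  qed (use A Zz in simp_all)
  have "exact_pair C (e j) (e (Suc j))" if j: "j < Suc m" for j
  proof -
    consider "j = 0" | "1 \<le> j" "j < m" | "j = m"
      using j by linarith
    then show ?thesis
    proof cases
      case 1
      show ?thesis
      proof -
        have "X (Suc 0) = N"
          by (simp add: X_def)
        then have "e j = Ident C N" "e (Suc j) = Zero C N (X (Suc (Suc 0)))"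
          using 1 Suc by (simp_all add: e_def)
        then show ?thesis
          using exact_pair_zero[OF obj[of "Suc (Suc 0)"], of "Ident C N"] ident_epi[OF N] N by simp
      qed
    next
      case 2
      then have "e j = Zero C (X j) Z" "e (Suc j) = Zero C Z (X (Suc (Suc j)))"
        by (simp_all add: e_def X_def)
      then show ?thesis
        using exact_pair_zero[of "X (Suc (Suc j))" "e j"] epiZ[of "X j"] obj Zz(3) by simp
    next
      case 3
      then have "e j = Zero C Z A \<cdot> Zero C (X j) Z" "e (Suc j) = Ident C A"
        using Suc A obj[of m] Zz(3) by (simp_all add: e_def X_def)
      then show ?thesis
        unfolding exact_pair_iff using kerI epiZ[of "X j"] obj Zz(3) A
        by (intro exI[of _ "Zero C Z A"] exI[of _ "Zero C (X j) Z"]) simp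
    qed
  qed
  then have "is_extension X e (Suc m) A N"
    using e ident_mono[OF N] ident_epi[OF A] unfolding is_extension_def exact_sequence_def
    by (simp add: e_def X_def)
  moreover have "effaced e m (Ident C A)"
  proof -
    have "effaced e m' (f \<cdot> i)"
      if c: "ses i p" "Cod C p = Dom C (Ident C A)" "f \<in> Hom C (Dom C p) (Dom C (e (Suc (Suc m'))))"
        "e (Suc (Suc m')) \<cdot> f = Ident C A \<cdot> p" for i p f
    proof -
      have "f = p"
        using c Suc A ses_arr[OF c(1)] by (simp add: e_def)
      then have "f \<cdot> i = Zero C (Dom C i) (X (Suc (Suc m')))"
        using ses_arr[OF c(1)] c(2) A Suc by (simp add: X_def)
      moreover have "effaced e m' (Zero C (Dom C i) (X (Suc (Suc m'))))"
      proof (rule effaced_zero)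
        show "is_zero_object C (X j)" if "2 \<le> j" "j \<le> Suc m'" for j
          using that Z Suc by (simp add: X_def)
      qed (use e Suc ses_arr[OF c(1)] in auto)
      ultimately show ?thesis
        by simp
    qed
    then show ?thesis
      unfolding Suc effaced.simps by blast
  qed
  moreover have "\<exists>\<alpha>. chain_map X' e' X e \<alpha> (Suc m) \<and> \<alpha> (Suc (Suc m)) = Ident C A"
    if X': "is_extension X' e' (Suc m) A N" and \<rho>: "\<rho> \<in> Hom C (X' (Suc 0)) N" "\<rho> \<cdot> e' 0 = Ident C N"
    for X' e' \<rho>
  proof -
    have ex: "exact_sequence X' e' (Suc m)" "X' 0 = N" "X' (Suc (Suc m)) = A"
      using X' unfolding is_extension_def by auto
    note E = exact_sequence_arr[OF ex(1)]
    have objX: "X' j \<in> Obj C" if "j \<le> Suc m" for j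
      using E[OF that] by (metis dom_obj)
    define \<alpha> where "\<alpha> = (\<lambda>j. if j = 0 then Ident C N else if j = 1 then \<rho> else if j \<le> m then Zero C (X' j) Z
      else if j = Suc m then e' j else Ident C A)"
    have "\<alpha> j \<in> Hom C (X' j) (X j)" if j: "j \<le> Suc (Suc m)" for j
    proof -
      consider "j = 0" | "j = 1" | "2 \<le> j" "j \<le> m" | "j = Suc m" | "j = Suc (Suc m)"
        using j by linarith
      then show ?thesis
        using E[of j] objX[of j] ex(2,3) A N \<rho>(1) Suc Zz(3)
        by cases (simp_all add: X_def \<alpha>_def)
    qed
    moreover have "e j \<cdot> \<alpha> j = \<alpha> (Suc j) \<cdot> e' j" if j: "j \<le> Suc m" for j
    proof -
      have aj: "\<alpha> j \<in> Arr C" "Cod C (\<alpha> j) = X j" "Dom C (\<alpha> j) = X' j"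
        using calculation[of j] j by auto
      consider "j = 0" | "1 \<le> j" "j < m" | "j = m" | "j = Suc m"
        using j by linarith
      then show ?thesis
      proof cases
        case 1
        then show ?thesis
          using \<rho> N by (simp add: e_def \<alpha>_def)
      next
        case 2
        then have "e j \<cdot> \<alpha> j = Zero C (X' j) Z"
          using aj obj[of j] Zz(3) by (simp add: e_def X_def)
        moreover have "\<alpha> (Suc j) \<cdot> e' j = Zero C (X' j) Z"
          using 2 E[of j] Zz(3) by (simp add: \<alpha>_def)
        ultimately show ?thesis
          by simp
      next
        case 3
        have "e j \<cdot> \<alpha> j = Zero C (X' j) A"
          using 3 aj obj[of j] A Suc by (simp add: e_def X_def)
        moreover have "\<alpha> (Suc j) \<cdot> e' j = Zero C (X' j) A"
          using 3 exact_sequence_zero[OF ex(1), of m] ex(3) Suc by (simp add: \<alpha>_def)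
        ultimately show ?thesis
          by simp
      next
        case 4
        then show ?thesis
          using E[of j] ex(3) A Suc by (simp add: e_def \<alpha>_def)
      qed
    qed
    moreover have "\<alpha> 0 = Ident C (X' 0)"
      using ex(2) by (simp add: \<alpha>_def)
    ultimately show ?thesis
      unfolding chain_map_def by (intro exI[of _ \<alpha>]) (simp add: \<alpha>_def)
  qed
  ultimately show ?thesis
    using that by blast
qed

lemma extension_last_step:
  assumes "is_extension X e (Suc m) A N"
  obtains k c where "ses k (e (Suc m))" "is_epi C c" "c \<in> Hom C (X m) (Dom C k)" "e m = k \<cdot> c"
    "e (Suc m) \<in> Hom C (X (Suc m)) A" "k \<in> Hom C (Dom C k) (X (Suc m))"
proof -
  have ex: "exact_sequence X e (Suc m)" "X (Suc (Suc m)) = A" "is_epi C (e (Suc m))"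
    using assms unfolding is_extension_def by auto
  note E = exact_sequence_arr[OF ex(1), of m] exact_sequence_arr[OF ex(1), of "Suc m"]
  have "exact_pair C (e m) (e (Suc m))"
    using ex(1) unfolding exact_sequence_def by simp
  then obtain k c where k: "is_epi C c" "k \<in> Arr C" "Cod C c = Dom C k" "e m = k \<cdot> c"
    "is_kernel C k (e (Suc m))"
    unfolding exact_pair_iff by blast
  note c = epi_arr[OF k(1)]
  have "ses k (e (Suc m))"
    using kernel_epi_ses k(5) ex(3) by blast
  moreover have "c \<in> Hom C (X m) (Dom C k)"
    using k(2-4) c E by simp
  moreover have "e (Suc m) \<in> Hom C (X (Suc m)) A"
    using E ex(2) by simp
  moreover have "k \<in> Hom C (Dom C k) (X (Suc m))"
    using kernel_arr[OF k(5)] E by simp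
  ultimately show ?thesis
    using that k by blast
qed

text \<open>Splicing an extension of \<open>K\<close> with \<open>0 \<rightarrow> K \<rightarrow> P \<rightarrow> A \<rightarrow> 0\<close> replaces its last arrow and adds one
  more, and likewise for the objects.\<close>

definition extend_by :: "nat \<Rightarrow> (nat \<Rightarrow> 'x) \<Rightarrow> 'x \<Rightarrow> 'x \<Rightarrow> nat \<Rightarrow> 'x" where
  "extend_by n e x y j = (if j < n then e j else if j = n then x else y)"

lemma splice_extension:
  assumes X: "is_extension X e (Suc m) K N" and p: "ses i p" "Dom C i = K" "Cod C p = A"
  shows "is_extension (extend_by (Suc (Suc m)) X (Dom C p) A) (extend_by (Suc m) e (i \<cdot> e (Suc m)) p)
    (Suc (Suc m)) A N"
proof -
  let ?X = "extend_by (Suc (Suc m)) X (Dom C p) A" and ?e = "extend_by (Suc m) e (i \<cdot> e (Suc m)) p"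
  have ex: "exact_sequence X e (Suc m)" "X 0 = N" "X (Suc (Suc m)) = K" "is_epi C (e (Suc m))"
    using X unfolding is_extension_def by auto
  note E = exact_sequence_arr[OF ex(1)]
  note A = ses_arr[OF p(1)]
  obtain k c where kc: "ses k (e (Suc m))" "is_epi C c" "c \<in> Hom C (X m) (Dom C k)" "e m = k \<cdot> c"
    "e (Suc m) \<in> Hom C (X (Suc m)) K" "k \<in> Hom C (Dom C k) (X (Suc m))"
    using extension_last_step[OF X] by blast
  have arr: "?e j \<in> Hom C (?X j) (?X (Suc j))" if j: "j \<le> Suc (Suc m)" for j
  proof -
    consider "j < Suc m" | "j = Suc m" | "j = Suc (Suc m)"
      using j by linarith
    then show ?thesis
      using E[of j] A kc(5) p by cases (simp_all add: extend_by_def)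
  qed
  have "exact_pair C (?e j) (?e (Suc j))" if j: "j < Suc (Suc m)" for j
  proof -
    consider "j < m" | "j = m" | "j = Suc m"
      using j by linarith
    then show ?thesis
    proof cases
      case 1
      then show ?thesis
        using ex(1) unfolding exact_sequence_def by (simp add: extend_by_def)
    next
      case 2
      have "is_kernel C k (i \<cdot> e (Suc m))"
        using kernel_mono_comp[OF _ A(5)] kc(1,5) p(2) unfolding ses_def by simp
      then show ?thesis
        unfolding exact_pair_iff using 2 kc(2-4,6)
        by (intro exI[of _ k] exI[of _ c]) (simp add: extend_by_def)
    next
      case 3
      then show ?thesis
        unfolding exact_pair_iff using p(1,2) A kc(5) ex(4)
        by (intro exI[of _ i] exI[of _ "e (Suc m)"]) (simp add: extend_by_def ses_def)
    qed
  qed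
  moreover have "is_mono C (?e 0)"
    using ex(1) unfolding exact_sequence_def by (simp add: extend_by_def)
  ultimately show ?thesis
    using arr A ex(2) unfolding is_extension_def exact_sequence_def by (simp add: extend_by_def)
qed

lemma effaced_cong: "(\<And>j. j \<le> Suc m \<Longrightarrow> e j = e' j) \<Longrightarrow> effaced e m = effaced e' m"
  by (induction m) (simp_all add: fun_eq_iff)

lemma effaced_splice:
  assumes X: "is_extension X e (Suc m) K N" and i: "is_mono C i" "Dom C i = K"
    and g: "g \<in> Hom C W K" and eff: "effaced (extend_by (Suc m) e (i \<cdot> e (Suc m)) p) m (i \<cdot> g)"
  shows "effaced e m g"
proof -
  let ?e = "extend_by (Suc m) e (i \<cdot> e (Suc m)) p"
  have e: "e (Suc m) \<in> Hom C (X (Suc m)) K"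
    using X unfolding is_extension_def exact_sequence_def by auto
  note iarr = mono_arr[OF i(1)]
  have eS: "?e (Suc m) = i \<cdot> e (Suc m)"
    by (simp add: extend_by_def)
  show ?thesis
  proof (cases m)
    case 0
    then obtain t where t: "t \<in> Hom C W (X (Suc 0))" "(i \<cdot> e (Suc 0)) \<cdot> t = i \<cdot> g"
      using eff eS e g i iarr by auto
    then have "e (Suc 0) \<cdot> t = g"
      using mono_cancel[OF i(1), of "e (Suc 0) \<cdot> t" g] e g i iarr 0 by simp
    then show ?thesis
      using t(1) e g 0 by auto
  next
    case (Suc m')
    have "effaced e m' (f \<cdot> j)"
      if c: "ses j q" "Cod C q = Dom C g" "Dom C q \<in> M" "f \<in> Hom C (Dom C q) (Dom C (e (Suc m)))"
        "e (Suc m) \<cdot> f = g \<cdot> q" for j q f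
    proof -
      note A = ses_arr[OF c(1)]
      have "?e (Suc m) \<cdot> f = (i \<cdot> g) \<cdot> q"
        using eS c(2,4,5) e g i iarr A by simp
      moreover have "Cod C q = Dom C (i \<cdot> g)" "Dom C (?e (Suc m)) = Dom C (e (Suc m))"
        using eS c(2) e g i iarr by simp_all
      ultimately have "effaced ?e m' (f \<cdot> j)"
        using eff c(1,3,4) unfolding Suc effaced.simps by metis
      moreover have "effaced ?e m' = effaced e m'"
        using Suc by (intro effaced_cong) (simp add: extend_by_def)
      ultimately show ?thesis
        by simp
    qed
    then show ?thesis
      unfolding Suc effaced.simps by blast
  qed
qed

text \<open>Push out \<open>0 \<rightarrow> K \<rightarrow> P \<rightarrow> A \<rightarrow> 0\<close> along \<open>s : K \<rightarrow> N\<close> to \<open>0 \<rightarrow> N \<rightarrow> E \<rightarrow> A \<rightarrow> 0\<close>.  The composite of \<open>P \<rightarrow> E\<close> with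
  a retraction \<open>E \<rightarrow> N\<close> extends \<open>s\<close>.\<close>

lemma extend_of_split_pushout:
  assumes p: "ses i p" and s: "s \<in> Hom C (Dom C i) N"
    and split: "\<And>n r. \<lbrakk>ses n r; Dom C n = N; Cod C r = Cod C p\<rbrakk> \<Longrightarrow>
      \<exists>\<sigma>\<in>Hom C (Cod C p) (Dom C r). r \<cdot> \<sigma> = Ident C (Cod C p)"
  obtains t where "t \<in> Hom C (Cod C i) N" "t \<cdot> i = s"
proof -
  note A = ses_arr[OF p]
  have N: "N \<in> Obj C"
    using s by auto
  let ?P = "Dom C p" and ?K = "Dom C i" and ?A = "Cod C p"
  have P: "?P \<in> Obj C" "?K \<in> Obj C" "?A \<in> Obj C"
    using A by simp_all
  obtain S s1 s2 t1 t2 where S: "s1 \<in> Hom C ?P S" "s2 \<in> Hom C N S" "t1 \<in> Hom C S ?P" "t2 \<in> Hom C S N"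
    "t1 \<cdot> s1 = Ident C ?P" "t2 \<cdot> s2 = Ident C N" "t1 \<cdot> s2 = Zero C N ?P" "t2 \<cdot> s1 = Zero C ?P N"
    "Add C (s1 \<cdot> t1) (s2 \<cdot> t2) = Ident C S"
    using biproduct[OF P(1) N] by metis
  define g where "g = diff (s1 \<cdot> i) (s2 \<cdot> s)"
  have i: "i \<in> Hom C ?K ?P" and p': "p \<in> Hom C ?P ?A"
    using A by simp_all
  have g: "g \<in> Hom C ?K S"
    using S i s by (simp add: g_def)
  have tg: "t1 \<cdot> g = i"
    using S i s P N comp_eqD'[OF S(5), of i] comp_eqD'[OF S(7), of s] by (simp add: g_def)
  have "is_mono C g"
    using mono_of_comp[of t1 g] tg A(5) S g by auto
  then obtain c where c: "ses g c"
    using mono_ses by blast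
  note Ac = ses_arr[OF c]
  define E where "E = Cod C c"
  have c': "c \<in> Hom C S E"
    using Ac g by (simp add: E_def)
  have E: "E \<in> Obj C"
    using c' by auto
  have cg: "c \<cdot> g = Zero C ?K E"
    using Ac(4) g by (simp add: E_def)
  \<comment> \<open>The pushout \<open>E\<close> is the cokernel of \<open>(i, - s)\<close>, and \<open>n\<close> is the new first arrow.\<close>
  define n where "n = c \<cdot> s2"
  have n: "n \<in> Hom C N E"
    using c' S by (simp add: n_def)
  have "diff (c \<cdot> s1 \<cdot> i) (n \<cdot> s) = Zero C ?K E"
    using cg c' S i s by (simp add: g_def n_def)
  then have xi: "c \<cdot> s1 \<cdot> i = n \<cdot> s"
    by (rule diff_eq_zero) (use c' S i s n in simp_all)
  have "(p \<cdot> t1) \<cdot> g = Zero C ?K ?A"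
    using tg S p' g A(4) by simp
  then obtain r where r: "r \<in> Hom C E ?A" "r \<cdot> c = p \<cdot> t1"
    using S p' g c' unfolding E_def by - (rule ses_desc[OF c, of "p \<cdot> t1" ?A], simp_all)
  have nm: "is_mono C n"
  proof (rule monoI)
    fix x assume x: "x \<in> Arr C" "Cod C x = Dom C n" "n \<cdot> x = Zero C (Dom C x) (Cod C n)"
    have x': "x \<in> Hom C (Dom C x) N"
      using x n by simp
    have "c \<cdot> (s2 \<cdot> x) = Zero C (Dom C x) E"
      using x(3) x' S c' n unfolding n_def by simp
    then obtain y where y: "y \<in> Hom C (Dom C x) ?K" "g \<cdot> y = s2 \<cdot> x"
      using x' S g c' unfolding E_def by - (rule ses_lift[OF c, of "s2 \<cdot> x" "Dom C x"], simp_all)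
    have "i \<cdot> y = t1 \<cdot> g \<cdot> y"
      using comp_eqD'[OF tg, of y] y S g by simp
    also have "\<dots> = Zero C (Dom C x) ?P"
      using comp_eqD'[OF S(7), of x] y(2) S x' P by simp
    finally have "y = Zero C (Dom C x) ?K"
      using mono_zero[OF A(5), of y] y(1) i by simp
    then have "s2 \<cdot> x = Zero C (Dom C x) S"
      using y(2) g x' by simp
    then have "t2 \<cdot> s2 \<cdot> x = Zero C (Dom C x) N"
      using S x(1) by simp
    then show "x = Zero C (Dom C x) (Dom C n)"
      using comp_eqD'[OF S(6), of x] S x' n by simp
  qed (use n in simp)
  have "is_epi C (p \<cdot> t1)"
    using A(6) epi_of_comp[of t1 s1] ident_epi[OF P(1)] S p' by (intro epi_comp) auto
  then have re: "is_epi C r"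
    using epi_of_comp[of r c] r c' by auto
  have "is_cokernel C r n"
  proof (rule cokernelI)
    have "r \<cdot> n = (p \<cdot> t1) \<cdot> s2"
      using comp_eqD[OF r(2), of s2] r(1) c' S p' by (simp add: n_def)
    then show "r \<cdot> n = Zero C (Dom C n) (Cod C r)"
      using S p' n r(1) N by simp
    fix h assume h: "h \<in> Arr C" "Dom C h = Cod C n" "h \<cdot> n = Zero C (Dom C n) (Cod C h)"
    have h': "h \<in> Hom C E (Cod C h)"
      using h n by simp
    have hn: "h \<cdot> n = Zero C N (Cod C h)"
      using h(3) n by simp
    have "h \<cdot> c = h \<cdot> c \<cdot> Add C (s1 \<cdot> t1) (s2 \<cdot> t2)"
      using S c' h' by simp
    also have "\<dots> = Add C (h \<cdot> c \<cdot> s1 \<cdot> t1) (h \<cdot> n \<cdot> t2)"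
      unfolding n_def using S(1-4) c' h' by (subst comp_add(1)) simp_all
    also have "\<dots> = h \<cdot> c \<cdot> s1 \<cdot> t1"
      using comp_eqD'[OF hn, of t2] S c' h' n by simp
    finally have hc: "h \<cdot> c = h \<cdot> c \<cdot> s1 \<cdot> t1" .
    have "(h \<cdot> c \<cdot> s1) \<cdot> i = h \<cdot> n \<cdot> s"
      using xi h' c' S i by simp
    also have "\<dots> = Zero C ?K (Cod C h)"
      using comp_eqD'[OF hn, of s] n h' s N by simp
    finally obtain w where w: "w \<in> Hom C ?A (Cod C h)" "w \<cdot> p = h \<cdot> c \<cdot> s1"
      using h' c' S i by - (rule ses_desc[OF p, of "h \<cdot> c \<cdot> s1" "Cod C h"], simp_all)
    have "(w \<cdot> r) \<cdot> c = (w \<cdot> p) \<cdot> t1"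
      using w(1) r c' p' S by simp
    also have "\<dots> = h \<cdot> c"
      unfolding w(2) using hc h' c' S by simp
    finally have "w \<cdot> r = h"
      using epi_cancel[OF Ac(6), of "w \<cdot> r" h] w(1) r(1) h' c' by simp
    then show "\<exists>u. u \<in> Arr C \<and> Cod C u = Cod C h \<and> Dom C u = Cod C r \<and> u \<cdot> r = h"
      using w(1) r(1) by (intro exI[of _ w]) simp
  qed (use re n r in simp_all)
  then have nr: "ses n r"
    using cokernel_mono_ses nm by blast
  obtain \<sigma> where \<sigma>: "\<sigma> \<in> Hom C ?A E" "r \<cdot> \<sigma> = Ident C ?A"
    using split[OF nr] n r by auto
  have "r \<cdot> diff (Ident C E) (\<sigma> \<cdot> r) = Zero C E ?A"
    using comp_eqD'[OF \<sigma>(2), of r] \<sigma>(1) r(1) E by simp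
  then obtain \<rho> where \<rho>: "\<rho> \<in> Hom C E N" "n \<cdot> \<rho> = diff (Ident C E) (\<sigma> \<cdot> r)"
    using \<sigma>(1) r(1) E n by - (rule ses_lift[OF nr, of "diff (Ident C E) (\<sigma> \<cdot> r)" E], simp_all)
  have "n \<cdot> (\<rho> \<cdot> n) = diff (Ident C E) (\<sigma> \<cdot> r) \<cdot> n"
    using comp_eqD'[OF \<rho>(2), of n] \<rho>(1) n by simp
  also have "\<dots> = n"
    using \<sigma>(1) r(1) E n ses_arr(4)[OF nr] N by simp
  finally have "n \<cdot> (\<rho> \<cdot> n) = n \<cdot> Ident C N"
    using n by simp
  then have \<rho>n: "\<rho> \<cdot> n = Ident C N"
    by (rule mono_cancel[OF nm]) (use \<rho>(1) n N in simp_all)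
  have "(\<rho> \<cdot> c \<cdot> s1) \<cdot> i = \<rho> \<cdot> n \<cdot> s"
    using xi \<rho>(1) c' S i by simp
  also have "\<dots> = s"
    using comp_eqD'[OF \<rho>n, of s] \<rho>(1) n s by simp
  finally show ?thesis
    using that[of "\<rho> \<cdot> c \<cdot> s1"] \<rho>(1) c' S i by simp
qed

text \<open>Extensions of a syzygy \<open>K\<close> are spliced with \<open>0 \<rightarrow> K \<rightarrow> P \<rightarrow> A \<rightarrow> 0\<close>; the identity of \<open>P\<close> is then
  a candidate that leads back to the given extension.\<close>

lemma acyclic_of_effaced:
  assumes "A \<in> Obj C" and "\<And>m X e N. \<lbrakk>m < k; N \<in> M; is_extension X e (Suc m) A N\<rbrakk> \<Longrightarrow> effaced e m (Ident C A)"
  shows "acyclic k A"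
  using assms
proof (induction k arbitrary: A)
  case (Suc k)
  have "extends i" if p: "ses i p" "Cod C p = A" for i p
    unfolding extends_def
  proof (intro ballI)
    fix N s assume N: "N \<in> M" and s: "s \<in> Hom C (Dom C i) N"
    have "\<exists>\<sigma>\<in>Hom C (Cod C p) (Dom C r). r \<cdot> \<sigma> = Ident C (Cod C p)"
      if nr: "ses n r" "Dom C n = N" "Cod C r = Cod C p" for n r
    proof -
      note B = ses_arr[OF nr(1)]
      define X where "X = (\<lambda>j::nat. if j = 0 then N else if j = 1 then Dom C r else A)"
      define e where "e = (\<lambda>j::nat. if j = 0 then n else r)"
      have "e j \<in> Hom C (X j) (X (Suc j))" if "j \<le> Suc 0" for j
        using that B nr p by (cases "j = 0") (simp_all add: X_def e_def)
      then have "is_extension X e (Suc 0) A N"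
        using B(5,6) ses_exact_pair[OF nr(1)] unfolding is_extension_def exact_sequence_def
        by (simp add: X_def e_def)
      then have "effaced e 0 (Ident C A)"
        using Suc.prems(2)[of 0 N X e] N by simp
      then show ?thesis
        using nr p Suc.prems(1) by (simp add: e_def)
    qed
    then obtain t where "t \<in> Hom C (Cod C i) N" "t \<cdot> i = s"
      using extend_of_split_pushout[OF p(1) s] by blast
    then show "\<exists>t\<in>Hom C (Cod C i) N. t \<cdot> i = s"
      by blast
  qed
  moreover have "acyclic k (Dom C i)" if p: "ses i p" "Cod C p = A" "Dom C p \<in> M" for i p
  proof (rule Suc.IH)
    note B = ses_arr[OF p(1)]
    show K: "Dom C i \<in> Obj C"
      using B by simp
    fix m X e N assume m: "m < k" "N \<in> M" "is_extension X e (Suc m) (Dom C i) N"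
    let ?e = "extend_by (Suc m) e (i \<cdot> e (Suc m)) p"
    have "effaced ?e (Suc m) (Ident C A)"
      using Suc.prems(2)[OF _ m(2) splice_extension[OF m(3) p(1) _ p(2)]] m(1) by simp
    moreover have "Cod C p = Dom C (Ident C A)" "Ident C (Dom C p) \<in> Hom C (Dom C p) (Dom C (?e (Suc (Suc m))))"
      "?e (Suc (Suc m)) \<cdot> Ident C (Dom C p) = Ident C A \<cdot> p"
      using p Suc.prems(1) B by (simp_all add: extend_by_def)
    ultimately have "effaced ?e m (Ident C (Dom C p) \<cdot> i)"
      using p(1,3) unfolding effaced.simps by blast
    then have "effaced ?e m (i \<cdot> Ident C (Dom C i))"
      using B by simp
    then show "effaced e m (Ident C (Dom C i))"
      using effaced_splice[OF m(3) B(5) _ _ ] K by (metis Hom_iff ident_arr)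
  qed
  ultimately show ?case
    unfolding acyclic.simps ext1_zero_def by blast
qed simp

lemma exact_pair_comp_mono_iff:
  assumes "is_mono C m" "c \<in> Arr C" "Dom C m = Cod C c"
  shows "exact_pair C f (m \<cdot> c) \<longleftrightarrow> exact_pair C f c"
  unfolding exact_pair_iff
  using kernel_mono_comp[of _ c m] kernel_of_mono_comp[of _ m c] assms mono_arr[OF assms(1)] by blast

lemma extension_pullback:
  assumes X: "is_extension X e (Suc m) K N" and u: "u \<in> Hom C K' K"
  obtains X' e' \<beta> where "is_extension X' e' (Suc m) K' N" "chain_map X' e' X e \<beta> (Suc m)"
    "\<beta> (Suc (Suc m)) = u"
proof -
  have ex: "exact_sequence X e (Suc m)" "X 0 = N" "X (Suc (Suc m)) = K" "is_epi C (e (Suc m))"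
    using X unfolding is_extension_def by auto
  note E = exact_sequence_arr[OF ex(1)]
  obtain k c where kc: "ses k (e (Suc m))" "is_epi C c" "c \<in> Hom C (X m) (Dom C k)" "e m = k \<cdot> c"
    "e (Suc m) \<in> Hom C (X (Suc m)) K" "k \<in> Hom C (Dom C k) (X (Suc m))"
    using extension_last_step[OF X] by blast
  have u': "u \<in> Hom C K' (Cod C (e (Suc m)))"
    using u kc(5) by simp
  obtain j a b where Y: "ses j a" "a \<in> Hom C (Dom C a) K'" "b \<in> Hom C (Dom C a) (Dom C (e (Suc m)))"
    "j \<in> Hom C (Dom C k) (Dom C a)" "b \<cdot> j = k" "u \<cdot> a = e (Suc m) \<cdot> b"
    by (rule pullback_ses[OF kc(1) u']) (rule that, assumption+)
  note A = ses_arr[OF Y(1)]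
  have b: "b \<in> Hom C (Dom C a) (X (Suc m))"
    using Y(3) kc(5) by simp
  define X' where "X' = extend_by (Suc m) X (Dom C a) K'"
  define e' where "e' = extend_by m e (j \<cdot> c) a"
  define \<beta> where "\<beta> = extend_by (Suc m) (\<lambda>n. Ident C (X n)) b u"
  have arr: "e' n \<in> Hom C (X' n) (X' (Suc n))" if n: "n \<le> Suc m" for n
  proof -
    consider "n < m" | "n = m" | "n = Suc m"
      using n by linarith
    then show ?thesis
      using E[of n] kc(3) Y(2,4) by cases (simp_all add: e'_def X'_def extend_by_def)
  qed
  have bjc: "b \<cdot> (j \<cdot> c) = e m"
    using comp_eqD'[OF Y(5), of c] kc(3,4) Y(4) b by simp
  have "is_mono C (e' 0)"
  proof (cases "m = 0")
    case True
    then have "is_mono C (b \<cdot> (j \<cdot> c))"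
      using ex(1) bjc unfolding exact_sequence_def by simp
    then show ?thesis
      using mono_of_comp[of b "j \<cdot> c"] True b Y(4) kc(3) by (simp add: e'_def extend_by_def)
  next
    case False
    then show ?thesis
      using ex(1) unfolding exact_sequence_def by (simp add: e'_def extend_by_def)
  qed
  moreover have "exact_pair C (e' n) (e' (Suc n))" if n: "n < Suc m" for n
  proof -
    have *: "exact_pair C (e n) (e (Suc n))"
      using ex(1) n unfolding exact_sequence_def by simp
    consider "Suc n < m" | "Suc n = m" | "n = m"
      using n by linarith
    then show ?thesis
    proof cases
      case 1
      then show ?thesis
        using * by (simp add: e'_def extend_by_def)
    next
      case 2
      then have "exact_pair C (e n) (k \<cdot> c)"
        using * kc(4) by simp
      then have "exact_pair C (e n) (j \<cdot> c)"
        using exact_pair_comp_mono_iff[of k c] exact_pair_comp_mono_iff[of j c] kc(3)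
          ses_arr(5)[OF kc(1)] A(5) Y(4) by simp
      then show ?thesis
        using 2 by (simp add: e'_def extend_by_def)
    next
      case 3
      then show ?thesis
        unfolding exact_pair_iff using kc(2,3) Y(1,4)
        by (intro exI[of _ j] exI[of _ c]) (simp add: e'_def extend_by_def ses_def)
    qed
  qed
  moreover have X'0: "X' 0 = N"
    using ex(2) by (simp add: X'_def extend_by_def)
  ultimately have "is_extension X' e' (Suc m) K' N"
    using arr A(6) unfolding is_extension_def exact_sequence_def
    by (simp add: X'_def e'_def extend_by_def)
  moreover have "chain_map X' e' X e \<beta> (Suc m)"
    unfolding chain_map_def
  proof (intro conjI allI impI)
    show "\<beta> 0 = Ident C (X' 0)"
      using X'0 ex(2) by (simp add: \<beta>_def extend_by_def)
    fix n
    show "\<beta> n \<in> Hom C (X' n) (X n)" if n: "n \<le> Suc (Suc m)"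
    proof -
      consider "n < Suc m" | "n = Suc m" | "n = Suc (Suc m)"
        using n by linarith
      then show ?thesis
        using E[of n] dom_obj[of "e n"] b u ex(3)
        by cases (simp_all add: \<beta>_def X'_def extend_by_def)
    qed
    show "e n \<cdot> \<beta> n = \<beta> (Suc n) \<cdot> e' n" if n: "n \<le> Suc m"
    proof -
      consider "n < m" | "n = m" | "n = Suc m"
        using n by linarith
      then show ?thesis
        using E[of n] bjc Y(6) by cases (simp_all add: \<beta>_def e'_def extend_by_def)
    qed
  qed
  ultimately show ?thesis
    using that[of X' e' \<beta>] by (simp add: \<beta>_def extend_by_def)
qed

text \<open>The inverse of splicing: \<open>k\<close> is the kernel of the last arrow.\<close>

lemma extension_truncate:
  assumes X: "is_extension X e (Suc (Suc m)) A N"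
  obtains k e' where "ses k (e (Suc (Suc m)))" "k \<in> Hom C (Dom C k) (X (Suc (Suc m)))"
    "is_extension (\<lambda>j. if j \<le> Suc m then X j else Dom C k) e' (Suc m) (Dom C k) N"
    "\<And>j. j \<le> m \<Longrightarrow> e' j = e j" "e (Suc m) = k \<cdot> e' (Suc m)"
proof -
  have ex: "exact_sequence X e (Suc (Suc m))" "X 0 = N"
    using X unfolding is_extension_def by auto
  note E = exact_sequence_arr[OF ex(1)]
  obtain k c where kc: "ses k (e (Suc (Suc m)))" "is_epi C c" "c \<in> Hom C (X (Suc m)) (Dom C k)"
    "e (Suc m) = k \<cdot> c" "k \<in> Hom C (Dom C k) (X (Suc (Suc m)))"
    using extension_last_step[OF X] by blast
  define X' where "X' = (\<lambda>j. if j \<le> Suc m then X j else Dom C k)"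
  define e' where "e' = (\<lambda>j. if j \<le> m then e j else c)"
  have "e' j \<in> Hom C (X' j) (X' (Suc j))" if "j \<le> Suc m" for j
    using that E[of j] kc(3) by (cases "j = Suc m") (simp_all add: X'_def e'_def)
  moreover have "exact_pair C (e' j) (e' (Suc j))" if j: "j < Suc m" for j
  proof -
    have *: "exact_pair C (e j) (e (Suc j))"
      using ex(1) j unfolding exact_sequence_def by simp
    show ?thesis
    proof (cases "j = m")
      case True
      then show ?thesis
        using * kc(3,4) exact_pair_comp_mono_iff[of k c] ses_arr(5)[OF kc(1)] by (simp add: e'_def)
    next
      case False
      then show ?thesis
        using * j by (simp add: e'_def)
    qed
  qed
  moreover have "is_mono C (e' 0)"
    using ex(1) unfolding exact_sequence_def by (simp add: e'_def)
  ultimately have "is_extension X' e' (Suc m) (Dom C k) N"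
    using ex(2) kc(2) unfolding is_extension_def exact_sequence_def by (simp add: X'_def e'_def)
  then show ?thesis
    using that[of k e'] kc unfolding X'_def by (simp add: e'_def)
qed

text \<open>Replace the last term before \<open>A\<close> by a cover \<open>Q\<close>.  The kernel of \<open>Q \<rightarrow> A\<close> is acyclic in one degree
  less, so the rest of the extension, pulled back to it, is dominated by a split one by induction;
  splicing with \<open>Q \<rightarrow> A\<close> gives the claim.\<close>

lemma split_extension_above:
  assumes "acyclic (Suc m) A" "N \<in> M" "is_extension X e (Suc m) A N"
  shows "\<exists>X' e' \<alpha> \<rho>. is_extension X' e' (Suc m) A N \<and> chain_map X' e' X e \<alpha> (Suc m) \<and>
    \<alpha> (Suc (Suc m)) = Ident C A \<and> \<rho> \<in> Hom C (X' (Suc 0)) N \<and> \<rho> \<cdot> e' 0 = Ident C N"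
  using assms
proof (induction m arbitrary: A X e)
  case 0
  have ex: "exact_sequence X e (Suc 0)" "X 0 = N" "X (Suc (Suc 0)) = A" "is_epi C (e (Suc 0))"
    "is_mono C (e 0)"
    using 0(3) unfolding is_extension_def exact_sequence_def by auto
  note E = exact_sequence_arr[OF ex(1), of 0] exact_sequence_arr[OF ex(1), of "Suc 0"]
  have "is_kernel C (e 0) (e (Suc 0))"
  proof (rule kernelI)
    show "e (Suc 0) \<cdot> e 0 = Zero C (Dom C (e 0)) (Cod C (e (Suc 0)))"
      using exact_sequence_zero[OF ex(1), of 0] E by simp
    fix h assume h: "h \<in> Arr C" "Cod C h = Dom C (e (Suc 0))"
      "e (Suc 0) \<cdot> h = Zero C (Dom C h) (Cod C (e (Suc 0)))"
    have h': "h \<in> Hom C (Dom C h) (X (Suc 0))" "e (Suc 0) \<cdot> h = Zero C (Dom C h) (X (Suc (Suc 0)))"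
      using h E by simp_all
    obtain v where "v \<in> Hom C (Dom C h) (X 0)" "e 0 \<cdot> v = h"
      using exact_sequence_lift[OF ex(1) _ h'] by blast
    then show "\<exists>u. u \<in> Arr C \<and> Dom C u = Dom C h \<and> Cod C u = Dom C (e 0) \<and> e 0 \<cdot> u = h"
      using E by (intro exI[of _ v]) simp
  qed (use ex(5) E in simp_all)
  then have "ses (e 0) (e (Suc 0))"
    using kernel_epi_ses ex(4) by blast
  then have "extends (e 0)"
    using 0(1) E ex(3) unfolding acyclic.simps ext1_zero_def by auto
  then obtain \<rho> where \<rho>: "\<rho> \<in> Hom C (X (Suc 0)) N" "\<rho> \<cdot> e 0 = Ident C N"
    using extendsE[OF _ 0(2), of "e 0" "Ident C N"] 0(2) E ex(2) by auto
  have "chain_map X e X e (\<lambda>j. Ident C (X j)) (Suc 0)"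
    unfolding chain_map_def
  proof (intro conjI allI impI)
    fix j :: nat
    show "Ident C (X j) \<in> Hom C (X j) (X j)" if j: "j \<le> Suc (Suc 0)"
    proof -
      consider "j = 0" | "j = Suc 0" | "j = Suc (Suc 0)"
        using j by linarith
      then show ?thesis
        using dom_obj[OF E(1)] dom_obj[OF E(4)] cod_obj[OF E(4)] E by cases simp_all
    qed
    show "e j \<cdot> Ident C (X j) = Ident C (X (Suc j)) \<cdot> e j" if "j \<le> Suc 0"
      using that E by (cases "j = 0") (simp_all add: le_Suc_eq)
  qed simp
  then show ?case
    using 0(3) \<rho> ex(3) by blast
next
  case (Suc m)
  have ex: "exact_sequence X e (Suc (Suc m))" "X 0 = N" "X (Suc (Suc (Suc m))) = A"
    using Suc.prems(3) unfolding is_extension_def by auto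
  note E = exact_sequence_arr[OF ex(1), of "Suc (Suc m)"]
  let ?l = "e (Suc (Suc m))"
  obtain k e0 where k: "ses k ?l" "k \<in> Hom C (Dom C k) (X (Suc (Suc m)))"
    "is_extension (\<lambda>j. if j \<le> Suc m then X j else Dom C k) e0 (Suc m) (Dom C k) N"
    "\<And>j. j \<le> m \<Longrightarrow> e0 j = e j" "e (Suc m) = k \<cdot> e0 (Suc m)"
    using extension_truncate[OF Suc.prems(3)] by blast
  let ?Y = "\<lambda>j. if j \<le> Suc m then X j else Dom C k"
  have l: "?l \<in> Hom C (X (Suc (Suc m))) A"
    using E ex(3) by simp
  obtain i q where q: "ses i q" "Cod C q = X (Suc (Suc m))" "Dom C q \<in> M"
    using cover[of "X (Suc (Suc m))"] dom_obj[OF E(1)] E by auto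
  note Aq = ses_arr[OF q(1)] ses_arr[OF k(1)]
  have "is_epi C (?l \<cdot> q)"
    using Aq q(2) E by (intro epi_comp) auto
  then obtain \<kappa> where \<kappa>: "ses \<kappa> (?l \<cdot> q)"
    using epi_ses by blast
  note A\<kappa> = ses_arr[OF \<kappa>]
  have lq: "Dom C (?l \<cdot> q) = Dom C q" "Cod C (?l \<cdot> q) = A"
    using Aq l q(2) by simp_all
  have "?l \<cdot> (q \<cdot> \<kappa>) = Zero C (Dom C \<kappa>) A"
    using A\<kappa> lq Aq(2) l q(2) by simp
  then obtain u where u: "u \<in> Hom C (Dom C \<kappa>) (Dom C k)" "k \<cdot> u = q \<cdot> \<kappa>"
    using A\<kappa>(1,3) lq Aq(2) l q(2) by - (rule ses_lift[OF k(1), of "q \<cdot> \<kappa>" "Dom C \<kappa>"], simp_all)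
  obtain X1 e1 \<beta> where X1: "is_extension X1 e1 (Suc m) (Dom C \<kappa>) N" "chain_map X1 e1 ?Y e0 \<beta> (Suc m)"
    "\<beta> (Suc (Suc m)) = u"
    using extension_pullback[OF k(3) u(1)] by blast
  have "acyclic (Suc m) (Dom C \<kappa>)"
    using acyclic_syzygy[OF Suc.prems(1) \<kappa>] lq q(3) by simp
  then obtain X2 e2 \<gamma> \<rho> where X2: "is_extension X2 e2 (Suc m) (Dom C \<kappa>) N"
    "chain_map X2 e2 X1 e1 \<gamma> (Suc m)" "\<gamma> (Suc (Suc m)) = Ident C (Dom C \<kappa>)"
    "\<rho> \<in> Hom C (X2 (Suc 0)) N" "\<rho> \<cdot> e2 0 = Ident C N"
    using Suc.IH[OF _ Suc.prems(2) X1(1)] by blast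
  let ?X = "extend_by (Suc (Suc m)) X2 (Dom C q) A"
    and ?e = "extend_by (Suc m) e2 (\<kappa> \<cdot> e2 (Suc m)) (?l \<cdot> q)"
  have S: "is_extension ?X ?e (Suc (Suc m)) A N"
    using splice_extension[OF X2(1) \<kappa>] lq by simp
  define \<alpha> where "\<alpha> = extend_by (Suc (Suc m)) (\<lambda>j. \<beta> j \<cdot> \<gamma> j) q (Ident C A)"
  have ex2: "exact_sequence X2 e2 (Suc m)" "exact_sequence X1 e1 (Suc m)" "exact_sequence ?Y e0 (Suc m)"
    "X2 0 = N" "X1 0 = N" "X2 (Suc (Suc m)) = Dom C \<kappa>" "X1 (Suc (Suc m)) = Dom C \<kappa>"
    using X1(1) X2(1) k(3) unfolding is_extension_def by auto
  note b = chain_mapD(1-4)[OF X1(2)] and g = chain_mapD(1-4)[OF X2(2)]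
  note E0 = exact_sequence_arr[OF ex2(3)] and E1 = exact_sequence_arr[OF ex2(2)]
    and E2 = exact_sequence_arr[OF ex2(1)]
  have A: "A \<in> Obj C"
    using l by auto
  have eq: "e0 j \<cdot> \<beta> j \<cdot> \<gamma> j = \<beta> (Suc j) \<cdot> \<gamma> (Suc j) \<cdot> e2 j" if j: "j \<le> Suc m" for j
  proof -
    have "e0 j \<cdot> \<beta> j \<cdot> \<gamma> j = \<beta> (Suc j) \<cdot> e1 j \<cdot> \<gamma> j"
      using comp_eqD[OF b(4)[OF j], of "\<gamma> j"] b(1-3)[of j] b(1-3)[of "Suc j"] g(1-3)[of j]
        E0[OF j] E1[OF j] j by simp
    then show ?thesis
      using g(4)[OF j] by simp
  qed
  have "chain_map ?X ?e X e \<alpha> (Suc (Suc m))"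
    unfolding chain_map_def
  proof (intro conjI allI impI)
    have "N \<in> Obj C"
      using Suc.prems(2) by simp
    then show "\<alpha> 0 = Ident C (?X 0)"
      using chain_mapD(5)[OF X1(2)] chain_mapD(5)[OF X2(2)] ex2
      by (simp add: \<alpha>_def extend_by_def)
    fix j
    show "\<alpha> j \<in> Hom C (?X j) (X j)" if j: "j \<le> Suc (Suc (Suc m))"
    proof -
      consider "j < Suc (Suc m)" | "j = Suc (Suc m)" | "j = Suc (Suc (Suc m))"
        using j by linarith
      then show ?thesis
        using b(1-3)[of j] g(1-3)[of j] Aq(2) q(2) ex(3) A
        by cases (simp_all add: \<alpha>_def extend_by_def)
    qed
    show "e j \<cdot> \<alpha> j = \<alpha> (Suc j) \<cdot> ?e j" if j: "j \<le> Suc (Suc m)"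
    proof -
      consider "j < Suc m" | "j = Suc m" | "j = Suc (Suc m)"
        using j by linarith
      then show ?thesis
      proof cases
        case 1
        then have "\<alpha> j = \<beta> j \<cdot> \<gamma> j" "\<alpha> (Suc j) = \<beta> (Suc j) \<cdot> \<gamma> (Suc j)" "?e j = e2 j" "e0 j = e j"
          using k(4)[of j] by (simp_all add: \<alpha>_def extend_by_def)
        then show ?thesis
          using eq[of j] 1 b(1-3)[of "Suc j"] g(1-3)[of "Suc j"] E2[of j] by simp
      next
        case 2
        have "e (Suc m) \<cdot> \<beta> (Suc m) \<cdot> \<gamma> (Suc m) = k \<cdot> (e0 (Suc m) \<cdot> \<beta> (Suc m) \<cdot> \<gamma> (Suc m))"
          using k(5) E0[of "Suc m"] b(1-3)[of "Suc m"] g(1-3)[of "Suc m"] k(2) by simp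
        also have "\<dots> = k \<cdot> u \<cdot> e2 (Suc m)"
          using eq[of "Suc m"] X1(3) X2(3) E2[of "Suc m"] ex2(6) by simp
        also have "\<dots> = q \<cdot> \<kappa> \<cdot> e2 (Suc m)"
          using comp_eqD[OF u(2), of "e2 (Suc m)"] k(2) u(1) Aq(2) A\<kappa>(1,3) lq E2[of "Suc m"] ex2(6)
          by simp
        finally show ?thesis
          using 2 by (simp add: \<alpha>_def extend_by_def)
      next
        case 3
        then show ?thesis
          using l Aq(2) q(2) by (simp add: \<alpha>_def extend_by_def)
      qed
    qed
  qed
  moreover have "\<alpha> (Suc (Suc (Suc m))) = Ident C A" "?e 0 = e2 0" "?X (Suc 0) = X2 (Suc 0)"
    by (simp_all add: \<alpha>_def extend_by_def)
  ultimately show ?case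
    using S X2(4,5) by metis
qed

lemma Ext_zero_of_acyclic:
  assumes A: "A \<in> Obj C" "acyclic (Suc m) A" and N: "N \<in> M"
  shows "Ext_zero C (Suc m) A N"
proof -
  let ?R = "extension_morphism C (Suc m) A N"
  obtain X e where T: "is_extension X e (Suc m) A N"
    "\<And>X' e' \<rho>. \<lbrakk>is_extension X' e' (Suc m) A N; \<rho> \<in> Hom C (X' (Suc 0)) N; \<rho> \<cdot> e' 0 = Ident C N\<rbrakk> \<Longrightarrow>
      \<exists>\<alpha>. chain_map X' e' X e \<alpha> (Suc m) \<and> \<alpha> (Suc (Suc m)) = Ident C A"
    by (rule trivial_extension[OF A(1) M_obj[OF N], of m]) (rule that)
  let ?T = "map e [0..<Suc (Suc m)]"
  have *: "(fs, ?T) \<in> (?R \<union> ?R\<inverse>)\<^sup>*" if fs: "fs \<in> extensions C (Suc m) A N" for fs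
  proof -
    note F = is_extension_of_list[OF fs]
    obtain X' e' \<alpha> \<rho> where X': "is_extension X' e' (Suc m) A N"
      "chain_map X' e' (nth (objects C fs)) (nth fs) \<alpha> (Suc m)" "\<alpha> (Suc (Suc m)) = Ident C A"
      "\<rho> \<in> Hom C (X' (Suc 0)) N" "\<rho> \<cdot> e' 0 = Ident C N"
      using split_extension_above[OF A(2) N F] by blast
    obtain \<beta> where \<beta>: "chain_map X' e' X e \<beta> (Suc m)" "\<beta> (Suc (Suc m)) = Ident C A"
      using T(2)[OF X'(1,4,5)] by blast
    have "map (nth fs) [0..<Suc (Suc m)] = fs"
      using fs map_nth[of fs] unfolding extensions_def by simp
    then have "(map e' [0..<Suc (Suc m)], fs) \<in> ?R"
      using extension_morphismI[OF X'(1) F X'(2,3)] by simp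
    moreover have "(map e' [0..<Suc (Suc m)], ?T) \<in> ?R"
      using extension_morphismI[OF X'(1) T(1) \<beta>] .
    ultimately show ?thesis
      by (meson UnCI converseI converse_rtrancl_into_rtrancl r_into_rtrancl)
  qed
  have "sym (?R \<union> ?R\<inverse>)"
    by (auto simp: sym_def)
  then have "sym ((?R \<union> ?R\<inverse>)\<^sup>*)"
    by (rule sym_rtrancl)
  then have "(fs, gs) \<in> extension_equiv C (Suc m) A N"
    if "fs \<in> extensions C (Suc m) A N" "gs \<in> extensions C (Suc m) A N" for fs gs
    using *[OF that(1)] *[OF that(2)] that unfolding extension_equiv_def sym_def
    by (meson IntI SigmaI rtrancl_trans)
  then show ?thesis
    using extension_of_functions[OF T(1)] unfolding Ext_zero_iff by blast
qed

lemma effaced_of_Ext_zero: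
  assumes A: "A \<in> Obj C" and N: "N \<in> M" and M: "\<And>P. P \<in> M \<Longrightarrow> acyclic m P"
    and Ext: "Ext_zero C (Suc m) A N" and X: "is_extension X e (Suc m) A N"
  shows "effaced e m (Ident C A)"
proof -
  obtain X' e' where T: "is_extension X' e' (Suc m) A N" "effaced e' m (Ident C A)"
    by (rule trivial_extension[OF A M_obj[OF N], of m]) (rule that)
  have nth: "effaced (nth (map f [0..<Suc (Suc m)])) m = effaced f m" for f :: "nat \<Rightarrow> 'b"
    by (intro effaced_cong) (simp del: upt_Suc)
  have "(map e' [0..<Suc (Suc m)], map e [0..<Suc (Suc m)]) \<in> extension_equiv C (Suc m) A N"
    using Ext extension_of_functions[OF T(1)] extension_of_functions[OF X] unfolding Ext_zero_iff
    by blast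
  from effaced_equiv[OF this N M] show ?thesis
    using T(2) unfolding nth by blast
qed

text \<open>By induction on the degree, since \<open>effaced_equiv\<close> in one degree presupposes that the
  objects of \<open>M\<close> are acyclic in the lower ones.\<close>

lemma acyclic_of_Ext_zero:
  assumes "\<And>X N i. \<lbrakk>X \<in> M; N \<in> M; 1 \<le> i; i \<le> k\<rbrakk> \<Longrightarrow> Ext_zero C i X N" and "X \<in> M"
  shows "acyclic k X"
  using assms
proof (induction k arbitrary: X)
  case (Suc k)
  have k: "acyclic k P" if "P \<in> M" for P
    using that Suc.prems(1) by (intro Suc.IH) auto
  show ?case
  proof (rule acyclic_of_effaced)
    fix m Y e N assume "m < Suc k" "N \<in> M" "is_extension Y e (Suc m) X N"
    then show "effaced e m (Ident C X)"
      using effaced_of_Ext_zero[of X N m Y e] Suc.prems k acyclic_le[of k _ m] by simp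
  qed (use Suc.prems(2) in simp)
qed simp

end

section \<open>Composition series and subobjects\<close>

context abelian_category
begin

inductive composition_length :: "nat \<Rightarrow> 'a \<Rightarrow> bool" where
  zero: "is_zero_object C Z \<Longrightarrow> composition_length 0 Z"
| step: "\<lbrakk>composition_length n (Dom C j); ses j c; is_simple C (Cod C c)\<rbrakk> \<Longrightarrow>
    composition_length (Suc n) (Dom C c)"

lemma composition_length_of_series:
  assumes "has_finite_length C A"
  obtains n where "composition_length n A"
proof -
  obtain n :: nat and F j where F: "is_zero_object C (F 0)" "F n = A"
    "\<forall>k<n. j k \<in> Hom C (F k) (F (Suc k)) \<and> is_mono C (j k) \<and>
        (\<exists>c. is_cokernel C c (j k) \<and> is_simple C (Cod C c))"
    using assms unfolding has_finite_length_def by blast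
  have "composition_length k (F k)" if "k \<le> n" for k
    using that
  proof (induction k)
    case 0
    then show ?case
      using F(1) zero by blast
  next
    case (Suc k)
    then obtain c where c: "j k \<in> Hom C (F k) (F (Suc k))" "is_mono C (j k)" "is_cokernel C c (j k)"
      "is_simple C (Cod C c)"
      using F(3) by (meson Suc_le_lessD)
    have "ses (j k) c"
      using cokernel_mono_ses c by blast
    then have "composition_length (Suc k) (Dom C c)"
      using Suc c by (intro step[of k "j k" c]) simp_all
    then show ?case
      using c cokernel_arr(3)[OF c(3)] by simp
  qed
  then show ?thesis
    using that F(2) by blast
qed

lemma iso_of_mono_epi:
  assumes m: "is_mono C m" and e: "is_epi C m"
  shows "is_iso C m"
proof -
  obtain c where c: "ses m c"
    using mono_ses m by blast
  note A = ses_arr[OF c]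
  have "c = Zero C (Cod C m) (Cod C c)"
    using epi_zero[OF e, of c] A by simp
  then have "c \<cdot> Ident C (Cod C m) = Zero C (Cod C m) (Cod C c)"
    using A by simp
  then obtain u where u: "u \<in> Hom C (Cod C m) (Dom C m)" "m \<cdot> u = Ident C (Cod C m)"
    using A by - (rule ses_lift[OF c, of "Ident C (Cod C m)" "Cod C m"], simp_all)
  have "m \<cdot> (u \<cdot> m) = m \<cdot> Ident C (Dom C m)"
    using comp_eqD'[OF u(2), of m] u(1) A by simp
  then have "u \<cdot> m = Ident C (Dom C m)"
    by (rule mono_cancel[OF m]) (use u(1) A in simp_all)
  then show ?thesis
    unfolding is_iso_def using u A by blast
qed

lemma iso_mono_epi:
  assumes "is_iso C m"
  shows "is_mono C m" "is_epi C m"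
proof -
  obtain g where g: "g \<in> Hom C (Cod C m) (Dom C m)" "g \<cdot> m = Ident C (Dom C m)"
    "m \<cdot> g = Ident C (Cod C m)" and m: "m \<in> Arr C"
    using assms unfolding is_iso_def by blast
  show "is_mono C m"
    using mono_of_comp[of g m] g m ident_mono[of "Dom C m"] by simp
  show "is_epi C m"
    using epi_of_comp[of m g] g m ident_epi[of "Cod C m"] by simp
qed

lemma zero_objectI:
  assumes "Z \<in> Obj C" "Ident C Z = Zero C Z Z"
  shows "is_zero_object C Z"
proof -
  have 1: "f = Zero C Z X" if "f \<in> Hom C Z X" for f X
  proof -
    have X: "X \<in> Obj C"
      using that by auto
    have "f = f \<cdot> Ident C Z"
      using that by simp
    also have "\<dots> = Zero C Z X"
      unfolding assms(2) using that assms(1) X by simp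
    finally show ?thesis .
  qed
  have 2: "f = Zero C X Z" if "f \<in> Hom C X Z" for f X
  proof -
    have X: "X \<in> Obj C"
      using that by auto
    have "f = Ident C Z \<cdot> f"
      using that by simp
    also have "\<dots> = Zero C X Z"
      unfolding assms(2) using that assms(1) X by simp
    finally show ?thesis .
  qed
  have 3: "Zero C Z X \<in> Hom C Z X" "Zero C X Z \<in> Hom C X Z" if "X \<in> Obj C" for X
    using that assms(1) by simp_all
  show ?thesis
    unfolding is_zero_object_def using assms(1) 1 2 3 by metis
qed

lemma epi_to_simple:
  assumes f: "f \<in> Arr C" and S: "is_simple C (Cod C f)" and nz: "f \<noteq> Zero C (Dom C f) (Cod C f)"
  shows "is_epi C f"
proof -
  obtain q where q: "is_cokernel C q f"
    using has_cokernel f by blast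
  obtain k where k: "is_kernel C k q"
    using has_kernel cokernel_arr[OF q] by blast
  note A = cokernel_arr[OF q] kernel_arr[OF k]
  obtain e where e: "is_epi C e" "e \<in> Hom C (Dom C f) (Dom C k)" "k \<cdot> e = f"
    using image_factorisation[OF f, of k] q k unfolding is_image_def by blast
  have "Cod C k = Cod C f"
    using A by simp
  then have "is_zero_object C (Dom C k) \<or> is_iso C k"
    using S kernel_mono[OF k] unfolding is_simple_def by blast
  moreover have "\<not> is_zero_object C (Dom C k)"
  proof
    assume Z: "is_zero_object C (Dom C k)"
    have "f = k \<cdot> Zero C (Dom C f) (Dom C k)"
      using zero_object_Zero(1)[OF Z e(2)] e(3) by simp
    then show False
      using nz A f by simp
  qed
  ultimately have "is_epi C k"
    using iso_mono_epi by blast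
  then show ?thesis
    using epi_comp[OF e(1), of k] e by simp
qed

text \<open>A simple quotient \<open>B/F\<close> of \<open>B\<close> and a subobject \<open>Y \<subseteq> B\<close> give \<open>Y \<subseteq> F\<close> or \<open>Y/(Y \<inter> F) = B/F\<close>, so
  the length of \<open>Y\<close> is controlled by that of \<open>Y\<close> or of \<open>Y \<inter> F\<close> as a subobject of \<open>F\<close>.\<close>

lemma composition_length_subobject:
  assumes "composition_length n B" "is_mono C m" "Cod C m = B"
  shows "\<exists>n'\<le>n. composition_length n' (Dom C m) \<and> (n' = n \<longrightarrow> is_iso C m)"
  using assms
proof (induction arbitrary: m rule: composition_length.induct)
  case (zero Z)
  note m = mono_arr[OF zero(2)]
  have Y: "Dom C m \<in> Obj C" "Z \<in> Obj C"
    using m zero by auto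
  have "m \<cdot> Ident C (Dom C m) = m \<cdot> Zero C (Dom C m) (Dom C m)"
    using zero_object_Zero(1)[OF zero(1), of m "Dom C m"] m zero(3) Y by simp
  then have id: "Ident C (Dom C m) = Zero C (Dom C m) (Dom C m)"
    by (rule mono_cancel[OF zero(2)]) (use Y in simp_all)
  have "is_epi C m"
  proof (rule epiI)
    fix g assume g: "g \<in> Arr C" "Dom C g = Cod C m"
    then show "g = Zero C (Cod C m) (Cod C g)"
      using zero_object_Zero(2)[OF zero(1), of g "Cod C g"] zero(3) by simp
  qed (rule m)
  then show ?case
    using composition_length.zero[OF zero_objectI[OF Y(1) id]] iso_of_mono_epi zero(2) by blast
next
  case (step n j c)
  note J = ses_arr[OF step(2)]
  note m = mono_arr[OF step(5)]
  have mc: "Cod C m = Dom C c"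
    using step(6) .
  show ?case
  proof (cases "c \<cdot> m = Zero C (Dom C m) (Cod C c)")
    case True
    obtain m' where m': "m' \<in> Hom C (Dom C m) (Dom C j)" "j \<cdot> m' = m"
      using True m mc by - (rule ses_lift[OF step(2), of m "Dom C m"], simp_all)
    then have "is_mono C m'"
      using mono_of_comp[of j m'] step(5) J by auto
    then obtain n' where "n' \<le> n" "composition_length n' (Dom C m')"
      using step(4)[of m'] m' by auto
    then show ?thesis
      using m' by (intro exI[of _ n']) simp
  next
    case False
    have cm: "c \<cdot> m \<in> Hom C (Dom C m) (Cod C c)"
      using J m mc by simp
    have epi: "is_epi C (c \<cdot> m)"
      using epi_to_simple[of "c \<cdot> m"] cm step(3) False by simp
    then obtain k where k: "ses k (c \<cdot> m)"
      using epi_ses by blast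
    note K = ses_arr[OF k]
    have "c \<cdot> (m \<cdot> k) = Zero C (Dom C k) (Cod C c)"
      using K cm J m mc by simp
    then obtain m' where m': "m' \<in> Hom C (Dom C k) (Dom C j)" "j \<cdot> m' = m \<cdot> k"
      using K cm m mc by - (rule ses_lift[OF step(2), of "m \<cdot> k" "Dom C k"], simp_all)
    have "is_mono C (j \<cdot> m')"
      unfolding m'(2) using mono_comp[OF K(5) step(5)] K cm by simp
    then have "is_mono C m'"
      using mono_of_comp[of j m'] m' J by simp
    then obtain n' where n': "n' \<le> n" "composition_length n' (Dom C k)" "n' = n \<Longrightarrow> is_iso C m'"
      using step(4)[of m'] m'(1) by auto
    have "composition_length (Suc n') (Dom C m)"
      using composition_length.step[OF n'(2) k] step(3) cm by simp
    moreover have "is_iso C m" if "n' = n"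
    proof (rule iso_of_mono_epi[OF step(5)], rule epiI)
      have m'e: "is_epi C m'"
        using iso_mono_epi n'(3) that by blast
      fix x assume x: "x \<in> Arr C" "Dom C x = Cod C m" "x \<cdot> m = Zero C (Dom C m) (Cod C x)"
      have "(x \<cdot> j) \<cdot> m' = x \<cdot> m \<cdot> k"
        using x(1,2) m' J mc by simp
      also have "\<dots> = Zero C (Dom C k) (Cod C x)"
        using comp_eqD'[OF x(3), of k] x(1,2) m K cm by simp
      finally have "x \<cdot> j = Zero C (Dom C j) (Cod C x)"
        using epi_zero[OF m'e, of "x \<cdot> j"] x(1,2) m'(1) J mc by simp
      then obtain y where y: "y \<in> Hom C (Cod C c) (Cod C x)" "y \<cdot> c = x"
        using x(1,2) mc by - (rule ses_desc[OF step(2), of x "Cod C x"], simp_all)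
      have "y \<cdot> (c \<cdot> m) = Zero C (Dom C m) (Cod C x)"
        using x(3) y comp_eqD'[OF y(2), of m] m J mc by simp
      then have "y = Zero C (Cod C c) (Cod C x)"
        using epi_zero[OF epi, of y] y(1) cm by simp
      then have "x = Zero C (Cod C c) (Cod C x) \<cdot> c"
        using y(2) by simp
      then show "x = Zero C (Cod C m) (Cod C x)"
        using J x(1,2) mc by simp
    qed (rule m)
    ultimately show ?thesis
      using n'(1) by (intro exI[of _ "Suc n'"]) simp
  qed
qed

end

section \<open>Higher extensions through syzygies\<close>

locale cluster_tilting_subcategory = abelian_length_category +
  fixes M :: "'a set" and d :: nat
  assumes d: "d \<ge> 1" and ct: "cluster_tilting C d M"

sublocale cluster_tilting_subcategory \<subseteq> generating_subcategory
  using ct unfolding cluster_tilting_def by unfold_locales auto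

context cluster_tilting_subcategory
begin

lemma M_acyclic: "\<lbrakk>P \<in> M; k < d\<rbrakk> \<Longrightarrow> acyclic k P"
proof (rule acyclic_of_Ext_zero)
  fix X N i assume a: "k < d" "X \<in> M" "N \<in> M" "1 \<le> i" "i \<le> k"
  have "M = {X \<in> Obj C. \<forall>M'\<in>M. \<forall>i. 1 \<le> i \<and> i < d \<longrightarrow> Ext_zero C i X M'}"
    using ct unfolding cluster_tilting_def by blast
  then have "\<forall>M'\<in>M. \<forall>i. 1 \<le> i \<and> i < d \<longrightarrow> Ext_zero C i X M'"
    using a(2) by blast
  moreover have "1 \<le> i \<and> i < d"
    using a by linarith
  ultimately show "Ext_zero C i X N"
    using a(3) by blast
qed

text \<open>\<open>M\<close> contains every object that has no extensions by \<open>M\<close>.\<close>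

lemma acyclic_in_M:
  assumes "A \<in> Obj C" "acyclic (d - 1) A"
  shows "A \<in> M"
proof -
  have "Ext_zero C i A N" if i: "N \<in> M" "1 \<le> i" "i < d" for N i
  proof -
    obtain m where m: "i = Suc m"
      using i by (cases i) auto
    have "acyclic i A"
      using acyclic_le[OF assms(2), of i] i by simp
    then show ?thesis
      using Ext_zero_of_acyclic[of A m N] assms(1) i(1) unfolding m by blast
  qed
  moreover have "M = {X \<in> Obj C. \<forall>M'\<in>M. \<forall>i. 1 \<le> i \<and> i < d \<longrightarrow> Ext_zero C i X M'}"
    using ct unfolding cluster_tilting_def by blast
  ultimately show ?thesis
    using assms(1) by blast
qed

text \<open>Left approximations are monomorphisms as \<open>M\<close> is cogenerating.\<close>

lemma left_approximation_ses:
  assumes A: "A \<in> Obj C"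
  obtains a c where "ses a c" "Dom C a = A" "Cod C a \<in> M" "extends a"
proof -
  obtain a X where a: "X \<in> M" "a \<in> Hom C A X" "\<forall>X'\<in>M. \<forall>g\<in>Hom C A X'. \<exists>h\<in>Hom C X X'. g = h \<cdot> a"
    using ct A unfolding cluster_tilting_def functorially_finite_def left_approximation_def by blast
  obtain m X' where m: "X' \<in> M" "m \<in> Hom C A X'" "is_mono C m"
    using ct A unfolding cluster_tilting_def cogenerating_def by blast
  obtain h where h: "h \<in> Hom C X X'" "m = h \<cdot> a"
    using a(3) m by blast
  have "is_mono C (h \<cdot> a)"
    using m(3) h(2) by simp
  then have "is_mono C a"
    by (rule mono_of_comp) (use a h in simp_all)
  then obtain c where c: "ses a c"
    using mono_ses by blast
  have "extends a"
    unfolding extends_def using a by (metis Hom_iff)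
  then show ?thesis
    using that[OF c] a by simp
qed

inductive syzygy :: "'a \<Rightarrow> nat \<Rightarrow> 'a \<Rightarrow> bool" for U where
  zero: "syzygy U 0 U"
| step: "\<lbrakk>syzygy U n K; ses i p; Cod C p = K; Dom C p \<in> M\<rbrakk> \<Longrightarrow> syzygy U (Suc n) (Dom C i)"

lemma syzygy_acyclic: "\<lbrakk>syzygy U n K; acyclic (n + r) U\<rbrakk> \<Longrightarrow> acyclic r K"
proof (induction arbitrary: r rule: syzygy.induct)
  case (step n K i p)
  then have "acyclic (Suc r) K"
    by (metis add_Suc_shift)
  then show ?case
    using acyclic_syzygy step by blast
qed simp

text \<open>For a monomorphism \<open>j : L \<rightarrow> Q\<close> in \<open>M\<close> and \<open>U \<in> M\<close> this says that \<open>Ext\<^sup>d(U, L) \<rightarrow> Ext\<^sup>d(U, Q)\<close> is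
  injective.  Each class is given by a map from the \<open>d\<close>-th syzygy in some resolution of \<open>U\<close> by objects
  of \<open>M\<close>, and it is zero iff this map extends to the last term of the resolution, since these objects
  are acyclic in the lower degrees.\<close>

definition ext_injective :: "'a \<Rightarrow> 'b \<Rightarrow> bool" where
  "ext_injective U j \<longleftrightarrow> (\<forall>K i p \<kappa> s. syzygy U (d - 1) K \<and> ses i p \<and> Cod C p = K \<and> Dom C p \<in> M \<and>
     \<kappa> \<in> Hom C (Dom C i) (Dom C j) \<and> s \<in> Hom C (Dom C p) (Cod C j) \<and> j \<cdot> \<kappa> = s \<cdot> i \<longrightarrow>
     (\<exists>h\<in>Hom C (Dom C p) (Dom C j). h \<cdot> i = \<kappa>))"

lemma ext_injective_comp:
  assumes j: "ext_injective U j" and j': "ext_injective U j'" and "j \<in> Arr C" "j' \<in> Arr C"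
    and "Cod C j = Dom C j'"
  shows "ext_injective U (j' \<cdot> j)"
  unfolding ext_injective_def
proof (intro allI impI, elim conjE)
  fix K i p \<kappa> s assume a: "syzygy U (d - 1) K" "ses i p" "Cod C p = K" "Dom C p \<in> M"
    "\<kappa> \<in> Hom C (Dom C i) (Dom C (j' \<cdot> j))" "s \<in> Hom C (Dom C p) (Cod C (j' \<cdot> j))" "(j' \<cdot> j) \<cdot> \<kappa> = s \<cdot> i"
  note A = ses_arr[OF a(2)]
  have \<kappa>: "\<kappa> \<in> Hom C (Dom C i) (Dom C j)" "s \<in> Hom C (Dom C p) (Cod C j')"
    using a(5,6) assms(3-5) by simp_all
  have "j \<cdot> \<kappa> \<in> Hom C (Dom C i) (Dom C j')" "j' \<cdot> (j \<cdot> \<kappa>) = s \<cdot> i"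
    using \<kappa> a(7) assms(3-5) by simp_all
  then obtain h where h: "h \<in> Hom C (Dom C p) (Cod C j)" "h \<cdot> i = j \<cdot> \<kappa>"
    using j' a(1-4) \<kappa> assms(5) unfolding ext_injective_def by metis
  then have "\<exists>h'\<in>Hom C (Dom C p) (Dom C j). h' \<cdot> i = \<kappa>"
    using j a(1-4) \<kappa> unfolding ext_injective_def by metis
  then show "\<exists>h\<in>Hom C (Dom C p) (Dom C (j' \<cdot> j)). h \<cdot> i = \<kappa>"
    using assms(3-5) by simp
qed

lemma ext_injective_ident: "Q \<in> Obj C \<Longrightarrow> ext_injective U (Ident C Q)"
  unfolding ext_injective_def by (auto intro!: bexI)

text \<open>What a \<open>d\<close>-kernel in \<open>M\<close> provides, in the form in which dimension shifting uses it.\<close>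

definition hom_exact :: "(nat \<Rightarrow> 'a) \<Rightarrow> (nat \<Rightarrow> 'b) \<Rightarrow> bool" where
  "hom_exact X f \<longleftrightarrow> (\<forall>j\<le>d. f j \<in> Hom C (X j) (X (Suc j))) \<and> (\<forall>j\<le>Suc d. X j \<in> M) \<and> is_mono C (f 0) \<and>
     (\<forall>j<d. f (Suc j) \<cdot> f j = Zero C (X j) (X (Suc (Suc j)))) \<and>
     (\<forall>P\<in>M. \<forall>j<d. \<forall>h\<in>Hom C P (X (Suc j)). f (Suc j) \<cdot> h = Zero C P (X (Suc (Suc j))) \<longrightarrow>
        (\<exists>t\<in>Hom C P (X j). f j \<cdot> t = h))"

lemma hom_exactD:
  assumes "hom_exact X f"
  shows "j \<le> d \<Longrightarrow> f j \<in> Hom C (X j) (X (Suc j))" "j \<le> Suc d \<Longrightarrow> X j \<in> M" "is_mono C (f 0)"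
    "j < d \<Longrightarrow> f (Suc j) \<cdot> f j = Zero C (X j) (X (Suc (Suc j)))"
  using assms unfolding hom_exact_def by auto

lemma hom_exact_lift:
  assumes "hom_exact X f" "P \<in> M" "j < d" "h \<in> Hom C P (X (Suc j))"
    "f (Suc j) \<cdot> h = Zero C P (X (Suc (Suc j)))"
  obtains t where "t \<in> Hom C P (X j)" "f j \<cdot> t = h"
  using assms unfolding hom_exact_def by blast

text \<open>One shift moves \<open>g\<close> from the \<open>n\<close>-th syzygy of \<open>U\<close> to the one before it and from \<open>X\<^bsub>r+1\<^esub>\<close> to
  \<open>X\<^bsub>r+2\<^esub>\<close>; after \<open>n\<close> shifts the hypothesis on \<open>U\<close> applies.\<close>

lemma syzygy_lift:
  assumes X: "hom_exact X f" and U: "U \<in> M"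
    and top: "\<And>g. g \<in> Hom C U (X (Suc d)) \<Longrightarrow> \<exists>t\<in>Hom C U (X d). f d \<cdot> t = g"
  shows "\<lbrakk>syzygy U n K; n + r = d; 1 \<le> r; g \<in> Hom C K (X (Suc r));
    1 \<le> n \<Longrightarrow> f (Suc r) \<cdot> g = Zero C K (X (Suc (Suc r)))\<rbrakk> \<Longrightarrow> \<exists>t\<in>Hom C K (X r). f r \<cdot> t = g"
proof (induction arbitrary: r g rule: syzygy.induct)
  case zero
  then show ?case
    using top by simp
next
  case (step n K i p)
  note A = ses_arr[OF step(2)]
  have r: "n + Suc r = d" "r < d" "Suc r \<le> d"
    using step.prems by auto
  have f: "f r \<in> Hom C (X r) (X (Suc r))" "f (Suc r) \<in> Hom C (X (Suc r)) (X (Suc (Suc r)))"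
    using hom_exactD(1)[OF X] r by auto
  have XM: "X (Suc r) \<in> M" "X (Suc (Suc r)) \<in> M"
    using hom_exactD(2)[OF X] r by auto
  have "acyclic (Suc (r - 1)) K"
    using syzygy_acyclic[OF step(1)] M_acyclic[OF U, of "n + r"] step.prems r by simp
  then have "extends i"
    using step(2,3) unfolding acyclic.simps ext1_zero_def by blast
  then obtain f' where f': "f' \<in> Hom C (Dom C p) (X (Suc r))" "f' \<cdot> i = g"
    using extendsE[OF _ XM(1), of i g] step.prems(3) A by auto
  have gz: "f (Suc r) \<cdot> g = Zero C (Dom C i) (X (Suc (Suc r)))"
    using step.prems(4) by simp
  have "(f (Suc r) \<cdot> f') \<cdot> i = Zero C (Dom C i) (X (Suc (Suc r)))"
    using gz f' f A by simp
  then obtain g0 where g0: "g0 \<in> Hom C K (X (Suc (Suc r)))" "g0 \<cdot> p = f (Suc r) \<cdot> f'"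
    using f' f A step(3) by - (rule ses_desc[OF step(2), of "f (Suc r) \<cdot> f'" "X (Suc (Suc r))"], simp_all)
  have "f (Suc (Suc r)) \<cdot> g0 = Zero C K (X (Suc (Suc (Suc r))))" if "1 \<le> n"
  proof -
    have r': "Suc r < d"
      using that r by simp
    have f2: "f (Suc (Suc r)) \<in> Hom C (X (Suc (Suc r))) (X (Suc (Suc (Suc r))))"
      "X (Suc (Suc (Suc r))) \<in> M"
      using hom_exactD(1,2)[OF X] r' by auto
    have "f (Suc (Suc r)) \<cdot> f (Suc r) \<cdot> f' = Zero C (Dom C p) (X (Suc (Suc (Suc r))))"
      using comp_eqD'[OF hom_exactD(4)[OF X r'], of f'] f2 f f' XM by simp
    then have "(f (Suc (Suc r)) \<cdot> g0) \<cdot> p = Zero C (Dom C p) (X (Suc (Suc (Suc r))))"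
      using g0 f2 A step(3) by simp
    then show ?thesis
      using epi_zero[OF A(6), of "f (Suc (Suc r)) \<cdot> g0"] g0(1) f2 step(3) by simp
  qed
  then obtain t0 where t0: "t0 \<in> Hom C K (X (Suc r))" "f (Suc r) \<cdot> t0 = g0"
    using step.IH[OF r(1) _ g0(1)] by auto
  have h: "diff f' (t0 \<cdot> p) \<in> Hom C (Dom C p) (X (Suc r))"
    using f' t0(1) A step(3) by simp
  have "f (Suc r) \<cdot> t0 \<cdot> p = f (Suc r) \<cdot> f'"
    using comp_eqD'[OF t0(2), of p] t0(1) f g0 A step(3) by simp
  then have "f (Suc r) \<cdot> diff f' (t0 \<cdot> p) = Zero C (Dom C p) (X (Suc (Suc r)))"
    using f' t0(1) A step(3) f by simp
  then obtain l where l: "l \<in> Hom C (Dom C p) (X r)" "f r \<cdot> l = diff f' (t0 \<cdot> p)"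
    using hom_exact_lift[OF X step(4) r(2) h] by blast
  have "f r \<cdot> (l \<cdot> i) = diff f' (t0 \<cdot> p) \<cdot> i"
    using comp_eqD'[OF l(2), of i] l(1) f A by simp
  also have "\<dots> = g"
    using f' t0(1) A step(3) step.prems(3) XM by simp
  finally show ?case
    using l(1) A by (intro bexI[of _ "l \<cdot> i"]) simp_all
qed

text \<open>If the class of \<open>\<kappa>\<close> dies in \<open>Ext\<^sup>d(U, X\<^sub>1)\<close>, a chain map from the resolution of \<open>U\<close> to the
  sequence ends with a map \<open>U \<rightarrow> X\<^bsub>d+1\<^esub>\<close>.  It lifts to \<open>X\<^sub>d\<close> by assumption, which makes the chain map
  homotopic to zero; at the left end the homotopy extends \<open>\<kappa>\<close>.\<close>

lemma ext_injective_of_hom_exact: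
  assumes X: "hom_exact X f" and U: "U \<in> M"
    and top: "\<And>g. g \<in> Hom C U (X (Suc d)) \<Longrightarrow> \<exists>t\<in>Hom C U (X d). f d \<cdot> t = g"
  shows "ext_injective U (f 0)"
  unfolding ext_injective_def
proof (intro allI impI, elim conjE)
  fix K i p \<kappa> s assume a: "syzygy U (d - 1) K" "ses i p" "Cod C p = K" "Dom C p \<in> M"
    "\<kappa> \<in> Hom C (Dom C i) (Dom C (f 0))" "s \<in> Hom C (Dom C p) (Cod C (f 0))" "f 0 \<cdot> \<kappa> = s \<cdot> i"
  note A = ses_arr[OF a(2)]
  have f: "f 0 \<in> Hom C (X 0) (X (Suc 0))" "f (Suc 0) \<in> Hom C (X (Suc 0)) (X (Suc (Suc 0)))"
    using hom_exactD(1)[OF X] d by auto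
  have XM: "X 0 \<in> M" "X (Suc 0) \<in> M" "X (Suc (Suc 0)) \<in> M"
    using hom_exactD(2)[OF X] d by auto
  have f10: "f (Suc 0) \<cdot> f 0 = Zero C (X 0) (X (Suc (Suc 0)))"
    using hom_exactD(4)[OF X, of 0] d by simp
  have \<kappa>: "\<kappa> \<in> Hom C (Dom C i) (X 0)" "s \<in> Hom C (Dom C p) (X (Suc 0))"
    using a(5,6) f by simp_all
  have "f (Suc 0) \<cdot> s \<cdot> i = f (Suc 0) \<cdot> f 0 \<cdot> \<kappa>"
    using a(7) by simp
  also have "\<dots> = Zero C (Dom C i) (X (Suc (Suc 0)))"
    using comp_eqD'[OF f10, of \<kappa>] \<kappa> f XM by simp
  finally have "(f (Suc 0) \<cdot> s) \<cdot> i = Zero C (Dom C i) (X (Suc (Suc 0)))"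
    using \<kappa> f A by simp
  then obtain g where g: "g \<in> Hom C K (X (Suc (Suc 0)))" "g \<cdot> p = f (Suc 0) \<cdot> s"
    using \<kappa> f A a(3) by - (rule ses_desc[OF a(2), of "f (Suc 0) \<cdot> s" "X (Suc (Suc 0))"], simp_all)
  have "f (Suc (Suc 0)) \<cdot> g = Zero C K (X (Suc (Suc (Suc 0))))" if "1 \<le> d - 1"
  proof -
    have d2: "Suc 0 < d"
      using that by simp
    have f2: "f (Suc (Suc 0)) \<in> Hom C (X (Suc (Suc 0))) (X (Suc (Suc (Suc 0))))"
      "X (Suc (Suc (Suc 0))) \<in> M"
      using hom_exactD(1,2)[OF X] d2 by auto
    have "f (Suc (Suc 0)) \<cdot> f (Suc 0) \<cdot> s = Zero C (Dom C p) (X (Suc (Suc (Suc 0))))"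
      using comp_eqD'[OF hom_exactD(4)[OF X d2], of s] f2 f \<kappa> XM by simp
    then have "(f (Suc (Suc 0)) \<cdot> g) \<cdot> p = Zero C (Dom C p) (X (Suc (Suc (Suc 0))))"
      using g f2 A a(3) by simp
    then show ?thesis
      using epi_zero[OF A(6), of "f (Suc (Suc 0)) \<cdot> g"] g(1) f2 a(3) by simp
  qed
  then obtain t where t: "t \<in> Hom C K (X (Suc 0))" "f (Suc 0) \<cdot> t = g"
    using syzygy_lift[OF X U top a(1) _ _ g(1)] d by auto
  have h: "diff s (t \<cdot> p) \<in> Hom C (Dom C p) (X (Suc 0))"
    using \<kappa> t(1) A a(3) by simp
  have "f (Suc 0) \<cdot> t \<cdot> p = f (Suc 0) \<cdot> s"
    using comp_eqD'[OF t(2), of p] t(1) f g A a(3) by simp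
  then have "f (Suc 0) \<cdot> diff s (t \<cdot> p) = Zero C (Dom C p) (X (Suc (Suc 0)))"
    using \<kappa> t(1) A a(3) f by simp
  then obtain l where l: "l \<in> Hom C (Dom C p) (X 0)" "f 0 \<cdot> l = diff s (t \<cdot> p)"
    using hom_exact_lift[OF X a(4) _ h] d by auto
  have "f 0 \<cdot> (l \<cdot> i) = diff s (t \<cdot> p) \<cdot> i"
    using comp_eqD'[OF l(2), of i] l(1) f A by simp
  also have "\<dots> = f 0 \<cdot> \<kappa>"
    using \<kappa> t(1) A a(3,7) XM f by simp
  finally have "l \<cdot> i = \<kappa>"
    by (rule mono_cancel[OF hom_exactD(3)[OF X]]) (use l(1) \<kappa>(1) A f in simp_all)
  then show "\<exists>h\<in>Hom C (Dom C p) (Dom C (f 0)). h \<cdot> i = \<kappa>"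
    using l(1) f by (intro bexI[of _ l]) simp_all
qed

text \<open>Conversely, a map \<open>U \<rightarrow> X\<^bsub>d+1\<^esub>\<close> yields a class in \<open>Ext\<^sup>d(U, X\<^sub>0)\<close> that dies in \<open>Ext\<^sup>d(U, X\<^sub>1)\<close>.
  By injectivity it is zero, so the map lifts.\<close>

lemma syzygy_lift_top:
  assumes X: "exact_sequence X f d" and XM: "\<And>j. j \<le> d \<Longrightarrow> X j \<in> M" and U: "U \<in> M"
    and inj: "ext_injective U (f 0)"
  shows "\<lbrakk>Suc (m + n) = d; syzygy U n K; g \<in> Hom C K (X (Suc (Suc m))); liftable (f (Suc m)) g\<rbrakk> \<Longrightarrow>
    \<exists>t\<in>Hom C K (X (Suc m)). f (Suc m) \<cdot> t = g"
proof (induction m arbitrary: n K g)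
  case 0
  have f: "f 0 \<in> Hom C (X 0) (X (Suc 0))" "f (Suc 0) \<in> Hom C (X (Suc 0)) (X (Suc (Suc 0)))"
    using exact_sequence_arr[OF X, of 0] exact_sequence_arr[OF X, of "Suc 0"] 0(1) by auto
  obtain i p y where p: "ses i p" "Cod C p = K" "Dom C p \<in> M" "y \<in> Hom C (Dom C p) (X (Suc 0))"
    "f (Suc 0) \<cdot> y = g \<cdot> p"
    using 0(3,4) f unfolding liftable_def by auto
  note A = ses_arr[OF p(1)]
  have yi: "y \<cdot> i \<in> Hom C (Dom C i) (X (Suc 0))"
    using p A by simp
  have "f (Suc 0) \<cdot> (y \<cdot> i) = Zero C (Dom C i) (X (Suc (Suc 0)))"
    using comp_eqD[OF p(5), of i] p f A 0(3) by simp
  then obtain \<kappa> where \<kappa>: "\<kappa> \<in> Hom C (Dom C i) (X 0)" "f 0 \<cdot> \<kappa> = y \<cdot> i"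
    using exact_sequence_lift[OF X _ yi] d by auto
  have "d - 1 = n"
    using 0(1) by simp
  then have "syzygy U (d - 1) K"
    using 0(2) by simp
  then obtain h where h: "h \<in> Hom C (Dom C p) (X 0)" "h \<cdot> i = \<kappa>"
    using inj p \<kappa> f unfolding ext_injective_def by (metis Hom_iff)
  have f10: "f (Suc 0) \<cdot> f 0 = Zero C (X 0) (X (Suc (Suc 0)))"
    using exact_sequence_zero[OF X, of 0] d by simp
  show ?case
    using corrected_lift[OF p(1) f(2) f10 f(1) _ p(4,5) h(1)] h \<kappa> 0(3) p(2) by (metis Hom_iff)
next
  case (Suc m)
  let ?e = "f (Suc (Suc m))"
  have f: "f (Suc m) \<in> Hom C (X (Suc m)) (X (Suc (Suc m)))"
    "?e \<in> Hom C (X (Suc (Suc m))) (X (Suc (Suc (Suc m))))"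
    using exact_sequence_arr[OF X, of "Suc m"] exact_sequence_arr[OF X, of "Suc (Suc m)"] Suc(2) by auto
  obtain i p y where p: "ses i p" "Cod C p = K" "Dom C p \<in> M" "y \<in> Hom C (Dom C p) (X (Suc (Suc m)))"
    "?e \<cdot> y = g \<cdot> p"
    using Suc.prems(3,4) f unfolding liftable_def by auto
  note A = ses_arr[OF p(1)]
  have g: "g \<in> Arr C" "Dom C g = K" "Cod C g = X (Suc (Suc (Suc m)))"
    using Suc.prems(3) by auto
  have n: "Suc (Suc m) \<le> d" "Suc (m + Suc n) = d"
    using Suc.prems(1) by simp_all
  have yi: "y \<cdot> i \<in> Hom C (Dom C i) (X (Suc (Suc m)))"
    using p A by simp
  have "liftable (f (Suc m)) (y \<cdot> i)"
    using lift_on_kernel[OF X n(1) p(1) _ p(4,5) g(1,3)] p(2) g(2) by simp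
  then obtain z where z: "z \<in> Hom C (Dom C i) (X (Suc m))" "f (Suc m) \<cdot> z = y \<cdot> i"
    using Suc.IH[OF n(2) syzygy.step[OF Suc.prems(2) p(1-3)] yi] by blast
  have "acyclic (Suc m) K"
    by (rule syzygy_acyclic[OF Suc.prems(2) M_acyclic[OF U]]) (use Suc.prems(1) in simp)
  then have "extends i"
    using p(1,2) unfolding acyclic.simps ext1_zero_def by blast
  then obtain h where h: "h \<in> Hom C (Dom C p) (X (Suc m))" "h \<cdot> i = z"
    using extendsE[OF _ XM, of i "Suc m" z] z n A by auto
  then show ?case
    using corrected_lift[OF p(1) f(2) exact_sequence_zero[OF X n(1)] f(1) _ p(4,5) h(1)] h z(2)
      Suc.prems(3) p(2) by metis
qed

text \<open>The obstruction to lifting lies in \<open>Ext\<^sup>m(K, X\<^sub>0)\<close>, up to extensions of \<open>K\<close> by the objects in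
  between; all of these are zero.\<close>

lemma exact_sequence_hom_exact:
  assumes X: "exact_sequence X f d" and XM: "\<And>j. j \<le> d \<Longrightarrow> X j \<in> M"
  shows "\<lbrakk>m < d; acyclic m K; g \<in> Hom C K (X (Suc m)); f (Suc m) \<cdot> g = Zero C K (X (Suc (Suc m)))\<rbrakk> \<Longrightarrow>
    \<exists>t\<in>Hom C K (X m). f m \<cdot> t = g"
proof (induction m arbitrary: K g)
  case 0
  then show ?case
    using exact_sequence_lift[OF X _ 0(3,4)] by blast
next
  case (Suc m)
  let ?e = "f (Suc m)"
  have f: "f m \<in> Hom C (X m) (X (Suc m))" "?e \<in> Hom C (X (Suc m)) (X (Suc (Suc m)))"
    using exact_sequence_arr[OF X, of m] exact_sequence_arr[OF X, of "Suc m"] Suc(2) by auto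
  have "liftable ?e g"
    using exact_sequence_liftable[OF X Suc.prems(1,3,4)] .
  then obtain i p y where p: "ses i p" "Cod C p = K" "Dom C p \<in> M" "y \<in> Hom C (Dom C p) (X (Suc m))"
    "?e \<cdot> y = g \<cdot> p"
    using Suc.prems(3) f unfolding liftable_def by auto
  note A = ses_arr[OF p(1)]
  have g: "g \<in> Arr C" "Dom C g = K" "Cod C g = X (Suc (Suc m))"
    using Suc.prems(3) by auto
  have yi: "y \<cdot> i \<in> Hom C (Dom C i) (X (Suc m))"
    using p A by simp
  have "?e \<cdot> (y \<cdot> i) = Zero C (Dom C i) (X (Suc (Suc m)))"
    using comp_eqD[OF p(5), of i] p f g A by simp
  moreover have "acyclic m (Dom C i)"
    using acyclic_syzygy[OF Suc.prems(2) p(1-3)] .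
  ultimately obtain z where z: "z \<in> Hom C (Dom C i) (X m)" "f m \<cdot> z = y \<cdot> i"
    using Suc.IH[OF _ _ yi] Suc.prems(1) by auto
  have "extends i"
    using p(1,2) Suc.prems(2) unfolding acyclic.simps ext1_zero_def by blast
  then obtain h where h: "h \<in> Hom C (Dom C p) (X m)" "h \<cdot> i = z"
    using extendsE[OF _ XM, of i m z] z Suc.prems(1) A by auto
  then show ?case
    using corrected_lift[OF p(1) f(2) exact_sequence_zero[OF X, of m] f(1) _ p(4,5) h(1)] h z(2)
      Suc.prems(1,3) p(2) by (metis less_imp_le)
qed

text \<open>Starting with the cokernel of the monomorphism, embed each cokernel into \<open>M\<close> by a left
  approximation and take the next cokernel.  Counted from zero, the \<open>k\<close>-th of these is acyclic up to degree \<open>k\<close> by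
  \<open>acyclic_closure\<close>, so after \<open>d - 1\<close> steps it belongs to \<open>M\<close>.\<close>

lemma mono_sequence:
  assumes j0: "is_mono C j0" "Dom C j0 \<in> M" "Cod C j0 \<in> M"
  obtains X f where "exact_sequence X f d" "is_epi C (f d)" "f 0 = j0" "X 0 = Dom C j0" "X 1 = Cod C j0"
    "\<And>j. j \<le> Suc d \<Longrightarrow> X j \<in> M"
    "\<And>j N h. \<lbrakk>j < d; N \<in> M; h \<in> Hom C (X (Suc j)) N; h \<cdot> f j = Zero C (X j) N\<rbrakk> \<Longrightarrow>
      \<exists>t\<in>Hom C (X (Suc (Suc j))) N. t \<cdot> f (Suc j) = h"
proof -
  obtain c0 where c0: "ses j0 c0"
    using mono_ses j0 by blast
  \<comment> \<open>The sequence of short exact sequences is chosen recursively, by iterating a choice function.\<close>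
  define S where "S = (\<lambda>(a, c). ses a c \<and> Cod C a \<in> M)"
  have "\<exists>q. S q \<and> Dom C (fst q) = Cod C (snd r) \<and> extends (fst q)" if "S r" for r :: "'b \<times> 'b"
  proof -
    have "Cod C (snd r) \<in> Obj C"
      using that ses_arr(2)[of "fst r" "snd r"] by (auto simp: S_def)
    then obtain a c where "ses a c" "Dom C a = Cod C (snd r)" "Cod C a \<in> M" "extends a"
      using left_approximation_ses by blast
    then show ?thesis
      by (intro exI[of _ "(a, c)"]) (simp add: S_def)
  qed
  then obtain nx where nx: "\<And>r. S r \<Longrightarrow> S (nx r) \<and> Dom C (fst (nx r)) = Cod C (snd r) \<and> extends (fst (nx r))"
    by metis
  define q where "q = (\<lambda>n. (nx ^^ n) (j0, c0))"
  have q0: "q 0 = (j0, c0)" and qS: "q (Suc n) = nx (q n)" for n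
    by (simp_all add: q_def)
  have Sq: "S (q n)" for n
  proof (induction n)
    case 0
    then show ?case
      using c0 j0 by (simp add: S_def q0)
  next
    case (Suc n)
    then show ?case
      using nx qS by simp
  qed
  define a where "a = (\<lambda>n. fst (q n))"
  define c where "c = (\<lambda>n. snd (q n))"
  have ac: "ses (a n) (c n)" "Cod C (a n) \<in> M" for n
    using Sq[of n] by (simp_all add: S_def a_def c_def case_prod_beta)
  have as: "Dom C (a (Suc n)) = Cod C (c n)" "extends (a (Suc n))" for n
    using nx[OF Sq[of n]] by (simp_all add: a_def c_def qS)
  have a0: "a 0 = j0"
    by (simp add: a_def q0)
  note A = ses_arr[OF ac(1)]
  have acyc: "n < d \<Longrightarrow> acyclic n (Cod C (c n))" for n
  proof (induction n)
    case (Suc n)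
    have M_n: "acyclic j P" if "P \<in> M" "j < Suc n" for P j
      using M_acyclic[OF that(1)] that(2) Suc.prems by (meson less_trans)
    have clos: "\<forall>a b. ses a b \<and> acyclic n (Dom C a) \<and> acyclic (Suc n) (Dom C b) \<and> extends a \<longrightarrow>
        acyclic (Suc n) (Cod C b)"
      by (rule acyclic_closure[of "Suc n", THEN conjunct2, THEN conjunct1, unfolded diff_Suc_1])
        (rule M_n)
    have "acyclic n (Dom C (a (Suc n)))"
      unfolding as(1) using Suc.IH Suc.prems by (meson Suc_lessD)
    moreover have "acyclic (Suc n) (Dom C (c (Suc n)))"
      using M_acyclic[OF ac(2) Suc.prems, of "Suc n"] unfolding A(3) .
    ultimately show ?case
      using clos ac(1)[of "Suc n"] as(2)[of n] by blast
  qed simp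
  have last: "Cod C (c (d - 1)) \<in> M"
    using acyclic_in_M[OF _ acyc] A(2)[of "d - 1"] d by simp
  \<comment> \<open>\<open>f j\<close> factors as \<open>e j\<close> followed by \<open>a j\<close>; the last arrow is the last cokernel itself.\<close>
  define e where "e = (\<lambda>j. if j = 0 then Ident C (Dom C j0) else c (j - 1))"
  define f where "f = (\<lambda>j. if j < d then a j \<cdot> e j else e j)"
  define X where "X = (\<lambda>j. if j = 0 then Dom C j0 else if j \<le> d then Cod C (a (j - 1)) else Cod C (c (d - 1)))"
  have j0arr: "j0 \<in> Arr C"
    using mono_arr j0 by blast
  have e: "e j \<in> Arr C" "is_epi C (e j)" "Cod C (e j) = Dom C (a j)" for j
  proof -
    have "e j \<in> Arr C \<and> is_epi C (e j) \<and> Cod C (e j) = Dom C (a j)"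
    proof (cases j)
      case 0
      then show ?thesis
        using j0arr a0 ident_epi[of "Dom C j0"] by (simp add: e_def)
    next
      case (Suc n)
      then show ?thesis
        using A(2,6)[of n] as(1)[of n] by (simp add: e_def)
    qed
    then show "e j \<in> Arr C" "is_epi C (e j)" "Cod C (e j) = Dom C (a j)"
      by auto
  qed
  have eX: "Dom C (e j) = X j" if "j \<le> d" for j
    using that A(3)[of "j - 1"] j0arr by (auto simp: e_def X_def)
  have fH: "f j \<in> Hom C (X j) (X (Suc j))" if j: "j \<le> d" for j
  proof (cases "j < d")
    case True
    then show ?thesis
      using e[of j] eX[of j] A(1)[of j] by (simp add: f_def X_def)
  next
    case False
    then have "j = d"
      using j by simp
    then show ?thesis
      using e[of d] eX[of d] d by (simp add: f_def X_def e_def)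
  qed
  have f0: "f 0 = j0"
    using d j0arr a0 by (simp add: f_def e_def)
  have "exact_pair C (f j) (f (Suc j))" if j: "j < d" for j
  proof -
    have k: "is_kernel C (a j) (c j)"
      using ac(1)[of j] by (simp add: ses_def)
    have "is_kernel C (a j) (f (Suc j))"
    proof (cases "Suc j < d")
      case True
      then show ?thesis
        using kernel_mono_comp[OF k A(5)[of "Suc j"] as(1)] by (simp add: f_def e_def)
    next
      case False
      then show ?thesis
        using k by (simp add: f_def e_def)
    qed
    then show ?thesis
      unfolding exact_pair_iff using e[of j] A(1)[of j] j
      by (intro exI[of _ "a j"] exI[of _ "e j"]) (simp add: f_def)
  qed
  then have ex: "exact_sequence X f d"
    using fH f0 j0(1) unfolding exact_sequence_def by simp
  have fd: "is_epi C (f d)"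
    using e(2)[of d] by (simp add: f_def)
  have X01: "X 0 = Dom C j0" "X 1 = Cod C j0"
    using d a0 by (simp_all add: X_def)
  have XM: "X j \<in> M" if "j \<le> Suc d" for j
    using j0 ac(2) last by (simp add: X_def)
  have hom: "\<exists>t\<in>Hom C (X (Suc (Suc j))) N. t \<cdot> f (Suc j) = h"
    if h: "j < d" "N \<in> M" "h \<in> Hom C (X (Suc j)) N" "h \<cdot> f j = Zero C (X j) N" for j N h
  proof -
    have XS: "X (Suc j) = Cod C (a j)"
      using h(1) by (simp add: X_def)
    have ha: "h \<cdot> a j \<in> Hom C (Dom C (a j)) N"
      using h(3) XS A(1)[of j] by simp
    have "(h \<cdot> a j) \<cdot> e j = Zero C (Dom C (e j)) N"
      using h XS A(1)[of j] e[of j] eX[of j] by (simp add: f_def)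
    then have "h \<cdot> a j = Zero C (Dom C (a j)) N"
      using epi_zero[OF e(2)[of j], of "h \<cdot> a j"] ha e[of j] by simp
    then obtain w where w: "w \<in> Hom C (Cod C (c j)) N" "w \<cdot> c j = h"
      using h(3) XS A(3)[of j] by - (rule ses_desc[OF ac(1)[of j], of h N], simp_all)
    show ?thesis
    proof (cases "Suc j < d")
      case True
      obtain t where t: "t \<in> Hom C (Cod C (a (Suc j))) N" "t \<cdot> a (Suc j) = w"
        using extendsE[OF as(2)[of j] h(2), of w] w as(1)[of j] by auto
      have "t \<cdot> f (Suc j) = w \<cdot> c j"
        using comp_eqD'[OF t(2), of "c j"] t(1) True A(1)[of "Suc j"] A(2)[of j] as(1)[of j]
        by (simp add: f_def e_def)
      then show ?thesis
        using t(1) w(2) True by (intro bexI[of _ t]) (simp_all add: X_def)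
    next
      case False
      then have "Suc j = d"
        using h(1) by simp
      then show ?thesis
        using w by (intro bexI[of _ w]) (auto simp: f_def e_def X_def)
    qed
  qed
  show ?thesis
    using that[OF ex fd f0 X01 XM hom] by blast
qed

end

section \<open>Torsion classes and their intersections\<close>

text \<open>A sequence of groups with increasing indices, as for covariant Hom, read off the
  inductive definition.\<close>

lemma exact_seq_rev_iff:
  fixes G :: "nat \<Rightarrow> 'g monoid"
  assumes "1 \<le> n"
  shows "exact_seq (rev (map G [0..<Suc n]), rev (map \<phi> [0..<n])) \<longleftrightarrow>
    (\<forall>j<n. group_hom (G j) (G (Suc j)) (\<phi> j)) \<and>
    (\<forall>j. Suc j < n \<longrightarrow> kernel (G (Suc j)) (G (Suc (Suc j))) (\<phi> (Suc j)) = \<phi> j ` carrier (G j))"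
  using assms
proof (induction n rule: nat_induct_at_least)
  case base
  then show ?case
    by simp
next
  case (Suc n)
  then obtain k where k: "n = Suc k"
    by (cases n) auto
  let ?P = "\<forall>j<n. group_hom (G j) (G (Suc j)) (\<phi> j)"
  let ?K = "\<lambda>j. kernel (G (Suc j)) (G (Suc (Suc j))) (\<phi> (Suc j)) = \<phi> j ` carrier (G j)"
  have 1: "exact_seq (rev (map G [0..<Suc (Suc n)]), rev (map \<phi> [0..<Suc n])) \<longleftrightarrow>
    exact_seq (rev (map G [0..<Suc n]), rev (map \<phi> [0..<n])) \<and> group (G (Suc n)) \<and>
    \<phi> n \<in> hom (G n) (G (Suc n)) \<and> ?K k"
    unfolding k by simp
  have 2: "(\<forall>j<Suc n. group_hom (G j) (G (Suc j)) (\<phi> j)) \<longleftrightarrow> ?P \<and> group_hom (G n) (G (Suc n)) (\<phi> n)"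
    by (auto simp: less_Suc_eq)
  have 3: "(\<forall>j. Suc j < Suc n \<longrightarrow> ?K j) \<longleftrightarrow> (\<forall>j. Suc j < n \<longrightarrow> ?K j) \<and> ?K k"
    unfolding k by (auto simp: less_Suc_eq)
  have 4: "group_hom (G n) (G (Suc n)) (\<phi> n) \<longleftrightarrow> group (G (Suc n)) \<and> \<phi> n \<in> hom (G n) (G (Suc n))" if ?P
    using that unfolding k by (auto simp: group_hom_def group_hom_axioms_def)
  show ?case
    unfolding 1 2 3 Suc.IH using 4 by argo
qed

text \<open>The same for decreasing indices, as for contravariant Hom.\<close>

lemma exact_seq_map_iff:
  fixes G :: "nat \<Rightarrow> 'g monoid"
  assumes "1 \<le> n"
  shows "exact_seq (map G [0..<Suc n], map \<phi> [0..<n]) \<longleftrightarrow>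
    (\<forall>j<n. group_hom (G (Suc j)) (G j) (\<phi> j)) \<and>
    (\<forall>j. Suc j < n \<longrightarrow> kernel (G (Suc j)) (G j) (\<phi> j) = \<phi> (Suc j) ` carrier (G (Suc (Suc j))))"
  using assms
proof (induction n arbitrary: G \<phi> rule: nat_induct_at_least)
  case base
  then show ?case
    by simp
next
  case (Suc n)
  then obtain k where k: "n = Suc k"
    by (cases n) auto
  let ?P = "\<forall>j<n. group_hom (G (Suc (Suc j))) (G (Suc j)) (\<phi> (Suc j))"
  let ?K = "\<lambda>j. kernel (G (Suc j)) (G j) (\<phi> j) = \<phi> (Suc j) ` carrier (G (Suc (Suc j)))"
  have 1: "exact_seq (map G [0..<Suc (Suc n)], map \<phi> [0..<Suc n]) \<longleftrightarrow>
    exact_seq (map (\<lambda>i. G (Suc i)) [0..<Suc n], map (\<lambda>i. \<phi> (Suc i)) [0..<n]) \<and> group (G 0) \<and>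
    \<phi> 0 \<in> hom (G (Suc 0)) (G 0) \<and> ?K 0"
    unfolding k by (simp add: map_upt_Suc del: upt_Suc)
  have 2: "(\<forall>j<Suc n. group_hom (G (Suc j)) (G j) (\<phi> j)) \<longleftrightarrow> group_hom (G (Suc 0)) (G 0) (\<phi> 0) \<and> ?P"
    by (rule All_less_Suc2)
  have 3: "(\<forall>j. Suc j < Suc n \<longrightarrow> ?K j) \<longleftrightarrow> ?K 0 \<and> (\<forall>j. Suc j < n \<longrightarrow> ?K (Suc j))"
    unfolding Suc_less_eq using All_less_Suc2[of k ?K] unfolding k by simp
  have 4: "group_hom (G (Suc 0)) (G 0) (\<phi> 0) \<longleftrightarrow> group (G 0) \<and> \<phi> 0 \<in> hom (G (Suc 0)) (G 0)" if ?P
    using that unfolding k by (auto simp: group_hom_def group_hom_axioms_def)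
  show ?case
    unfolding 1 2 3 Suc.IH using 4 by argo
qed

context preadditive_category
begin

lemma Hom_group_hom:
  assumes "f \<in> Hom C X Y" "N \<in> Obj C"
  shows "group_hom (Hom_group C N X) (Hom_group C N Y) (\<lambda>g. f \<cdot> g)"
    "group_hom (Hom_group C Y N) (Hom_group C X N) (\<lambda>g. g \<cdot> f)"
proof -
  have "X \<in> Obj C" "Y \<in> Obj C"
    using assms by auto
  then have G: "group (Hom_group C N X)" "group (Hom_group C N Y)" "group (Hom_group C Y N)"
    "group (Hom_group C X N)"
    using Hom_group_group assms(2) by blast+
  have "(\<lambda>g. f \<cdot> g) \<in> hom (Hom_group C N X) (Hom_group C N Y)"
    "(\<lambda>g. g \<cdot> f) \<in> hom (Hom_group C Y N) (Hom_group C X N)"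
    using assms by (simp_all add: hom_def Pi_def)
  with G show "group_hom (Hom_group C N X) (Hom_group C N Y) (\<lambda>g. f \<cdot> g)"
    "group_hom (Hom_group C Y N) (Hom_group C X N) (\<lambda>g. g \<cdot> f)"
    by (simp_all add: group_hom_def group_hom_axioms_def)
qed

lemma Hom_group_trivial_hom:
  assumes "X \<in> Obj C" "Y \<in> Obj C"
  shows "group_hom (singleton_group (Zero C X Y)) (Hom_group C X Y) (\<lambda>_. Zero C X Y)"
    "group_hom (Hom_group C X Y) (singleton_group z) (\<lambda>_. z)"
  using assms Hom_group_group[OF assms]
  by (auto simp: group_hom_def group_hom_axioms_def hom_def singleton_group_def
      intro: singleton_group[unfolded singleton_group_def])

lemma Hom_group_kernel:
  "kernel (Hom_group C N X) (Hom_group C N Y) \<phi> = {g \<in> Hom C N X. \<phi> g = Zero C N Y}"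
  "kernel (Hom_group C N X) (singleton_group z) (\<lambda>_. z) = Hom C N X"
  by (auto simp: kernel_def singleton_group_def)

end

context cluster_tilting_subcategory
begin

lemma objects_map_all:
  assumes "\<And>j. j \<le> n \<Longrightarrow> f j \<in> Hom C (X j) (X (Suc j))"
  shows "objects C (map f [0..<Suc n]) = map X [0..<Suc (Suc n)]"
  using objects_map[of n f X] assms
  by (intro nth_equalityI) (simp_all add: objects_def del: upt_Suc)

lemma d_kernel_iff:
  assumes f: "\<And>j. j \<le> d \<Longrightarrow> f j \<in> Hom C (X j) (X (Suc j))" and XM: "\<And>j. j \<le> Suc d \<Longrightarrow> X j \<in> M"
    and seq: "is_sequence C (map f [0..<Suc d])"
  shows "d_kernel C M d (butlast (map f [0..<Suc d])) (last (map f [0..<Suc d])) \<longleftrightarrow>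
    (\<forall>N\<in>M. \<forall>h\<in>Hom C N (X 0). f 0 \<cdot> h = Zero C N (X (Suc 0)) \<longrightarrow> h = Zero C N (X 0)) \<and>
    (\<forall>N\<in>M. \<forall>j<d. {h \<in> Hom C N (X (Suc j)). f (Suc j) \<cdot> h = Zero C N (X (Suc (Suc j)))} =
       (\<lambda>g. f j \<cdot> g) ` Hom C N (X j))"
proof -
  let ?fs = "map f [0..<Suc d]"
  have fs: "butlast ?fs @ [last ?fs] = ?fs"
    by simp
  have obj: "objects C ?fs = map X [0..<Suc (Suc d)]"
    using objects_map_all[of d f X] f by blast
  have hd: "Dom C (hd ?fs) = X 0"
    using f[of 0] by (simp add: hd_map del: upt_Suc)
  have Xo: "X j \<in> Obj C" if "j \<le> Suc d" for j
    using XM that by simp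
  have main: "(let z = Zero C N (Dom C (hd ?fs)) in
        exact_seq (rev (singleton_group z # map (\<lambda>X. Hom_group C N X) (objects C ?fs)),
                   rev ((\<lambda>_. z) # map (\<lambda>h g. h \<cdot> g) ?fs))) \<longleftrightarrow>
      (\<forall>h\<in>Hom C N (X 0). f 0 \<cdot> h = Zero C N (X (Suc 0)) \<longrightarrow> h = Zero C N (X 0)) \<and>
      (\<forall>j<d. {h \<in> Hom C N (X (Suc j)). f (Suc j) \<cdot> h = Zero C N (X (Suc (Suc j)))} =
       (\<lambda>g. f j \<cdot> g) ` Hom C N (X j))" if N: "N \<in> M" for N
  proof -
    let ?z = "Zero C N (X 0)"
    define G where "G = case_nat (singleton_group ?z) (\<lambda>j. Hom_group C N (X j))"
    define \<phi> where "\<phi> = case_nat (\<lambda>_. ?z) (\<lambda>j g. f j \<cdot> g)"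
    have N': "N \<in> Obj C"
      using N by simp
    have lists: "singleton_group ?z # map (\<lambda>X. Hom_group C N X) (objects C ?fs) = map G [0..<Suc (Suc (Suc d))]"
      "(\<lambda>_. ?z) # map (\<lambda>h g. h \<cdot> g) ?fs = map \<phi> [0..<Suc (Suc d)]"
      unfolding obj by (simp_all add: G_def \<phi>_def map_upt_Suc comp_def del: upt_Suc)
    have hom: "group_hom (G j) (G (Suc j)) (\<phi> j)" if "j < Suc (Suc d)" for j
      using that Hom_group_trivial_hom(1)[OF N' Xo[of 0]] Hom_group_hom(1)[OF f N']
      by (cases j) (simp_all add: G_def \<phi>_def)
    have z: "?z \<in> Hom C N (X 0)" "f 0 \<cdot> ?z = Zero C N (X (Suc 0))"
      using N' Xo[of 0] f[of 0] by simp_all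
    have "exact_seq (rev (map G [0..<Suc (Suc (Suc d))]), rev (map \<phi> [0..<Suc (Suc d)])) \<longleftrightarrow>
      (\<forall>j<Suc d. kernel (G (Suc j)) (G (Suc (Suc j))) (\<phi> (Suc j)) = \<phi> j ` carrier (G j))"
      using exact_seq_rev_iff[of "Suc (Suc d)" G \<phi>] hom by auto
    also have "\<dots> \<longleftrightarrow> {h \<in> Hom C N (X 0). f 0 \<cdot> h = Zero C N (X (Suc 0))} = {?z} \<and>
      (\<forall>j<d. {h \<in> Hom C N (X (Suc j)). f (Suc j) \<cdot> h = Zero C N (X (Suc (Suc j)))} =
       (\<lambda>g. f j \<cdot> g) ` Hom C N (X j))"
      unfolding All_less_Suc2
      by (simp add: G_def \<phi>_def Hom_group_kernel singleton_group_def del: Hom_iff)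
    also have "{h \<in> Hom C N (X 0). f 0 \<cdot> h = Zero C N (X (Suc 0))} = {?z} \<longleftrightarrow>
      (\<forall>h\<in>Hom C N (X 0). f 0 \<cdot> h = Zero C N (X (Suc 0)) \<longrightarrow> h = ?z)"
      using z by blast
    finally show ?thesis
      unfolding hd Let_def lists .
  qed
  have "set (objects C ?fs) \<subseteq> M"
    unfolding obj using XM by (auto simp del: upt_Suc)
  moreover have "length (butlast ?fs) = d"
    by simp
  ultimately have "d_kernel C M d (butlast ?fs) (last ?fs) \<longleftrightarrow>
    (\<forall>N\<in>M. let z = Zero C N (Dom C (hd ?fs)) in
        exact_seq (rev (singleton_group z # map (\<lambda>X. Hom_group C N X) (objects C ?fs)),
                   rev ((\<lambda>_. z) # map (\<lambda>h g. h \<cdot> g) ?fs)))"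
    unfolding d_kernel_def fs using seq by (simp only: simp_thms)
  then show ?thesis
    by (simp only: main ball_conj_distrib cong: ball_cong)
qed

lemma d_cokernelI:
  assumes f: "\<And>j. j \<le> d \<Longrightarrow> f j \<in> Hom C (X j) (X (Suc j))" and XM: "\<And>j. j \<le> Suc d \<Longrightarrow> X j \<in> M"
    and seq: "is_sequence C (map f [0..<Suc d])" and epi: "is_epi C (f d)"
    and zero: "\<And>j. j < d \<Longrightarrow> f (Suc j) \<cdot> f j = Zero C (X j) (X (Suc (Suc j)))"
    and hom: "\<And>j N h. \<lbrakk>j < d; N \<in> M; h \<in> Hom C (X (Suc j)) N; h \<cdot> f j = Zero C (X j) N\<rbrakk> \<Longrightarrow>
      \<exists>t\<in>Hom C (X (Suc (Suc j))) N. t \<cdot> f (Suc j) = h"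
  shows "d_cokernel C M d (hd (map f [0..<Suc d])) (tl (map f [0..<Suc d]))"
proof -
  let ?fs = "map f [0..<Suc d]"
  have fs: "hd ?fs # tl ?fs = ?fs"
    by (simp del: upt_Suc)
  have obj: "objects C ?fs = map X [0..<Suc (Suc d)]"
    using objects_map_all[of d f X] f by blast
  have last: "Cod C (last ?fs) = X (Suc d)"
    using f[of d] by simp
  have Xo: "X j \<in> Obj C" if "j \<le> Suc d" for j
    using XM that by simp
  have "let z = Zero C (Cod C (last ?fs)) N in
        exact_seq (map (\<lambda>X. Hom_group C X N) (objects C ?fs) @ [singleton_group z],
                   map (\<lambda>h g. g \<cdot> h) ?fs @ [\<lambda>_. z])" if N: "N \<in> M" for N
  proof -
    let ?z = "Zero C (X (Suc d)) N"
    define G where "G = (\<lambda>j. if j \<le> Suc d then Hom_group C (X j) N else singleton_group ?z)"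
    define \<phi> where "\<phi> = (\<lambda>j. if j \<le> d then (\<lambda>g. g \<cdot> f j) else (\<lambda>_. ?z))"
    have N': "N \<in> Obj C"
      using N by simp
    have "map (\<lambda>X. Hom_group C X N) (objects C ?fs) = map G [0..<Suc (Suc d)]"
      "map (\<lambda>h g. g \<cdot> h) ?fs = map \<phi> [0..<Suc d]"
      unfolding obj map_map comp_def by (auto simp: G_def \<phi>_def simp del: upt_Suc)
    moreover have "G (Suc (Suc d)) = singleton_group ?z" "\<phi> (Suc d) = (\<lambda>_. ?z)"
      by (simp_all add: G_def \<phi>_def)
    ultimately have lists: "map (\<lambda>X. Hom_group C X N) (objects C ?fs) @ [singleton_group ?z] = map G [0..<Suc (Suc (Suc d))]"
      "map (\<lambda>h g. g \<cdot> h) ?fs @ [\<lambda>_. ?z] = map \<phi> [0..<Suc (Suc d)]"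
      by (simp_all add: upt_Suc_append)
    have homs: "group_hom (G (Suc j)) (G j) (\<phi> j)" if "j < Suc (Suc d)" for j
    proof (cases "j \<le> d")
      case True
      then show ?thesis
        using Hom_group_hom(2)[OF f[OF True] N'] by (simp add: G_def \<phi>_def)
    next
      case False
      then have "j = Suc d"
        using that by simp
      then show ?thesis
        using Hom_group_trivial_hom(1)[OF Xo[of "Suc d"] N'] by (simp add: G_def \<phi>_def)
    qed
    have "kernel (G (Suc j)) (G j) (\<phi> j) = \<phi> (Suc j) ` carrier (G (Suc (Suc j)))" if j: "j < Suc d" for j
    proof -
      have k: "kernel (G (Suc j)) (G j) (\<phi> j) = {h \<in> Hom C (X (Suc j)) N. h \<cdot> f j = Zero C (X j) N}"
        using j by (auto simp: G_def \<phi>_def kernel_def)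
      show ?thesis
      proof (cases "j < d")
        case True
        have "t \<cdot> f (Suc j) \<in> Hom C (X (Suc j)) N \<and> (t \<cdot> f (Suc j)) \<cdot> f j = Zero C (X j) N"
          if t: "t \<in> Hom C (X (Suc (Suc j))) N" for t
          using t f[of j] f[of "Suc j"] True zero[OF True] Xo[of j] by simp
        then show ?thesis
          unfolding k using hom[OF True N] True
          by (auto simp: G_def \<phi>_def simp del: Hom_iff assoc)
      next
        case False
        then have jd: "j = d"
          using j by simp
        have "h = ?z" if "h \<in> Hom C (X (Suc d)) N" "h \<cdot> f d = Zero C (X d) N" for h
          using epi_zero[OF epi, of h] that f[of d] by simp
        moreover have "?z \<in> Hom C (X (Suc d)) N" "?z \<cdot> f d = Zero C (X d) N"
          using Xo[of "Suc d"] N' f[of d] by simp_all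
        ultimately have "{h \<in> Hom C (X (Suc j)) N. h \<cdot> f j = Zero C (X j) N} = {?z}"
          unfolding jd by blast
        then show ?thesis
          unfolding k by (simp add: jd G_def \<phi>_def singleton_group_def)
      qed
    qed
    then have "exact_seq (map G [0..<Suc (Suc (Suc d))], map \<phi> [0..<Suc (Suc d)])"
      using exact_seq_map_iff[of "Suc (Suc d)" G \<phi>] homs by simp
    then show ?thesis
      unfolding last Let_def lists .
  qed
  moreover have "set (objects C ?fs) \<subseteq> M"
    unfolding obj using XM by (auto simp del: upt_Suc)
  moreover have "length (tl ?fs) = d"
    by simp
  ultimately show ?thesis
    unfolding d_cokernel_def fs using seq by blast
qed

text \<open>The zero groups at both ends turn exactness next to them into injectivity and
  surjectivity; for \<open>d = 1\<close> both conditions meet at the only group.\<close>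

lemma torsion_exact_iff:
  assumes f: "\<And>j. j \<le> d \<Longrightarrow> f j \<in> Hom C (X j) (X (Suc j))" and V: "V \<in> Obj C"
  shows "(let Vs = drop 2 (objects C (map f [0..<Suc d])); z = Zero C V (hd Vs); z' = Zero C V (last Vs) in
          exact_seq
            (rev (singleton_group z # map (\<lambda>V'. Hom_group C V V') Vs @ [singleton_group z']),
             rev ((\<lambda>_. z) # map (\<lambda>h g. h \<cdot> g) (drop 2 (map f [0..<Suc d])) @ [\<lambda>_. z']))) \<longleftrightarrow>
    (\<forall>j<d. (if Suc j < d then {g \<in> Hom C V (X (Suc (Suc j))). f (Suc (Suc j)) \<cdot> g = Zero C V (X (Suc (Suc (Suc j))))}
            else Hom C V (X (Suc (Suc j)))) =
       (if j = 0 then {Zero C V (X (Suc (Suc 0)))} else (\<lambda>g. f (Suc j) \<cdot> g) ` Hom C V (X (Suc j))))"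
proof -
  have obj: "objects C (map f [0..<Suc d]) = map X [0..<Suc (Suc d)]"
    using objects_map_all[of d f X] f by blast
  have Vs: "drop 2 (objects C (map f [0..<Suc d])) = map (\<lambda>j. X (Suc (Suc j))) [0..<d]"
    unfolding obj by (intro nth_equalityI) (simp_all add: nth_append del: upt_Suc)
  have ds: "drop 2 (map f [0..<Suc d]) = map (\<lambda>j. f (Suc (Suc j))) [0..<d - 1]"
    using d by (intro nth_equalityI) (simp_all add: nth_append del: upt_Suc)
  have hd: "hd (map (\<lambda>j. X (Suc (Suc j))) [0..<d]) = X (Suc (Suc 0))"
    and last: "last (map (\<lambda>j. X (Suc (Suc j))) [0..<d]) = X (Suc d)"
    using d by (simp_all add: hd_map last_map)
  let ?z = "Zero C V (X (Suc (Suc 0)))" and ?z' = "Zero C V (X (Suc d))"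
  define G where "G = (\<lambda>j. if j = 0 then singleton_group ?z else if j \<le> d then Hom_group C V (X (Suc j))
    else singleton_group ?z')"
  define \<phi> where "\<phi> = (\<lambda>j. if j = 0 then (\<lambda>_. ?z) else if j < d then (\<lambda>g. f (Suc j) \<cdot> g) else (\<lambda>_. ?z'))"
  have Xo: "X j \<in> Obj C" if "j \<le> Suc d" for j
  proof (cases "j \<le> d")
    case True
    then show ?thesis
      using f[of j] by (metis Hom_iff dom_obj)
  next
    case False
    then have "j = Suc d"
      using that by simp
    then show ?thesis
      using f[of d] by (metis Hom_iff cod_obj le_refl)
  qed
  have G1: "map (\<lambda>V'. Hom_group C V V') (map (\<lambda>j. X (Suc (Suc j))) [0..<d]) = map (\<lambda>j. G (Suc j)) [0..<d]"
    "map (\<lambda>h g. h \<cdot> g) (map (\<lambda>j. f (Suc (Suc j))) [0..<d - 1]) = map (\<lambda>j. \<phi> (Suc j)) [0..<d - 1]"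
    unfolding map_map comp_def by (auto simp: G_def \<phi>_def simp del: upt_Suc)
  have G2: "G (Suc d) = singleton_group ?z'" "\<phi> d = (\<lambda>_. ?z')" "G 0 = singleton_group ?z" "\<phi> 0 = (\<lambda>_. ?z)"
    using d by (simp_all add: G_def \<phi>_def)
  have "map G [0..<Suc (Suc d)] = G 0 # map (\<lambda>j. G (Suc j)) [0..<Suc d]"
    "map \<phi> [0..<Suc d] = \<phi> 0 # map (\<lambda>j. \<phi> (Suc j)) [0..<d]"
    by (simp_all only: map_upt_Suc)
  moreover have "map (\<lambda>j. \<phi> (Suc j)) [0..<d] = map (\<lambda>j. \<phi> (Suc j)) [0..<d - 1] @ [\<phi> d]"
    using d by (cases d) simp_all
  ultimately have lists: "singleton_group ?z # map (\<lambda>V'. Hom_group C V V') (map (\<lambda>j. X (Suc (Suc j))) [0..<d]) @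
      [singleton_group ?z'] = map G [0..<Suc (Suc d)]"
    "(\<lambda>_. ?z) # map (\<lambda>h g. h \<cdot> g) (map (\<lambda>j. f (Suc (Suc j))) [0..<d - 1]) @ [\<lambda>_. ?z'] = map \<phi> [0..<Suc d]"
    unfolding G1 by (simp_all add: G2)
  have homs: "group_hom (G j) (G (Suc j)) (\<phi> j)" if j: "j < Suc d" for j
  proof -
    consider "j = 0" | "0 < j" "j < d" | "0 < j" "j = d"
      using j by linarith
    then show ?thesis
    proof cases
      case 1
      then show ?thesis
        using Hom_group_trivial_hom(1)[OF V Xo[of "Suc (Suc 0)"]] d by (simp add: G_def \<phi>_def)
    next
      case 2
      then show ?thesis
        using Hom_group_hom(1)[OF f[of "Suc j"] V] by (simp add: G_def \<phi>_def)
    next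
      case 3
      then show ?thesis
        using Hom_group_trivial_hom(2)[OF V Xo[of "Suc d"]] by (simp add: G_def \<phi>_def)
    qed
  qed
  have "exact_seq (rev (map G [0..<Suc (Suc d)]), rev (map \<phi> [0..<Suc d])) \<longleftrightarrow>
    (\<forall>j<d. kernel (G (Suc j)) (G (Suc (Suc j))) (\<phi> (Suc j)) = \<phi> j ` carrier (G j))"
    using exact_seq_rev_iff[of "Suc d" G \<phi>] homs by simp
  also have "\<dots> \<longleftrightarrow> (\<forall>j<d. (if Suc j < d then {g \<in> Hom C V (X (Suc (Suc j))). f (Suc (Suc j)) \<cdot> g = Zero C V (X (Suc (Suc (Suc j))))}
            else Hom C V (X (Suc (Suc j)))) =
       (if j = 0 then {?z} else (\<lambda>g. f (Suc j) \<cdot> g) ` Hom C V (X (Suc j))))"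
    (is "(\<forall>j<d. ?A j = ?B j) \<longleftrightarrow> (\<forall>j<d. ?A' j = ?B' j)")
  proof -
    have "?A j = ?A' j" if "j < d" for j
      using that by (simp add: G_def \<phi>_def Hom_group_kernel del: Hom_iff)
    moreover have "?B j = ?B' j" if "j < d" for j
      using that by (simp add: G_def \<phi>_def singleton_group_def del: Hom_iff)
    ultimately show ?thesis
      by simp
  qed
  finally show ?thesis
    unfolding Vs ds hd last Let_def lists .
qed

text \<open>In the sequence \<open>Hom(V, X\<^sub>2) \<rightarrow> \<dots> \<rightarrow> Hom(V, X\<^bsub>d+1\<^esub>)\<close>, injectivity of the first map makes maps
  \<open>V \<rightarrow> Q\<close> factor through \<open>X\<^sub>0\<close>, and surjectivity of the last one is what
  \<open>ext_injective_of_hom_exact\<close> requires.\<close>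

lemma d_torsion_classE:
  assumes U: "d_torsion_class C M d U" and Q: "Q \<in> M"
  obtains X f where "hom_exact X f" "X 0 \<in> U" "X 1 = Q"
    "\<And>V t. \<lbrakk>V \<in> U; t \<in> Hom C V Q\<rbrakk> \<Longrightarrow> \<exists>t'\<in>Hom C V (X 0). f 0 \<cdot> t' = t"
    "\<And>V g. \<lbrakk>V \<in> U; g \<in> Hom C V (X (Suc d))\<rbrakk> \<Longrightarrow> \<exists>t\<in>Hom C V (X d). f d \<cdot> t = g"
proof -
  have UM: "U \<subseteq> M"
    using U unfolding d_torsion_class_def by blast
  obtain fs where fs: "d_exact C M d fs" "objects C fs ! 0 \<in> U" "objects C fs ! 1 = Q"
    "\<forall>V\<in>U. let Vs = drop 2 (objects C fs); z = Zero C V (hd Vs); z' = Zero C V (last Vs) in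
          exact_seq
            (rev (singleton_group z # map (\<lambda>V'. Hom_group C V V') Vs @ [singleton_group z']),
             rev ((\<lambda>_. z) # map (\<lambda>h g. h \<cdot> g) (drop 2 fs) @ [\<lambda>_. z']))"
    using U Q unfolding d_torsion_class_def by blast
  define X where "X = nth (objects C fs)"
  define f where "f = nth fs"
  have len: "length fs = Suc d" and ker: "d_kernel C M d (butlast fs) (last fs)"
    using fs(1) unfolding d_exact_def by auto
  have fs_eq: "fs = map f [0..<Suc d]"
    unfolding f_def using map_nth[of fs] len by simp
  have bl: "butlast fs @ [last fs] = fs"
    using len by (intro append_butlast_last_id) auto
  have seq: "is_sequence C fs" and objM: "set (objects C fs) \<subseteq> M"
    using ker unfolding d_kernel_def bl by blast+
  have fH: "f j \<in> Hom C (X j) (X (Suc j))" if "j \<le> d" for j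
    using sequence_nth[OF seq, of j] that len unfolding f_def X_def by simp
  have XM: "X j \<in> M" if "j \<le> Suc d" for j
    using objM that len nth_mem[of j "objects C fs"] unfolding X_def by (auto simp: objects_def)
  have K: "(\<forall>N\<in>M. \<forall>h\<in>Hom C N (X 0). f 0 \<cdot> h = Zero C N (X (Suc 0)) \<longrightarrow> h = Zero C N (X 0)) \<and>
    (\<forall>N\<in>M. \<forall>j<d. {h \<in> Hom C N (X (Suc j)). f (Suc j) \<cdot> h = Zero C N (X (Suc (Suc j)))} =
       (\<lambda>g. f j \<cdot> g) ` Hom C N (X j))"
    using d_kernel_iff[of f X, OF fH XM] seq ker unfolding fs_eq[symmetric] by blast
  have "is_mono C (f 0)"
  proof (rule monoI)
    show "f 0 \<in> Arr C"
      using fH[of 0] by simp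
    fix g assume g: "g \<in> Arr C" "Cod C g = Dom C (f 0)" "f 0 \<cdot> g = Zero C (Dom C g) (Cod C (f 0))"
    obtain i p where p: "ses i p" "Cod C p = Dom C g" "Dom C p \<in> M"
      using cover[of "Dom C g"] g by auto
    note A = ses_arr[OF p(1)]
    have f0: "f 0 \<in> Hom C (X 0) (X (Suc 0))"
      using fH[of 0] by simp
    have X1: "X (Suc 0) \<in> Obj C"
      using XM[of "Suc 0"] by simp
    have gp: "g \<cdot> p \<in> Hom C (Dom C p) (X 0)"
      using g p(2) A f0 by simp
    have "f 0 \<cdot> (g \<cdot> p) = Zero C (Dom C p) (X (Suc 0))"
      using comp_eqD'[OF g(3), of p] g(1,2) p(2) A f0 X1 by simp
    then have "g \<cdot> p = Zero C (Dom C p) (X 0)"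
      using K p(3) gp by blast
    then show "g = Zero C (Dom C g) (Dom C (f 0))"
      using epi_zero[OF A(6), of g] g(1,2) p(2) f0 by simp
  qed
  moreover have "f (Suc j) \<cdot> f j = Zero C (X j) (X (Suc (Suc j)))" if j: "j < d" for j
  proof -
    have fj: "f j \<in> Hom C (X j) (X (Suc j))" "X j \<in> M"
      using fH[of j] XM[of j] j by auto
    have "f j \<in> (\<lambda>g. f j \<cdot> g) ` Hom C (X j) (X j)"
      using fj by (intro image_eqI[of _ _ "Ident C (X j)"]) simp_all
    then show ?thesis
      using K fj(2) j by blast
  qed
  moreover have "\<exists>t\<in>Hom C P (X j). f j \<cdot> t = h"
    if "P \<in> M" "j < d" "h \<in> Hom C P (X (Suc j))" "f (Suc j) \<cdot> h = Zero C P (X (Suc (Suc j)))" for P j h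
  proof -
    have eq: "{h \<in> Hom C P (X (Suc j)). f (Suc j) \<cdot> h = Zero C P (X (Suc (Suc j)))} =
       (\<lambda>g. f j \<cdot> g) ` Hom C P (X j)"
      using K that(1,2) by blast
    have "h \<in> {h \<in> Hom C P (X (Suc j)). f (Suc j) \<cdot> h = Zero C P (X (Suc (Suc j)))}"
      using that(3,4) by blast
    then have "h \<in> (\<lambda>g. f j \<cdot> g) ` Hom C P (X j)"
      unfolding eq .
    then show ?thesis
      by (auto simp del: Hom_iff)
  qed
  ultimately have X: "hom_exact X f"
    unfolding hom_exact_def using fH XM by blast
  have T: "(if Suc j < d then {g \<in> Hom C V (X (Suc (Suc j))). f (Suc (Suc j)) \<cdot> g = Zero C V (X (Suc (Suc (Suc j))))}
            else Hom C V (X (Suc (Suc j)))) =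
       (if j = 0 then {Zero C V (X (Suc (Suc 0)))} else (\<lambda>g. f (Suc j) \<cdot> g) ` Hom C V (X (Suc j)))"
    if V: "V \<in> U" and j: "j < d" for V j
  proof -
    have Vo: "V \<in> Obj C"
      using V UM by auto
    note T = iffD1[OF torsion_exact_iff[of f X V, OF fH Vo, folded fs_eq] bspec[OF fs(4) V]]
    show ?thesis
      by (rule T[rule_format, OF _ j])
  qed
  have 1: "\<exists>t'\<in>Hom C V (X 0). f 0 \<cdot> t' = t" if V: "V \<in> U" and t: "t \<in> Hom C V Q" for V t
  proof -
    have VM: "V \<in> M"
      using V UM by blast
    have t': "t \<in> Hom C V (X (Suc 0))"
      using t fs(3) unfolding X_def by simp
    have f1: "f (Suc 0) \<in> Hom C (X (Suc 0)) (X (Suc (Suc 0)))"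
      using fH[of "Suc 0"] d by simp
    have g: "f (Suc 0) \<cdot> t \<in> Hom C V (X (Suc (Suc 0)))"
      using t' f1 by simp
    have "f (Suc (Suc 0)) \<cdot> f (Suc 0) \<cdot> t = Zero C V (X (Suc (Suc (Suc 0))))" if d2: "Suc 0 < d"
    proof -
      have f2: "f (Suc (Suc 0)) \<in> Hom C (X (Suc (Suc 0))) (X (Suc (Suc (Suc 0))))"
        "X (Suc (Suc (Suc 0))) \<in> Obj C"
        using fH[of "Suc (Suc 0)"] XM[of "Suc (Suc (Suc 0))"] d2 by auto
      show ?thesis
        using comp_eqD'[OF hom_exactD(4)[OF X d2], of t] t' f1 f2 by simp
    qed
    then have "f (Suc 0) \<cdot> t = Zero C V (X (Suc (Suc 0)))"
      using T[OF V, of 0] g d by (auto split: if_splits simp del: Hom_iff)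
    then show ?thesis
      using hom_exact_lift[OF X VM _ t'] d by (metis less_le_trans zero_less_one)
  qed
  have 2: "\<exists>t\<in>Hom C V (X d). f d \<cdot> t = g" if V: "V \<in> U" and g: "g \<in> Hom C V (X (Suc d))" for V g
  proof (cases "d = 1")
    case True
    have "Zero C V (X 1) \<in> Hom C V (X 1)" "f 1 \<cdot> Zero C V (X 1) = Zero C V (X (Suc (Suc 0)))"
      using V UM XM[of 1] fH[of 1] True by auto
    moreover have "g = Zero C V (X (Suc (Suc 0)))"
      using T[OF V, of 0] g True by (simp del: Hom_iff)
    ultimately show ?thesis
      unfolding True by blast
  next
    case False
    then obtain k where k: "d = Suc k" "k \<noteq> 0"
      using d by (cases d) auto
    then show ?thesis
      using T[OF V, of k] g by (auto simp del: Hom_iff)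
  qed
  show ?thesis
    using that[OF X _ _ 1 2] fs(2,3) unfolding X_def by blast
qed

text \<open>For \<open>V \<in> U\<close>, a map \<open>V \<rightarrow> X\<^sub>2\<close> killed by \<open>X\<^sub>2 \<rightarrow> X\<^sub>3\<close> comes from a map \<open>V \<rightarrow> X\<^sub>1 = Q\<close>, which factors
  through \<open>X\<^sub>0\<close>, and so it is zero.  Injectivity on \<open>Ext\<^sup>d\<close> makes \<open>Hom(V, X\<^sub>d) \<rightarrow> Hom(V, X\<^bsub>d+1\<^esub>)\<close> surjective.\<close>

lemma d_torsion_classI:
  assumes U: "subcategory C U" "U \<subseteq> M"
    and seq: "\<And>Q. Q \<in> M \<Longrightarrow> \<exists>j. is_mono C j \<and> Dom C j \<in> U \<and> Cod C j = Q \<and>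
      (\<forall>V\<in>U. ext_injective V j \<and> (\<forall>t\<in>Hom C V Q. \<exists>t'\<in>Hom C V (Dom C j). j \<cdot> t' = t))"
  shows "d_torsion_class C M d U"
  unfolding d_torsion_class_def
proof (intro conjI ballI U)
  fix Q assume Q: "Q \<in> M"
  obtain j0 where j0: "is_mono C j0" "Dom C j0 \<in> U" "Cod C j0 = Q"
    "\<And>V. V \<in> U \<Longrightarrow> ext_injective V j0"
    "\<And>V t. \<lbrakk>V \<in> U; t \<in> Hom C V Q\<rbrakk> \<Longrightarrow> \<exists>t'\<in>Hom C V (Dom C j0). j0 \<cdot> t' = t"
    using seq[OF Q] by blast
  have jM: "Dom C j0 \<in> M" "Cod C j0 \<in> M"
    using j0 U Q by auto
  obtain X f where X: "exact_sequence X f d" "is_epi C (f d)" "f 0 = j0" "X 0 = Dom C j0" "X 1 = Cod C j0"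
    and XM: "\<And>j. j \<le> Suc d \<Longrightarrow> X j \<in> M"
    and cok: "\<And>j N h. \<lbrakk>j < d; N \<in> M; h \<in> Hom C (X (Suc j)) N; h \<cdot> f j = Zero C (X j) N\<rbrakk> \<Longrightarrow>
      \<exists>t\<in>Hom C (X (Suc (Suc j))) N. t \<cdot> f (Suc j) = h"
    by (rule mono_sequence[OF j0(1) jM]) (rule that, assumption+)
  have fH: "f j \<in> Hom C (X j) (X (Suc j))" if "j \<le> d" for j
    using exact_sequence_arr[OF X(1) that] by simp
  have zero: "f (Suc j) \<cdot> f j = Zero C (X j) (X (Suc (Suc j)))" if "j < d" for j
    using exact_sequence_zero[OF X(1), of j] that by simp
  have XM': "X j \<in> M" if "j \<le> d" for j
    using XM[of j] that by simp
  have lift: "\<exists>t\<in>Hom C P (X j). f j \<cdot> t = h"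
    if "P \<in> M" "j < d" "h \<in> Hom C P (X (Suc j))" "f (Suc j) \<cdot> h = Zero C P (X (Suc (Suc j)))" for P j h
    using exact_sequence_hom_exact[OF X(1) XM' that(2) M_acyclic[OF that(1,2)] that(3,4)] by blast
  have kerim: "{h \<in> Hom C P (X (Suc j)). f (Suc j) \<cdot> h = Zero C P (X (Suc (Suc j)))} =
       (\<lambda>g. f j \<cdot> g) ` Hom C P (X j)" if P: "P \<in> M" and j: "j < d" for P j
  proof -
    have "f j \<cdot> g \<in> Hom C P (X (Suc j)) \<and> f (Suc j) \<cdot> f j \<cdot> g = Zero C P (X (Suc (Suc j)))"
      if g: "g \<in> Hom C P (X j)" for g
    proof -
      have "X (Suc (Suc j)) \<in> Obj C"
        using XM[of "Suc (Suc j)"] j by simp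
      then show ?thesis
        using comp_eqD'[OF zero[OF j], of g] fH[of j] fH[of "Suc j"] g j by simp
    qed
    then show ?thesis
      using lift[OF P j] by blast
  qed
  let ?fs = "map f [0..<Suc d]"
  have "is_extension X f d (X (Suc d)) (X 0)"
    using X(1,2) unfolding is_extension_def by blast
  then have sq: "is_sequence C ?fs"
    using extension_of_functions unfolding extensions_def by blast
  have "h = Zero C N (X 0)"
    if "N \<in> M" "h \<in> Hom C N (X 0)" "f 0 \<cdot> h = Zero C N (X (Suc 0))" for N h
    using mono_zero[OF j0(1), of h] X fH[of 0] that by simp
  then have "d_kernel C M d (butlast ?fs) (last ?fs)"
    using d_kernel_iff[of f X] fH XM sq kerim by blast
  moreover have "d_cokernel C M d (hd ?fs) (tl ?fs)"
    by (rule d_cokernelI[of f X, OF fH XM sq X(2) zero cok])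
  ultimately have ex: "d_exact C M d ?fs"
    unfolding d_exact_def by simp
  have obj: "objects C ?fs = map X [0..<Suc (Suc d)]"
    using objects_map_all[of d f X] fH by blast
  have o01: "objects C ?fs ! 0 \<in> U" "objects C ?fs ! 1 = Q"
    unfolding obj using X(4,5) j0(2,3) by (simp_all del: upt_Suc)
  have "let Vs = drop 2 (objects C ?fs); z = Zero C V (hd Vs); z' = Zero C V (last Vs) in
          exact_seq
            (rev (singleton_group z # map (\<lambda>V'. Hom_group C V V') Vs @ [singleton_group z']),
             rev ((\<lambda>_. z) # map (\<lambda>h g. h \<cdot> g) (drop 2 ?fs) @ [\<lambda>_. z']))" if V: "V \<in> U" for V
  proof -
    have VM: "V \<in> M"
      using V U by blast
    then have Vo: "V \<in> Obj C"
      by simp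
    have X2: "X (Suc (Suc 0)) \<in> Obj C"
      using XM[of "Suc (Suc 0)"] d by simp
    have f1: "f (Suc 0) \<in> Hom C (X (Suc 0)) (X (Suc (Suc 0)))" "f (Suc 0) \<cdot> f 0 = Zero C (X 0) (X (Suc (Suc 0)))"
      using fH[of "Suc 0"] zero[of 0] d by auto
    have f0: "f 0 \<in> Hom C (X 0) (X (Suc 0))"
      using fH[of 0] by simp
    have f1t: "f (Suc 0) \<cdot> t = Zero C V (X (Suc (Suc 0)))" if t: "t \<in> Hom C V (X (Suc 0))" for t
    proof -
      obtain t' where t': "t' \<in> Hom C V (X 0)" "f 0 \<cdot> t' = t"
        using j0(5)[OF V, of t] t X(3-5) j0(3) by auto
      show ?thesis
        using comp_eqD'[OF f1(2), of t'] t' f1(1) f0 X2 by simp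
    qed
    have top: "\<exists>t\<in>Hom C V (X d). f d \<cdot> t = g" if g: "g \<in> Hom C V (X (Suc d))" for g
    proof -
      have "ext_injective V (f 0)"
        using j0(4)[OF V] X(3) by simp
      moreover have "liftable (f d) g"
        using liftable_epi[OF X(2), of g V] g fH[of d] by simp
      ultimately show ?thesis
        using syzygy_lift_top[OF X(1) XM' VM _ _ syzygy.zero, of "d - 1" g] g d by simp
    qed
    have "(if Suc j < d then {g \<in> Hom C V (X (Suc (Suc j))). f (Suc (Suc j)) \<cdot> g = Zero C V (X (Suc (Suc (Suc j))))}
            else Hom C V (X (Suc (Suc j)))) =
       (if j = 0 then {Zero C V (X (Suc (Suc 0)))} else (\<lambda>g. f (Suc j) \<cdot> g) ` Hom C V (X (Suc j)))"
      (is "?A = ?B") if j: "j < d" for j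
    proof -
      have A: "?A = (\<lambda>g. f (Suc j) \<cdot> g) ` Hom C V (X (Suc j))"
      proof (cases "Suc j < d")
        case True
        then show ?thesis
          using kerim[OF VM True] by simp
      next
        case False
        then have jd: "d = Suc j"
          using j by simp
        have "(\<lambda>g. f d \<cdot> g) ` Hom C V (X d) \<subseteq> Hom C V (X (Suc d))"
          using fH[of d] by auto
        then have "(\<lambda>g. f d \<cdot> g) ` Hom C V (X d) = Hom C V (X (Suc d))"
          using top by blast
        then show ?thesis
          using jd by simp
      qed
      show ?thesis
      proof (cases "j = 0")
        case True
        have mem: "Zero C V (X (Suc 0)) \<in> Hom C V (X (Suc 0))"
          using Vo XM[of "Suc 0"] by simp
        have "(\<lambda>g. f (Suc 0) \<cdot> g) ` Hom C V (X (Suc 0)) = (\<lambda>g. Zero C V (X (Suc (Suc 0)))) ` Hom C V (X (Suc 0))"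
          by (rule image_cong[OF refl f1t])
        also have "\<dots> = {Zero C V (X (Suc (Suc 0)))}"
          by (rule image_constant[OF mem])
        finally have "(\<lambda>g. f (Suc 0) \<cdot> g) ` Hom C V (X (Suc 0)) = {Zero C V (X (Suc (Suc 0)))}" .
        then show ?thesis
          unfolding A using True by simp
      qed (use A in simp)
    qed
    then show ?thesis
      using torsion_exact_iff[of f X V] fH Vo by blast
  qed
  then show "\<exists>fs. d_exact C M d fs \<and> objects C fs ! 0 \<in> U \<and> objects C fs ! 1 = Q \<and>
       (\<forall>V\<in>U. let Vs = drop 2 (objects C fs); z = Zero C V (hd Vs); z' = Zero C V (last Vs) in
          exact_seq
            (rev (singleton_group z # map (\<lambda>V'. Hom_group C V V') Vs @ [singleton_group z']),
             rev ((\<lambda>_. z) # map (\<lambda>h g. h \<cdot> g) (drop 2 fs) @ [\<lambda>_. z'])))"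
    using ex o01 by blast
qed

text \<open>The monomorphism of least length with both properties plays the role of the torsion
  subobject that one gets by applying the torsion radicals of the family again and again.\<close>

lemma d_torsion_class_Inter:
  assumes S: "\<And>U. U \<in> S \<Longrightarrow> d_torsion_class C M d U"
  shows "d_torsion_class C M d (M \<inter> \<Inter>S)"
proof (rule d_torsion_classI)
  let ?I = "M \<inter> \<Inter>S"
  have subS: "subcategory C U" "U \<subseteq> M" if "U \<in> S" for U
    using S[OF that] unfolding d_torsion_class_def by auto
  show "subcategory C ?I"
    using sub subS(1) unfolding subcategory_def by blast
  show "?I \<subseteq> M"
    by blast
  fix Q assume Q: "Q \<in> M"
  define good where "good = (\<lambda>j. is_mono C j \<and> Dom C j \<in> M \<and> Cod C j = Q \<and>
      (\<forall>V\<in>?I. ext_injective V j \<and> (\<forall>t\<in>Hom C V Q. \<exists>t'\<in>Hom C V (Dom C j). j \<cdot> t' = t)))"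
  have Qo: "Q \<in> Obj C"
    using Q by simp
  have "good (Ident C Q)"
    unfolding good_def using Q Qo ident_mono ext_injective_ident by auto
  moreover obtain n where "composition_length n Q"
    using composition_length_of_series[OF finite_length[OF Qo]] by blast
  ultimately have "\<exists>n j. good j \<and> composition_length n (Dom C j)"
    using Qo by (metis ident_arr(2))
  then obtain n where n: "\<exists>j. good j \<and> composition_length n (Dom C j)"
    "\<And>n'. n' < n \<Longrightarrow> \<not> (\<exists>j. good j \<and> composition_length n' (Dom C j))"
    using exists_least_iff[of "\<lambda>n. \<exists>j. good j \<and> composition_length n (Dom C j)"] by blast
  then obtain j where j: "good j" "composition_length n (Dom C j)"
    by blast
  have jg: "is_mono C j" "Dom C j \<in> M" "Cod C j = Q"
    using j(1) unfolding good_def by auto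
  have "Dom C j \<in> U" if U: "U \<in> S" for U
  proof -
    obtain X f where X: "hom_exact X f" "X 0 \<in> U" "X 1 = Dom C j"
      "\<And>V t. \<lbrakk>V \<in> U; t \<in> Hom C V (Dom C j)\<rbrakk> \<Longrightarrow> \<exists>t'\<in>Hom C V (X 0). f 0 \<cdot> t' = t"
      "\<And>V g. \<lbrakk>V \<in> U; g \<in> Hom C V (X (Suc d))\<rbrakk> \<Longrightarrow> \<exists>t\<in>Hom C V (X d). f d \<cdot> t = g"
      by (rule d_torsion_classE[OF S[OF U] jg(2)]) (rule that, assumption+)
    have f0: "f 0 \<in> Hom C (X 0) (Dom C j)" "is_mono C (f 0)"
      using hom_exactD(1)[OF X(1), of 0] hom_exactD(3)[OF X(1)] X(3) by simp_all
    have jf: "j \<cdot> f 0 \<in> Hom C (X 0) Q"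
      using f0 jg mono_arr[OF jg(1)] by simp
    have "good (j \<cdot> f 0)"
      unfolding good_def
    proof (intro conjI ballI)
      show "is_mono C (j \<cdot> f 0)"
        using mono_comp[OF f0(2) jg(1)] f0 by simp
      show "Dom C (j \<cdot> f 0) \<in> M" "Cod C (j \<cdot> f 0) = Q"
        using jf X(2) subS(2)[OF U] by auto
      fix V assume V: "V \<in> ?I"
      have VU: "V \<in> U" "V \<in> M"
        using V U by auto
      have jV: "ext_injective V j" "\<And>t. t \<in> Hom C V Q \<Longrightarrow> \<exists>t'\<in>Hom C V (Dom C j). j \<cdot> t' = t"
        using j(1) V unfolding good_def by blast+
      have "ext_injective V (f 0)"
        using ext_injective_of_hom_exact[OF X(1) VU(2) X(5)[OF VU(1)]] .
      then show "ext_injective V (j \<cdot> f 0)"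
        by (rule ext_injective_comp[OF _ jV(1)]) (use f0 mono_arr[OF jg(1)] in simp_all)
      fix t assume t: "t \<in> Hom C V Q"
      obtain t' where t': "t' \<in> Hom C V (Dom C j)" "j \<cdot> t' = t"
        using jV(2)[OF t] by blast
      obtain t'' where t'': "t'' \<in> Hom C V (X 0)" "f 0 \<cdot> t'' = t'"
        using X(4)[OF VU(1) t'(1)] by blast
      have "(j \<cdot> f 0) \<cdot> t'' = t"
        using t' t'' f0 mono_arr[OF jg(1)] by simp
      then show "\<exists>t'\<in>Hom C V (Dom C (j \<cdot> f 0)). (j \<cdot> f 0) \<cdot> t' = t"
        using t''(1) jf by auto
    qed
    moreover obtain n' where n': "n' \<le> n" "composition_length n' (X 0)" "n' = n \<longrightarrow> is_iso C (f 0)"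
      using composition_length_subobject[OF j(2) f0(2)] f0(1) by auto
    moreover have "Dom C (j \<cdot> f 0) = X 0"
      using jf by simp
    ultimately have "n' = n"
      using n(2)[of n'] by (metis le_neq_implies_less)
    then have "isomorphic C (X 0) (Dom C j)"
      using n'(3) f0(1) unfolding isomorphic_def by blast
    then show ?thesis
      using subS(1)[OF U] X(2) unfolding subcategory_def by blast
  qed
  then have "Dom C j \<in> ?I"
    using jg(2) by blast
  then show "\<exists>j. is_mono C j \<and> Dom C j \<in> ?I \<and> Cod C j = Q \<and>
      (\<forall>V\<in>?I. ext_injective V j \<and> (\<forall>t\<in>Hom C V Q. \<exists>t'\<in>Hom C V (Dom C j). j \<cdot> t' = t))"
    using j(1) unfolding good_def by blast
qed

end

theorem theorem1p2:
  fixes C :: "('o, 'm, 'z) preadd_cat_scheme" and d :: nat and \<M> :: "'o set"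
  assumes "abelian_length_category C"
    and "d \<ge> 1"
    and "cluster_tilting C d \<M>"
  shows "complete_lattice (d_tors C \<M> d) \<and>
    (\<forall>\<S>. \<S> \<subseteq> carrier (d_tors C \<M> d) \<longrightarrow> \<Sqinter>\<^bsub>d_tors C \<M> d\<^esub> \<S> = \<M> \<inter> \<Inter>\<S>)"
proof -
  interpret cluster_tilting_subcategory C \<M> d
    using assms by (simp add: cluster_tilting_subcategory_def cluster_tilting_subcategory_axioms_def)
  let ?L = "d_tors C \<M> d"
  interpret L: partial_order ?L
    by unfold_locales (auto simp: d_tors_def)
  have sub_M: "U \<subseteq> \<M>" if "U \<in> carrier ?L" for U
    using that by (simp add: d_tors_def d_torsion_class_def)
  have glb: "greatest ?L (\<M> \<inter> \<Inter>\<S>) (Lower ?L \<S>)" if S: "\<S> \<subseteq> carrier ?L" for \<S>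
  proof -
    have "\<M> \<inter> \<Inter>\<S> \<in> carrier ?L"
      using d_torsion_class_Inter[of \<S>] S by (auto simp: d_tors_def)
    then show ?thesis
      using sub_M S by (auto simp: greatest_def Lower_def d_tors_def)
  qed
  have "complete_lattice ?L"
  proof (rule L.complete_lattice_criterion1)
    show "\<exists>g. greatest ?L g (carrier ?L)"
      using glb[of "{}"] by (auto simp: Lower_def)
  qed (use glb in blast)
  moreover have "\<Sqinter>\<^bsub>?L\<^esub> \<S> = \<M> \<inter> \<Inter>\<S>" if S: "\<S> \<subseteq> carrier ?L" for \<S>
    unfolding inf_def using glb[OF S] L.greatest_unique by (intro some_equality) blast+
  ultimately show ?thesis
    by blast
qed

end
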